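(* Let $M=M(b;(a_1,b_1),(a_2,b_2),(a_3,b_3))$ be a negative definite Seifert manifold with $b_1(M)=0$, let $j\ge1$ be an integer, $\omega$ a $2j$-th root of unity, and $W$ an admissible family. Let $A=a_1a_2a_3$, $\overline{a_i}=A/a_i$ and $$f_0(\omega,z)=\frac{\prod_{i=1}^3\left(z^{\overline{a_i}}\omega^{-1}-z^{-\overline{a_i}}\omega\right)}{z^{A}\omega^{-1}-z^{-A}\omega}.$$ Then the one-variable series $\mathcal{L}_A(\mathrm{a.e.}_{W_3(1)}(f_0(\omega,z)))$ is, up to normalization, a sum of quantum modular and modular forms of weight $\frac12$ with respect to $\Gamma(4a_1a_2a_3j^2)\subset\mathrm{SL}(2,\mathbb{Z})$. Specifically, $$\mathcal{L}_A\big(\mathrm{a.e.}_{W_3(1)}(f_0(\omega,z))\big)=p(q)+\theta_f+\left(\tfrac12-W_3(1)\right)\Theta_f,$$ where $p(q)$ is a polynomial (a finite $\mathbb{C}$-linear combination of powers $q^{n^2/(4A)}$, $n\in\mathbb{Z}$), $\theta_f$ is a quantum modular form of weight $\frac12$ and $\Theta_f$ is a modular form of weight $\frac12$, both with respect to $\Gamma(4a_1a_2a_3j^2)$.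
   Context: $M(b;(a_1,b_1),(a_2,b_2),(a_3,b_3))$, with $a_i>0$ and $\gcd(a_i,b_i)=1$, is the Seifert manifold given by the star-shaped plumbing tree with a degree-3 node of weight $-b$ and three legs whose weights (outwards from the node) are the negatives of the entries of the continued fractions $\frac{a_i}{b_i}=c^i_1-\frac{1}{c^i_2-\cdots}$; negative definite means its plumbing matrix (weights on the diagonal, $1$ for each edge, $0$ otherwise) is negative definite. An admissible family is a family of functions $W=\{W_n:\mathbb{Z}\to\frac12\mathbb{Z}\}_{n\ge0}$ such that $W_2(0)=1$, $W_2(r)=0$ for $r\ne0$, and $W_n(r+1)-W_n(r-1)=W_{n-1}(r)$ for all $n\ge1$, $r\in\mathbb{Z}$. If $f$ has Laurent expansions $\sum_k a_kz^k$ centered at $z=0$ and $\sum_k b_kz^{-k}$ centered at $z=\infty$, then for $y\in\mathbb{R}$, $\mathrm{a.e.}_y(f)=(1-y)\sum_k a_kz^k+y\sum_k b_kz^{-k}$. $\mathcal{L}_A$ is the linear map on formal series sending $z^n\mapsto q^{n^2/(4A)}$. We put $q=e^{2\pi i\tau}$, $q^r=e^{2\pi ir\tau}$, $\tau\in\mathbb{H}$ (upper half plane). $\Gamma(N)=\{\begin{psmallmatrix}a&b\\c&d\end{psmallmatrix}\in\mathrm{SL}(2,\mathbb{Z}): a\equiv d\equiv1,\ b\equiv c\equiv0 \bmod N\}$, acting by $\gamma\tau=\frac{a\tau+b}{c\tau+d}$. For $d$ odd, $\varepsilon_d=1$ if $d\equiv1\bmod 4$ and $\varepsilon_d=i$ if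 $d\equiv3\bmod4$. For $k\in\frac12+\mathbb{Z}$, $f|_k\gamma(\tau)=\varepsilon_d^{2k}\left(\frac{c}{d}\right)(c\tau+d)^{-k}f(\gamma\tau)$, with $\left(\frac{\cdot}{\cdot}\right)$ the Jacobi symbol (extended as usual in half-integral weight theory) and the principal branch of the square root on $\mathbb{H}$, extended to real arguments by limits from $\mathbb{H}$. Multipliers $\chi$ below are functions on $\Gamma$ with values of absolute value $1$; "a (quantum) modular form" means one for some multiplier. Modular form: for $\Gamma\le\mathrm{SL}(2,\mathbb{Z})$ of level $N$, $4\mid N$, a holomorphic $f:\mathbb{H}\to\mathbb{C}$ is a modular form of weight $k\in\frac12\mathbb{Z}$ with multiplier $\chi$ if $f-\overline{\chi}(\gamma)f|_k\gamma=0$ for all $\gamma\in\Gamma$, and for all $\gamma\in\mathrm{SL}(2,\mathbb{Z})$, $(c\tau+d)^{-k}f(\gamma\tau)$ is bounded as $\tau\to i\infty$. Quantum modular form: let $\mathcal{Q}=\mathbb{Q}\setminus S$ for some discrete set $S$ closed under $\Gamma$. A quantum modular form of weight $k$ with multiplier $\chi$ for $\Gamma$ is $f:\mathcal{Q}\to\mathbb{C}$ such that for all $\gamma\in\Gamma$ the function $h_\gamma(x)=f(x)-\overline{\chi}(\gamma)f|_k\gamma(x)$ on $\mathcal{Q}\setminus\{\gamma^{-1}(i\infty)\}$ extends to a function that is $C^\infty$ on $\mathbb{R}$ and real-analytic on $\mathbb{R}\setminus\{\gamma^{-1}(i\infty)\}$. A holomorphic function $F$ on $\mathbb{H}$ is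 called a quantum modular form if the limits $f(x)=\lim_{y\to0^+}F(x+iy)$ exist for $x\in\mathcal{Q}$ and define a quantum modular form.
   Formalization: In the definition of quantum modular form, the factor (cx+d)^{-k} at real x is the limit of the principal branch along x-iy (from the lower half plane), not from the upper half plane; with limits from the upper half plane the claim fails, e.g. for (2,3,5), ω=1. *)

theory Defs
  imports
    "HOL-Complex_Analysis.Complex_Analysis"
    "HOL-Number_Theory.Residues"
    "Jordan_Normal_Form.Matrix_Kernel"
begin

section \<open>Star-shaped plumbings and Seifert data\<close>

fun cont_frac :: "int list \<Rightarrow> rat" where
  "cont_frac [] = 0"
| "cont_frac [c] = of_int c"
| "cont_frac (c # c' # cs) = of_int c - 1 / cont_frac (c' # cs)"

text \<open>
  The legs are indexed by 1, 2, 3 and \<open>c i\<close> lists the continued fraction entries of the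
  \<open>i\<close>-th leg outwards from the node. Any integer continued fraction expansion of \<open>a i / b i\<close>
  is allowed. When the plumbing is negative definite, all tails of the continued fractions are
  positive, so no division by zero occurs in \<^const>\<open>cont_frac\<close>.
\<close>

definition seifert_data :: "(nat \<Rightarrow> int) \<Rightarrow> (nat \<Rightarrow> int) \<Rightarrow> (nat \<Rightarrow> int list) \<Rightarrow> bool" where
  "seifert_data a b c \<longleftrightarrow>
     (\<forall>i\<in>{1..3}. a i > 0 \<and> b i \<noteq> 0 \<and> gcd (a i) (b i) = 1 \<and>
        c i \<noteq> [] \<and> of_int (a i) / of_int (b i) = cont_frac (c i))"

text \<open>
  Vertices of the plumbing tree: \<open>None\<close> is the node, \<open>Some (i, k)\<close> is the \<open>k\<close>-th vertex
  (counted from 0) of the \<open>i\<close>-th leg.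
\<close>

definition star_vertices :: "(nat \<Rightarrow> int list) \<Rightarrow> (nat \<times> nat) option list" where
  "star_vertices c =
     None # concat (map (\<lambda>i. map (\<lambda>k. Some (i, k)) [0..<length (c i)]) [1, 2, 3])"

fun star_weight :: "int \<Rightarrow> (nat \<Rightarrow> int list) \<Rightarrow> (nat \<times> nat) option \<Rightarrow> int" where
  "star_weight b0 c None = - b0"
| "star_weight b0 c (Some (i, k)) = - (c i ! k)"

fun star_child :: "(nat \<times> nat) option \<Rightarrow> (nat \<times> nat) option \<Rightarrow> bool" where
  "star_child None (Some (i, k)) \<longleftrightarrow> k = 0"
| "star_child (Some (i, k)) (Some (i', k')) \<longleftrightarrow> i' = i \<and> k' = Suc k"
| "star_child _ None \<longleftrightarrow> False"

definition plumbing_matrix :: "int \<Rightarrow> (nat \<Rightarrow> int list) \<Rightarrow> real Matrix.mat" where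
  "plumbing_matrix b0 c =
     (let vs = star_vertices c; n = length vs in
      Matrix.mat n n (\<lambda>(r, s).
        if r = s then of_int (star_weight b0 c (vs ! r))
        else if star_child (vs ! r) (vs ! s) \<or> star_child (vs ! s) (vs ! r) then 1
        else 0))"

definition negative_definite :: "real Matrix.mat \<Rightarrow> bool" where
  "negative_definite Q \<longleftrightarrow>
     (\<forall>x\<in>carrier_vec (dim_row Q). x \<noteq> 0\<^sub>v (dim_row Q) \<longrightarrow> x \<bullet> (Q *\<^sub>v x) < 0)"

text \<open>
  The boundary \<open>M\<close> of the plumbing of sphere bundles along a tree has \<open>H\<^sub>1(M; \<int>)\<close> isomorphic to
  the cokernel of the (square) plumbing matrix, so its first Betti number is the corank of that
  matrix.
\<close>

definition first_betti :: "int \<Rightarrow> (nat \<Rightarrow> int list) \<Rightarrow> nat" where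
  "first_betti b0 c = kernel_dim (plumbing_matrix b0 c)"


section \<open>Admissible families and average expansions\<close>

definition admissible_family :: "(nat \<Rightarrow> int \<Rightarrow> real) \<Rightarrow> bool" where
  "admissible_family W \<longleftrightarrow>
     (\<forall>n r. 2 * W n r \<in> \<int>) \<and>
     W 2 0 = 1 \<and> (\<forall>r. r \<noteq> 0 \<longrightarrow> W 2 r = 0) \<and>
     (\<forall>n\<ge>1. \<forall>r. W n (r + 1) - W n (r - 1) = W (n - 1) r)"

text \<open>
  \<open>avg_expansion y f n\<close> is the coefficient of \<open>z\<^sup>n\<close> in the two-sided formal series a.e.\<open>\<^sub>y(f)\<close>.
  The coefficients \<open>b\<^sub>k\<close> of the expansion at infinity are those of \<open>w\<^sup>k\<close> in the expansion of
  \<open>f (1/w)\<close> at \<open>w = 0\<close>.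
\<close>

definition avg_expansion :: "real \<Rightarrow> (complex \<Rightarrow> complex) \<Rightarrow> int \<Rightarrow> complex" where
  "avg_expansion y f n =
     (1 - of_real y) * fls_nth (laurent_expansion f 0) n +
     of_real y * fls_nth (laurent_expansion (\<lambda>w. f (inverse w)) 0) (- n)"

definition q_pow :: "real \<Rightarrow> complex \<Rightarrow> complex" where
  "q_pow r \<tau> = exp (2 * of_real pi * \<i> * of_real r * \<tau>)"

text \<open>
  \<open>laplace_sum A s \<tau> v\<close>: the series \<open>\<L>\<^sub>A(s)\<close>, for a two-sided formal series with coefficients
  \<open>s n\<close>, converges unconditionally at \<open>q = e\<^sup>2\<^sup>\<pi>\<^sup>i\<^sup>\<tau>\<close> to \<open>v\<close>.
\<close>

definition laplace_sum :: "int \<Rightarrow> (int \<Rightarrow> complex) \<Rightarrow> complex \<Rightarrow> complex \<Rightarrow> bool" where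
  "laplace_sum A s \<tau> v \<longleftrightarrow>
     ((\<lambda>n. s n * q_pow (of_int (n\<^sup>2) / (4 * of_int A)) \<tau>) has_sum v) UNIV"

definition q_polynomial :: "int \<Rightarrow> (complex \<Rightarrow> complex) \<Rightarrow> bool" where
  "q_polynomial A p \<longleftrightarrow>
     (\<exists>F (s :: int \<Rightarrow> complex). finite F \<and>
        p = (\<lambda>\<tau>. \<Sum>n\<in>F. s n * q_pow (of_int (n\<^sup>2) / (4 * of_int A)) \<tau>))"

definition seifert_A :: "(nat \<Rightarrow> int) \<Rightarrow> int" where
  "seifert_A a = (\<Prod>i\<in>{1..3}. a i)"

definition f0 :: "(nat \<Rightarrow> int) \<Rightarrow> complex \<Rightarrow> complex \<Rightarrow> complex" where
  "f0 a \<omega> z =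
     (\<Prod>i\<in>{1..3}. z powi (seifert_A a div a i) * inverse \<omega> - z powi (- (seifert_A a div a i)) * \<omega>) /
     (z powi seifert_A a * inverse \<omega> - z powi (- seifert_A a) * \<omega>)"


section \<open>Modular and quantum modular forms of half-integral weight\<close>

definition SL2Z :: "int Matrix.mat set" where
  "SL2Z = {\<gamma> \<in> carrier_mat 2 2. Determinant.det \<gamma> = 1}"

definition Gamma_cong :: "int \<Rightarrow> int Matrix.mat set" where
  "Gamma_cong N = {\<gamma> \<in> SL2Z.
     [\<gamma> $$ (0,0) = 1] (mod N) \<and> [\<gamma> $$ (0,1) = 0] (mod N) \<and>
     [\<gamma> $$ (1,0) = 0] (mod N) \<and> [\<gamma> $$ (1,1) = 1] (mod N)}"

definition mob_denom :: "int Matrix.mat \<Rightarrow> 'a \<Rightarrow> 'a :: field" where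
  "mob_denom \<gamma> z = of_int (\<gamma> $$ (1,0)) * z + of_int (\<gamma> $$ (1,1))"

definition mob :: "int Matrix.mat \<Rightarrow> 'a \<Rightarrow> 'a :: field" where
  "mob \<gamma> z = (of_int (\<gamma> $$ (0,0)) * z + of_int (\<gamma> $$ (0,1))) / mob_denom \<gamma> z"

text \<open>
  Shimura's extension of the Jacobi symbol to odd \<open>d\<close> of either sign, with \<open>(0 / \<plusminus>1) = 1\<close>.
\<close>

definition jacobi_ext :: "int \<Rightarrow> int \<Rightarrow> int" where
  "jacobi_ext c d =
     (if c < 0 \<and> d < 0 then - 1 else 1) * (\<Prod>p\<in>#prime_factorization \<bar>d\<bar>. Legendre c p)"

definition eps_odd :: "int \<Rightarrow> complex" where
  "eps_odd d = (if [d = 1] (mod 4) then 1 else \<i>)"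

text \<open>
  For \<open>2k\<close> an integer, \<open>w powr (-k)\<close> is the \<open>(-2k)\<close>-th power of the principal square root of \<open>w\<close>
  and \<open>eps_odd d powr (2k)\<close> is the ordinary power.
\<close>

definition theta_factor :: "real \<Rightarrow> int Matrix.mat \<Rightarrow> complex" where
  "theta_factor k \<gamma> =
     eps_odd (\<gamma> $$ (1,1)) powr of_real (2 * k) * of_int (jacobi_ext (\<gamma> $$ (1,0)) (\<gamma> $$ (1,1)))"

definition slash_H ::
  "real \<Rightarrow> int Matrix.mat \<Rightarrow> (complex \<Rightarrow> complex) \<Rightarrow> complex \<Rightarrow> complex" where
  "slash_H k \<gamma> f \<tau> =
     theta_factor k \<gamma> * mob_denom \<gamma> \<tau> powr of_real (- k) * f (mob \<gamma> \<tau>)"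

text \<open>
  On the upper half plane \<open>(c\<tau> + d)\<^sup>-\<^sup>k\<close> uses the principal branch. At a real point \<open>x\<close> with
  \<open>cx + d < 0\<close> the limits of the principal branch along \<open>x + iy\<close> and along \<open>x - iy\<close>, \<open>y \<rightarrow> 0+\<close>,
  differ by the sign \<open>-1\<close> when \<open>k \<in> 1/2 + \<int>\<close>. The limit used here is the one along \<open>x - iy\<close>: the
  values at \<open>x\<close> of a false theta function of weight \<open>1/2\<close> agree with the limits along \<open>x - iy\<close> of
  the Eichler integral \<open>\<integral> g(\<sigma>) (\<sigma> - z)\<^sup>-\<^sup>1\<^sup>/\<^sup>2 d\<sigma>\<close>, taken from the conjugate of \<open>z\<close> to \<open>i\<infinity>\<close>, on the
  lower half plane, and this function of \<open>z\<close> transforms there with the principal branch of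
  \<open>(cz + d)\<^sup>-\<^sup>k\<close>. With the limit along \<open>x + iy\<close> the two terms of \<open>f - f|\<^sub>k\<gamma>\<close> would have the wrong
  relative sign on the side of \<open>\<gamma>\<^sup>-\<^sup>1(i\<infinity>)\<close> where \<open>cx + d < 0\<close>, and the error of modularity of such
  functions would not be smooth.
\<close>

definition real_automorphy :: "real \<Rightarrow> int Matrix.mat \<Rightarrow> real \<Rightarrow> complex" where
  "real_automorphy k \<gamma> x =
     Lim (at_right 0) (\<lambda>y :: real. mob_denom \<gamma> (Complex x (- y)) powr of_real (- k))"

definition slash_R ::
  "real \<Rightarrow> int Matrix.mat \<Rightarrow> (real \<Rightarrow> complex) \<Rightarrow> real \<Rightarrow> complex" where
  "slash_R k \<gamma> f x = theta_factor k \<gamma> * real_automorphy k \<gamma> x * f (mob \<gamma> x)"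

definition multiplier :: "int Matrix.mat set \<Rightarrow> (int Matrix.mat \<Rightarrow> complex) \<Rightarrow> bool" where
  "multiplier \<Gamma> v \<longleftrightarrow> (\<forall>\<gamma>\<in>\<Gamma>. cmod (v \<gamma>) = 1)"

definition modular_form_mult ::
  "int Matrix.mat set \<Rightarrow> real \<Rightarrow> (int Matrix.mat \<Rightarrow> complex) \<Rightarrow> (complex \<Rightarrow> complex) \<Rightarrow> bool" where
  "modular_form_mult \<Gamma> k v f \<longleftrightarrow>
     f holomorphic_on {\<tau>. Im \<tau> > 0} \<and>
     (\<forall>\<gamma>\<in>\<Gamma>. \<forall>\<tau>. Im \<tau> > 0 \<longrightarrow> f \<tau> - cnj (v \<gamma>) * slash_H k \<gamma> f \<tau> = 0) \<and>
     (\<forall>\<gamma>\<in>SL2Z. \<exists>Y B. \<forall>\<tau>. Im \<tau> > 0 \<and> Im \<tau> \<ge> Y \<longrightarrow>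
        cmod (mob_denom \<gamma> \<tau> powr of_real (- k) * f (mob \<gamma> \<tau>)) \<le> B)"

definition modular_form :: "int Matrix.mat set \<Rightarrow> real \<Rightarrow> (complex \<Rightarrow> complex) \<Rightarrow> bool" where
  "modular_form \<Gamma> k f \<longleftrightarrow> (\<exists>v. multiplier \<Gamma> v \<and> modular_form_mult \<Gamma> k v f)"

definition smooth_R :: "(real \<Rightarrow> complex) \<Rightarrow> bool" where
  "smooth_R h \<longleftrightarrow>
     (\<exists>D :: nat \<Rightarrow> real \<Rightarrow> complex. D 0 = h \<and>
        (\<forall>n x. (D n has_vector_derivative D (Suc n) x) (at x)))"

definition real_analytic_at :: "(real \<Rightarrow> complex) \<Rightarrow> real \<Rightarrow> bool" where
  "real_analytic_at h x \<longleftrightarrow>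
     (\<exists>r>0. \<exists>s :: nat \<Rightarrow> complex. \<forall>t. \<bar>t - x\<bar> < r \<longrightarrow>
        (\<lambda>n. s n * of_real ((t - x) ^ n)) sums h t)"

text \<open>
  The exceptional set \<open>S\<close> is a subset of \<open>\<rat>\<close>, and \<open>mob_denom \<gamma> x = 0\<close> says \<open>x = \<gamma>\<^sup>-\<^sup>1(i\<infinity>)\<close>.
\<close>

definition quantum_domain :: "int Matrix.mat set \<Rightarrow> real set \<Rightarrow> bool" where
  "quantum_domain \<Gamma> Q \<longleftrightarrow>
     (\<exists>S. S \<subseteq> \<rat> \<and> discrete S \<and>
        (\<forall>\<gamma>\<in>\<Gamma>. \<forall>x\<in>S. mob_denom \<gamma> x \<noteq> 0 \<longrightarrow> mob \<gamma> x \<in> S) \<and> Q = \<rat> - S)"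

definition quantum_modular_mult ::
  "int Matrix.mat set \<Rightarrow> real \<Rightarrow> (int Matrix.mat \<Rightarrow> complex) \<Rightarrow> real set \<Rightarrow> (real \<Rightarrow> complex) \<Rightarrow> bool"
  where
  "quantum_modular_mult \<Gamma> k v Q f \<longleftrightarrow>
     (\<forall>\<gamma>\<in>\<Gamma>. \<exists>h. smooth_R h \<and> (\<forall>x. mob_denom \<gamma> x \<noteq> 0 \<longrightarrow> real_analytic_at h x) \<and>
        (\<forall>x\<in>Q. mob_denom \<gamma> x \<noteq> 0 \<longrightarrow> h x = f x - cnj (v \<gamma>) * slash_R k \<gamma> f x))"

definition quantum_modular_form :: "int Matrix.mat set \<Rightarrow> real \<Rightarrow> (complex \<Rightarrow> complex) \<Rightarrow> bool" where
  "quantum_modular_form \<Gamma> k F \<longleftrightarrow>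
     F holomorphic_on {\<tau>. Im \<tau> > 0} \<and>
     (\<exists>v Q f. multiplier \<Gamma> v \<and> quantum_domain \<Gamma> Q \<and>
        (\<forall>x\<in>Q. ((\<lambda>y. F (Complex x y)) \<longlongrightarrow> f x) (at_right 0)) \<and>
        quantum_modular_mult \<Gamma> k v Q f)"

end

theory Submission
  imports Defs "HOL-Probability.Characteristic_Functions" "HOL-Real_Asymp.Real_Asymp"
begin

text \<open>
  The coefficients \<open>u\<close> and \<open>v\<close> of \<open>f0\<close> at \<open>0\<close> and at \<open>\<infinity>\<close> satisfy the same linear recurrence with a finitely
  supported right-hand side, so \<open>c = u - v\<close> is periodic modulo \<open>2Aj\<close>, and up to finitely many terms
  the average expansion has the coefficients \<open>(sgn n / 2 + 1/2 - y) c\<^sub>n\<close>. This splits the series into a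
  polynomial, a unary theta series \<open>\<Theta>\<close> and a false theta series \<open>\<theta>\<close>.

  Replacing \<open>n\<close> by \<open>jn\<close> one may work with \<open>\<Sum> f(n) q^(n\<^sup>2/4m)\<close>, \<open>m = Aj\<^sup>2\<close>, \<open>f\<close> periodic modulo \<open>2m\<close>. Poisson
  summation on residue classes gives the transformation of the theta series of weight \<open>1/2\<close> and \<open>3/2\<close>
  under all of \<open>SL(2, \<int>)\<close> in terms of Gauss sums, and on \<open>\<Gamma>(4m)\<close> the Gauss sum kernel is a scalar.

  The false theta series is the integral of the weight \<open>3/2\<close> series \<open>g\<close> against \<open>(\<sigma> - \<tau>)^(-1/2)\<close> from \<open>\<tau>\<close> to
  \<open>i\<infinity>\<close>. Since \<open>g\<close> decays rapidly at every cusp, this persists at rational \<open>x\<close>, and the error of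
  modularity at \<open>x\<close> is the same integral from the cusp \<open>\<gamma>^-1(i\<infinity>)\<close> to \<open>i\<infinity>\<close>, which is a smooth function of \<open>x\<close>
  and analytic away from that cusp.
\<close>

section \<open>Poisson summation for Gaussians\<close>

text \<open>A multiplier only has to have absolute value 1 on each matrix. So Gauss sums are never
  evaluated: their modulus suffices, and all constant phases disappear into one unimodular scalar
  per matrix. What cannot be absorbed is a sign of a square root that depends on the point; hence
  the care with principal branches, and the automorphy factor at real points as a limit from the
  lower half plane.

  The passage from n to jn is forced by the root of unity: under n to n + 2A the coefficients are
  twisted by \<omega>^(-2), so they have period 2Aj, while a theta series with exponents n^2/4m
  transforms well if its coefficients have period 2m. As n^2/4A = (jn)^2/4Aj^2, the function placed
  on the multiples of j has period 2Aj^2 = 2m, which explains the level 4Aj^2.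

  The weight 3/2 series carries the factor n, which kills the constant term, and this survives
  inversion. It therefore decays at every cusp, whatever f is, and the exceptional set of the
  quantum modular form can be taken empty.\<close>

lemma summable_power_gauss_int:
  fixes a :: real
  assumes "a > 0"
  shows "(\<lambda>n::int. \<bar>of_int n\<bar> ^ k * exp (- a * of_int n ^ 2)) summable_on UNIV"
proof -
  let ?f = "\<lambda>n::int. \<bar>of_int n :: real\<bar> ^ k * exp (- a * of_int n ^ 2)"
  have "summable (\<lambda>n::nat. real n ^ k * exp (- a * real n ^ 2))"
  proof (rule summable_comparison_test_bigo)
    show "summable (\<lambda>n. norm (1 / real n ^ 2))"
      using inverse_power_summable[of 2, where 'a = real] by (simp add: divide_inverse)
    show "(\<lambda>n::nat. real n ^ k * exp (- a * real n ^ 2)) \<in> O(\<lambda>n. 1 / real n ^ 2)"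
      using assms by real_asymp
  qed
  then have nat: "(\<lambda>n::nat. real n ^ k * exp (- a * real n ^ 2)) summable_on UNIV"
    by (intro norm_summable_imp_summable_on) simp
  have "?f summable_on range int"
    using nat by (subst summable_on_reindex) (auto simp: o_def)
  moreover have "?f summable_on range (\<lambda>n. - int n)"
    using nat by (subst summable_on_reindex) (auto simp: o_def inj_on_def)
  ultimately have "?f summable_on (range int \<union> range (\<lambda>n. - int n))"
    by (rule summable_on_union)
  moreover have "range int \<union> range (\<lambda>n. - int n) = UNIV"
  proof (intro equalityI subsetI UNIV_I)
    fix x :: int
    show "x \<in> range int \<union> range (\<lambda>n. - int n)"
    proof (cases "x \<ge> 0")
      case True
      then have "x = int (nat x)" by simp
      then show ?thesis by blast
    next
      case False
      then have "x = - int (nat (- x))" by simp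
      then show ?thesis by blast
    qed
  qed
  ultimately show ?thesis by simp
qed

section \<open>Uniqueness of cosine coefficients\<close>

lemma cos_integral_unit:
  fixes n :: int
  shows "((\<lambda>u. cos (2 * pi * of_int n * u)) has_integral (if n = 0 then 1 else 0)) {0..1::real}"
proof (cases "n = 0")
  case True
  then show ?thesis using has_integral_const_real[of "1::real" 0 1] by simp
next
  case False
  have "((\<lambda>u. cos (2 * pi * of_int n * u)) has_integral
      sin (2 * pi * of_int n * 1) / (2 * pi * of_int n) - sin (2 * pi * of_int n * 0) / (2 * pi * of_int n)) {0..1::real}"
    using False
    by (intro fundamental_theorem_of_calculus)
       (auto intro!: derivative_eq_intros simp flip: has_real_derivative_iff_has_vector_derivative)
  moreover have "sin (2 * pi * of_int n * 1 :: real) = 0"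
    using sin_int_2pin[of n] by (simp add: mult_ac)
  ultimately show ?thesis using False by simp
qed

text \<open>
  An even periodic function is a function of \<open>cos (2\<pi>u)\<close>, so polynomial approximation on \<open>[-1, 1]\<close> replaces
  a completeness theorem for Fourier series.
\<close>

lemma even_periodic_eq_0_if_cos_coeffs_0:
  fixes f :: "real \<Rightarrow> real"
  assumes cont: "continuous_on UNIV f" and per: "\<And>u. f (u + 1) = f u" and even: "\<And>u. f (- u) = f u"
    and coeff: "\<And>j::int. ((\<lambda>u. f u * cos (2 * pi * of_int j * u)) has_integral 0) {0..1}"
  shows "f u = 0"
proof -
  \<comment> \<open>Multiplying by \<open>cos (2 * pi * u)\<close> replaces the frequency j by j - 1
    and j + 1, so the claim is carried through the induction for all j at once; only j = 0 is used
    afterwards.\<close>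
  have pow: "((\<lambda>u. f u * cos (2 * pi * u) ^ n * cos (2 * pi * of_int j * u)) has_integral 0) {0..1}" for n j
  proof (induction n arbitrary: j)
    case 0
    then show ?case using coeff by simp
  next
    case (Suc n)
    have "((\<lambda>u. (1/2) * (f u * cos (2 * pi * u) ^ n * cos (2 * pi * of_int (j - 1) * u) +
         f u * cos (2 * pi * u) ^ n * cos (2 * pi * of_int (j + 1) * u))) has_integral (1/2) * (0 + 0)) {0..1}"
      by (intro has_integral_mult_right has_integral_add Suc)
    moreover have "(1/2) * (f u * cos (2 * pi * u) ^ n * cos (2 * pi * of_int (j - 1) * u) +
         f u * cos (2 * pi * u) ^ n * cos (2 * pi * of_int (j + 1) * u)) =
        f u * cos (2 * pi * u) ^ Suc n * cos (2 * pi * of_int j * u)" for u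
      by (simp add: algebra_simps cos_add cos_diff)
    ultimately show ?case by simp
  qed
  have poly: "((\<lambda>u. f u * p (cos (2 * pi * u))) has_integral 0) {0..1}" if p: "real_polynomial_function p" for p
  proof -
    obtain a n where pa: "p = (\<lambda>x. \<Sum>i\<le>n. a i * x ^ i)"
      using p by (auto simp: real_polynomial_function_iff_sum)
    have "((\<lambda>u. \<Sum>i\<le>n. a i * (f u * cos (2 * pi * u) ^ i * cos (2 * pi * of_int 0 * u))) has_integral
       (\<Sum>i\<le>n. a i * 0)) {0..1}"
      by (intro has_integral_sum has_integral_mult_right pow) auto
    then show ?thesis by (simp add: pa sum_distrib_left mult_ac)
  qed
  \<comment> \<open>On [0,1/2] the angle \<open>2 * pi * u\<close> is recovered by
    \<open>arccos\<close>; on [1/2,1] what is recovered is the angle of 1 - u, and f (1 - u) = f u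
    by evenness and periodicity.\<close>
  define G where "G y = f (arccos y / (2 * pi))" for y
  have contG: "continuous_on {-1..1} G"
    unfolding G_def by (intro continuous_intros continuous_on_compose2[OF cont]) auto
  have fG: "f u = G (cos (2 * pi * u))" if "u \<in> {0..1}" for u
  proof (cases "u \<le> 1/2")
    case True
    then have "arccos (cos (2 * pi * u)) = 2 * pi * u"
      using that by (intro arccos_cos) auto
    then show ?thesis by (simp add: G_def)
  next
    case False
    have "cos (2 * pi * u) = cos (2 * pi * (1 - u))"
      by (simp add: algebra_simps cos_diff)
    moreover have "arccos (cos (2 * pi * (1 - u))) = 2 * pi * (1 - u)"
      using that False by (intro arccos_cos) auto
    moreover have "f (1 - u) = f u"
      using per[of "- u"] even[of u] by simp
    ultimately show ?thesis by (simp add: G_def)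
  qed
  have contf: "continuous_on {0..1} f"
    using cont continuous_on_subset by blast
  obtain M where M: "\<And>u. u \<in> {0..1} \<Longrightarrow> \<bar>f u\<bar> \<le> M" and "M > 0"
  proof -
    have "bounded (f ` {0..1})"
      by (intro compact_imp_bounded compact_continuous_image contf) auto
    then obtain M where "M > 0" "\<And>u. u \<in> {0..1} \<Longrightarrow> \<bar>f u\<bar> \<le> M"
      by (auto simp: bounded_pos)
    then show ?thesis using that by blast
  qed
  define I where "I = integral {0..1} (\<lambda>u. f u * f u)"
  have I: "((\<lambda>u. f u * f u) has_integral I) {0..1}"
    unfolding I_def by (intro integrable_integral integrable_continuous_real continuous_intros contf)
  \<comment> \<open>As f is orthogonal to every polynomial in the cosine, I equals the integral of f
    times (f - p(cos)), whose second factor is at most e / M.\<close>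
  have "I \<le> e" if "e > 0" for e
  proof -
    obtain p where p: "real_polynomial_function p" "\<And>x. x \<in> {-1..1} \<Longrightarrow> \<bar>G x - p x\<bar> < e / M"
      using Stone_Weierstrass_real_polynomial_function[of "{-1..1}" G "e / M"] contG \<open>e > 0\<close> \<open>M > 0\<close> by auto
    have "((\<lambda>u. f u * f u - f u * p (cos (2 * pi * u))) has_integral (I - 0)) {0..1}"
      by (intro has_integral_diff I poly p)
    moreover have "((\<lambda>u. e) has_integral e) {0..1::real}"
      using has_integral_const_real[of e 0 1] by simp
    ultimately have "I - 0 \<le> e"
    proof (rule has_integral_le)
      fix u :: real assume u: "u \<in> {0..1}"
      have "f u * f u - f u * p (cos (2 * pi * u)) = f u * (G (cos (2 * pi * u)) - p (cos (2 * pi * u)))"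
        using fG[OF u] by (simp add: algebra_simps)
      also have "\<dots> \<le> \<bar>f u\<bar> * \<bar>G (cos (2 * pi * u)) - p (cos (2 * pi * u))\<bar>"
        by (metis abs_ge_self abs_mult)
      also have "\<dots> \<le> M * (e / M)"
        using M[OF u] p(2)[of "cos (2 * pi * u)"] by (intro mult_mono) auto
      finally show "f u * f u - f u * p (cos (2 * pi * u)) \<le> e" using \<open>M > 0\<close> by simp
    qed
    then show ?thesis by simp
  qed
  then have "I \<le> 0"
    using field_le_epsilon[of I 0] by simp
  moreover have "I \<ge> 0" using I by (rule has_integral_nonneg) auto
  ultimately have "I = 0" by simp
  have zero: "f u = 0" if "u \<in> {0..1}" for u
  proof -
    have "f u * f u = 0"
    proof (rule has_integral_0_cbox_imp_0[of 0 1 "\<lambda>u. f u * f u"])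
      show "continuous_on (cbox 0 1) (\<lambda>u. f u * f u)" using contf by (auto intro!: continuous_intros)
      show "((\<lambda>u. f u * f u) has_integral 0) (cbox 0 1)" using I \<open>I = 0\<close> by simp
    qed (use that in \<open>auto simp: box_real\<close>)
    then show ?thesis by simp
  qed
  have shift: "f (u + of_nat n) = f u" for n u
  proof (induction n)
    case (Suc n)
    then show ?case using per[of "u + of_nat n"] by (simp add: algebra_simps)
  qed simp
  have shift': "f (u + of_int n) = f u" for n u
  proof (cases "n \<ge> 0")
    case True
    then show ?thesis using shift[of u "nat n"] by simp
  next
    case False
    then show ?thesis using shift[of "u + of_int n" "nat (- n)"] by simp
  qed
  have "f (frac u) = 0" by (intro zero) (auto simp: frac_lt_1 less_imp_le)
  then show ?thesis using shift'[of "frac u" "\<lfloor>u\<rfloor>"] by (simp add: frac_def)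
qed

section \<open>The Gaussian: Fourier transform and unfolding\<close>

lemma gauss_cos_integral:
  fixes t r :: real
  assumes "t > 0"
  shows "integrable lborel (\<lambda>v. exp (- pi * t * v ^ 2) * cos (2 * pi * r * v))"
    and "(LINT v|lborel. exp (- pi * t * v ^ 2) * cos (2 * pi * r * v)) = exp (- pi * r ^ 2 / t) / sqrt t"
proof -
  \<comment> \<open>The substitution x = c v turns the standard normal density into the Gaussian up
    to a constant, so the characteristic function exp(-s^2/2) gives the integral; \<open>s\<close>
    below is chosen so that s x = 2 pi r v.\<close>
  define c where "c = sqrt (2 * pi * t)"
  have c: "c > 0" "c ^ 2 = 2 * pi * t" using assms by (auto simp: c_def)
  have dens: "std_normal_density (c * v) = exp (- pi * t * v ^ 2) / sqrt (2 * pi)" for v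
    using c by (simp add: std_normal_density_def power_mult_distrib)
  define s where "s = 2 * pi * r / c"
  have "integrable std_normal_distribution (\<lambda>x. iexp (s * x))"
    by (rule finite_measure.integrable_const_bound
        [OF prob_space.finite_measure[OF real_distribution.axioms(1)[OF real_dist_normal_dist]], of _ 1]) auto
  then have int: "complex_integrable lborel (\<lambda>x. std_normal_density x *\<^sub>R iexp (s * x))"
    by (subst (asm) integrable_density) auto
  have "(CLINT x|lborel. std_normal_density x *\<^sub>R iexp (s * x)) = complex_of_real (exp (- (s ^ 2) / 2))"
    using fun_cong[OF char_std_normal_distribution, of s]
    by (subst (asm) char_def, subst (asm) integral_density) auto
  moreover have Re: "Re (std_normal_density x *\<^sub>R iexp (s * x)) = std_normal_density x * cos (s * x)" for x
    by (simp add: Re_exp)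
  ultimately have val: "(LINT x|lborel. std_normal_density x * cos (s * x)) = exp (- (s ^ 2) / 2)"
    using integral_Re[OF int, unfolded Re] by (simp only: Re_complex_of_real)
  have intR: "integrable lborel (\<lambda>x. std_normal_density x * cos (s * x))"
    using integrable_Re[OF int] unfolding Re .
  have eq: "std_normal_density (0 + c * v) * cos (s * (0 + c * v)) =
      (exp (- pi * t * v ^ 2) * cos (2 * pi * r * v)) / sqrt (2 * pi)" for v
    using c(1) dens[of v] by (simp add: s_def mult_ac)
  have "integrable lborel (\<lambda>v. (exp (- pi * t * v ^ 2) * cos (2 * pi * r * v)) / sqrt (2 * pi))"
    using lborel_integrable_real_affine[OF intR, of c 0] c(1) unfolding eq by simp
  from integrable_mult_right[of "sqrt (2 * pi)", OF this]
  show "integrable lborel (\<lambda>v. exp (- pi * t * v ^ 2) * cos (2 * pi * r * v))"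
    by simp
  have "exp (- (s ^ 2) / 2) = \<bar>c\<bar> *\<^sub>R (LINT v|lborel. std_normal_density (0 + c * v) * cos (s * (0 + c * v)))"
    using lborel_integral_real_affine[of c "\<lambda>x. std_normal_density x * cos (s * x)" 0] c(1) val by simp
  also have "\<dots> = c / sqrt (2 * pi) * (LINT v|lborel. exp (- pi * t * v ^ 2) * cos (2 * pi * r * v))"
    unfolding eq using c(1) by simp
  also have "c / sqrt (2 * pi) = sqrt t"
    using assms by (simp add: c_def real_sqrt_mult)
  also have "- (s ^ 2) / 2 = - pi * r ^ 2 / t"
    using c assms by (simp add: s_def power_divide power_mult_distrib power2_eq_square field_simps)
  finally show "(LINT v|lborel. exp (- pi * t * v ^ 2) * cos (2 * pi * r * v)) = exp (- pi * r ^ 2 / t) / sqrt t"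
    using assms by (simp add: field_simps)
qed

text \<open>Unconditional sums are evaluated along these symmetric partial sums wherever a theorem
  about sequences is applied. The half-open range matches the tiling of [-N,N] by unit intervals
  [l,l+1].\<close>

lemma filterlim_symmetric_intervals:
  "filterlim (\<lambda>N. {- int N..<int N}) (finite_subsets_at_top UNIV) sequentially"
  unfolding filterlim_finite_subsets_at_top
proof (intro allI impI)
  fix X :: "int set"
  assume "finite X \<and> X \<subseteq> UNIV"
  then have fin: "finite X" by simp
  have "\<forall>\<^sub>F N in sequentially. x \<in> {- int N..<int N}" for x
    using eventually_gt_at_top[of "nat \<bar>x\<bar>"] by eventually_elim auto
  then have "\<forall>\<^sub>F N in sequentially. \<forall>x\<in>X. x \<in> {- int N..<int N}"
    using fin by (simp add: eventually_ball_finite)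
  then show "\<forall>\<^sub>F N in sequentially. finite {- int N..<int N} \<and> X \<subseteq> {- int N..<int N} \<and> {- int N..<int N} \<subseteq> UNIV"
    by eventually_elim auto
qed

text \<open>Unfolding: each translate contributes the integral over [l,l+1], and these intervals
  tile [-N,N].\<close>

lemma has_integral_unit_translates:
  fixes h :: "real \<Rightarrow> real"
  assumes cont: "continuous_on UNIV h"
  shows "((\<lambda>u. \<Sum>l\<in>{- int N..<int N}. h (of_int l + u)) has_integral integral {- real N..real N} h) {0..1}"
proof -
  have int: "h integrable_on {a..b}" for a b
    by (intro integrable_continuous_real continuous_on_subset[OF cont]) auto
  have one: "((\<lambda>u. h (of_int l + u)) has_integral integral {of_int l..of_int l + 1} h) {0..1}" for l
  proof -
    have "(h has_integral integral {of_int l..of_int l + 1} h) {of_int l..of_int l + 1}"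
      using int by (rule integrable_integral)
    from has_integral_affinity[of h _ "of_int l" "of_int l + 1" 1 "of_int l"] this
    have "((\<lambda>u. h (u + of_int l)) has_integral integral {of_int l..of_int l + 1} h)
        ((\<lambda>u. u - of_int l) ` {of_int l..of_int l + 1})"
      by simp
    also have "(\<lambda>u. u - of_int l) ` {of_int l..of_int l + 1} = {0..1::real}"
      by simp
    finally show ?thesis by (simp add: add.commute)
  qed
  have "(\<Sum>l\<in>{- int N..<int N}. integral {of_int l..of_int l + 1} h) = integral {- real N..real N} h"
  proof (induction N)
    case (Suc N)
    define p q where "p = - real N - 1" and "q = real N + 1"
    define T where "T l = integral {real_of_int l..real_of_int l + 1} h" for l
    have "{- int (Suc N)..<int (Suc N)} = insert (- int N - 1) (insert (int N) {- int N..<int N})" by auto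
    then have "(\<Sum>l\<in>{- int (Suc N)..<int (Suc N)}. T l) = T (- int N - 1) + (T (int N) + integral {- real N..real N} h)"
      using Suc by (simp add: T_def)
    also have "T (- int N - 1) = integral {p..- real N} h"
      by (simp add: T_def p_def)
    also have "T (int N) = integral {real N..q} h"
      by (simp add: T_def q_def)
    also have "integral {p..- real N} h + (integral {real N..q} h + integral {- real N..real N} h) = integral {p..q} h"
      using Henstock_Kurzweil_Integration.integral_combine[of p "- real N" q h]
        Henstock_Kurzweil_Integration.integral_combine[of "- real N" "real N" q h] int
      by (simp add: p_def q_def)
    also have "{p..q} = {- real (Suc N)..real (Suc N)}"
      by (simp add: p_def q_def)
    finally show ?case by (simp add: T_def)
  qed simp
  with has_integral_sum[of "{- int N..<int N}" "\<lambda>l u. h (of_int l + u)" _ "{0..1}", OF _ one]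
  show ?thesis by simp
qed

text \<open>From (l + 2u)^2 >= 0 one gets (l + u)^2 >= l^2/2 - u^2, hence a majorant that is uniform
  for u in a bounded set.\<close>

lemma gauss_term_bound:
  fixes t u w :: real and l :: int
  assumes "t > 0" "\<bar>u\<bar> \<le> R"
  shows "exp (- pi * t * (of_int l + u) ^ 2) \<le> exp (pi * t * R ^ 2) * exp (- (pi * t / 2) * of_int l ^ 2)"
proof -
  have "0 \<le> (of_int l + 2 * u) ^ 2" by simp
  moreover have "u ^ 2 \<le> R ^ 2" using assms(2) by (metis abs_ge_zero power2_abs power_mono)
  ultimately have "(of_int l) ^ 2 / 2 - R ^ 2 \<le> (of_int l + u) ^ 2"
    by (simp add: power2_eq_square algebra_simps)
  then have "pi * t * (of_int l ^ 2 / 2 - R ^ 2) \<le> pi * t * (of_int l + u) ^ 2"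
    using assms by (intro mult_left_mono) auto
  then show ?thesis by (simp add: algebra_simps flip: exp_add)
qed

lemma summable_gauss_int:
  fixes a :: real
  assumes "a > 0"
  shows "(\<lambda>n::int. exp (- a * of_int n ^ 2)) summable_on UNIV"
  using summable_power_gauss_int[OF assms, of 0] by simp

text \<open>Both sides are continuous, even and 1-periodic in u, so it suffices to compare cosine
  coefficients: on the left they come from unfolding to an integral over the line, on the right from
  orthogonality of the cosines.\<close>

lemma poisson_gauss_real:
  fixes t u :: real
  assumes t: "t > 0"
  shows "(\<Sum>\<^sub>\<infinity>l::int. exp (- pi * t * (of_int l + u) ^ 2)) =
    (1 / sqrt t) * (\<Sum>\<^sub>\<infinity>k::int. exp (- pi * of_int k ^ 2 / t) * cos (2 * pi * of_int k * u))"
proof -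
  define \<phi> where "\<phi> u = (\<Sum>\<^sub>\<infinity>l::int. exp (- pi * t * (of_int l + u) ^ 2))" for u
  define \<psi> where "\<psi> u = (\<Sum>\<^sub>\<infinity>k::int. exp (- pi * of_int k ^ 2 / t) * cos (2 * pi * of_int k * u))" for u
  have unif\<phi>: "uniform_limit {-R..R} (\<lambda>X u. \<Sum>l\<in>X. exp (- pi * t * (of_int l + u) ^ 2)) \<phi>
      (finite_subsets_at_top UNIV)" for R
    unfolding \<phi>_def
  proof (rule Weierstrass_m_test_general)
    show "(\<lambda>l::int. exp (pi * t * R ^ 2) * exp (- (pi * t / 2) * of_int l ^ 2)) summable_on UNIV"
      using t by (intro summable_on_cmult_right summable_gauss_int) auto
  next
    fix l :: int and u :: real assume "u \<in> {-R..R}"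
    then show "norm (exp (- pi * t * (of_int l + u) ^ 2)) \<le> exp (pi * t * R ^ 2) * exp (- (pi * t / 2) * of_int l ^ 2)"
      using gauss_term_bound[OF t, of u R l] by (simp add: abs_le_iff)
  qed
  have unif\<psi>: "uniform_limit UNIV (\<lambda>X u. \<Sum>k\<in>X. exp (- pi * of_int k ^ 2 / t) * cos (2 * pi * of_int k * u)) \<psi>
      (finite_subsets_at_top UNIV)"
    unfolding \<psi>_def
  proof (rule Weierstrass_m_test_general)
    show "(\<lambda>k::int. exp (- (pi / t) * of_int k ^ 2)) summable_on UNIV"
      using t by (intro summable_gauss_int) auto
  next
    fix k :: int and u :: real
    show "norm (exp (- pi * of_int k ^ 2 / t) * cos (2 * pi * of_int k * u)) \<le> exp (- (pi / t) * of_int k ^ 2)"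
      by (simp add: abs_mult mult_left_le)
  qed
  have cont\<phi>: "continuous_on {-R..R} \<phi>" for R
    by (rule uniform_limit_theorem[OF _ unif\<phi>]) (auto intro!: always_eventually continuous_intros)
  have cont\<phi>': "continuous_on UNIV \<phi>"
    unfolding continuous_on_eq_continuous_at[OF open_UNIV]
  proof
    fix u :: real
    have "u \<in> interior {-(\<bar>u\<bar> + 1)..\<bar>u\<bar> + 1}" by auto
    then show "isCont \<phi> u" using cont\<phi>[of "\<bar>u\<bar> + 1"] continuous_on_interior by blast
  qed
  have cont\<psi>: "continuous_on UNIV \<psi>"
    by (rule uniform_limit_theorem[OF _ unif\<psi>]) (auto intro!: always_eventually continuous_intros)
  have per\<phi>: "\<phi> (u + 1) = \<phi> u" for u
  proof -
    have "\<phi> u = (\<Sum>\<^sub>\<infinity>l::int. exp (- pi * t * (of_int (l + 1) + u) ^ 2))"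
      unfolding \<phi>_def
      by (rule infsum_reindex_bij_witness[of _ "\<lambda>l. l + 1" "\<lambda>l. l - 1"]) auto
    then show ?thesis by (simp add: \<phi>_def add_ac)
  qed
  have even\<phi>: "\<phi> (- u) = \<phi> u" for u
    unfolding \<phi>_def
    by (rule infsum_reindex_bij_witness[of _ uminus uminus]) (auto simp: power2_eq_square algebra_simps)
  have per\<psi>: "\<psi> (u + 1) = \<psi> u" for u
  proof -
    have "cos (2 * pi * of_int k * (u + 1)) = cos (2 * pi * of_int k * u)" for k :: int
      using cos_add[of "2 * pi * of_int k * u" "of_int k * (2 * pi)"] sin_int_2pin[of k] cos_int_2pin[of k]
      by (simp add: algebra_simps)
    then show ?thesis by (simp add: \<psi>_def)
  qed
  have even\<psi>: "\<psi> (- u) = \<psi> u" for u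
    by (simp add: \<psi>_def)
  have coeff\<phi>: "((\<lambda>u. \<phi> u * cos (2 * pi * of_int j * u)) has_integral exp (- pi * of_int j ^ 2 / t) / sqrt t) {0..1}" for j :: int
  proof -
    define h where "h v = exp (- pi * t * v ^ 2) * cos (2 * pi * of_int j * v)" for v
    have h: "integrable lborel h" "(LINT v|lborel. h v) = exp (- pi * of_int j ^ 2 / t) / sqrt t"
      using gauss_cos_integral[OF t, of "of_int j"] unfolding h_def by auto
    have conth: "continuous_on UNIV h" unfolding h_def by (intro continuous_intros)
    \<comment> \<open>As j * l is an integer, the cosine does not see the translation by l, so the
      integrand of the coefficient is the periodization of \<open>h\<close>.\<close>
    have hshift: "h (of_int l + u) = exp (- pi * t * (of_int l + u) ^ 2) * cos (2 * pi * of_int j * u)" for l :: int and u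
      using cos_add[of "2 * pi * of_int j * u" "of_int (j * l) * (2 * pi)"] sin_int_2pin[of "j * l"] cos_int_2pin[of "j * l"]
      by (simp add: h_def algebra_simps)
    have "uniform_limit {0..1} (\<lambda>X u. \<Sum>l\<in>X. exp (- pi * t * (of_int l + u) ^ 2)) \<phi> (finite_subsets_at_top UNIV)"
      using unif\<phi>[of 1] by (rule uniform_limit_on_subset) auto
    then have "uniform_limit {0..1} (\<lambda>N u. \<Sum>l\<in>{- int N..<int N}. exp (- pi * t * (of_int l + u) ^ 2)) \<phi> sequentially"
      by (rule filterlim_compose[OF _ filterlim_symmetric_intervals])
    moreover have "continuous_on {0..1} \<phi>" using cont\<phi>' continuous_on_subset by blast
    ultimately have "uniform_limit {0..1} (\<lambda>N u. (\<Sum>l\<in>{- int N..<int N}. exp (- pi * t * (of_int l + u) ^ 2)) * cos (2 * pi * of_int j * u))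
        (\<lambda>u. \<phi> u * cos (2 * pi * of_int j * u)) sequentially"
      by (intro uniform_lim_mult uniform_limit_const compact_imp_bounded compact_continuous_image)
         (auto intro!: continuous_intros)
    then have unif: "uniform_limit {0..1} (\<lambda>N u. \<Sum>l\<in>{- int N..<int N}. h (of_int l + u))
        (\<lambda>u. \<phi> u * cos (2 * pi * of_int j * u)) sequentially"
      by (simp add: hshift sum_distrib_right)
    obtain I J where I: "\<And>N. ((\<lambda>u. \<Sum>l\<in>{- int N..<int N}. h (of_int l + u)) has_integral I N) {0..1}"
      and J: "((\<lambda>u. \<phi> u * cos (2 * pi * of_int j * u)) has_integral J) {0..1}" and IJ: "I \<longlonglongrightarrow> J"
      by (rule uniform_limit_integral[OF unif])
         (auto intro!: continuous_on_sum continuous_on_compose2[OF conth] continuous_intros)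
    have "I N = integral {- real N..real N} h" for N
      using I has_integral_unit_translates[OF conth] by (rule has_integral_unique)
    also have "\<dots> N = (LINT v|lborel. indicator {- real N..real N} v *\<^sub>R h v)" for N
      using set_borel_integral_eq_integral(2)[of "{- real N..real N}" h]
        set_integrable_subset[of lborel UNIV h "{- real N..real N}"] h(1)
      by (simp add: set_lebesgue_integral_def set_integrable_def)
    finally have "I = (\<lambda>N. LINT v|lborel. indicator {- real N..real N} v *\<^sub>R h v)" by blast
    moreover have "(\<lambda>N. LINT v|lborel. indicator {- real N..real N} v *\<^sub>R h v) \<longlonglongrightarrow> (LINT v|lborel. h v)"
    proof (rule integral_dominated_convergence[where w = "\<lambda>v. \<bar>h v\<bar>"])
      show "AE v in lborel. (\<lambda>N. indicator {- real N..real N} v *\<^sub>R h v) \<longlonglongrightarrow> h v"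
      proof (rule AE_I2)
        fix v :: real
        have "\<forall>\<^sub>F N in sequentially. v \<in> {- real N..real N}"
          using eventually_ge_at_top[of "nat \<lceil>\<bar>v\<bar>\<rceil>"] by eventually_elim (simp, linarith)
        then have "\<forall>\<^sub>F N in sequentially. h v = indicator {- real N..real N} v *\<^sub>R h v"
          by eventually_elim auto
        then show "(\<lambda>N. indicator {- real N..real N} v *\<^sub>R h v) \<longlonglongrightarrow> h v"
          by (rule Lim_transform_eventually[OF tendsto_const])
      qed
    qed (use h(1) in \<open>auto simp: indicator_def\<close>)
    ultimately have "J = (LINT v|lborel. h v)" using IJ LIMSEQ_unique by metis
    then show ?thesis using J h(2) by simp
  qed
  have coeff\<psi>: "((\<lambda>u. \<psi> u * cos (2 * pi * of_int j * u)) has_integral exp (- pi * of_int j ^ 2 / t)) {0..1}" for j :: int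
  proof -
    have "uniform_limit {0..1} (\<lambda>X u. \<Sum>k\<in>X. exp (- pi * of_int k ^ 2 / t) * cos (2 * pi * of_int k * u)) \<psi>
      (finite_subsets_at_top UNIV)"
      using unif\<psi> by (rule uniform_limit_on_subset) auto
    moreover have "continuous_on {0..1} \<psi>" using cont\<psi> continuous_on_subset by blast
    ultimately have unif: "uniform_limit {0..1} (\<lambda>X u. (\<Sum>k\<in>X. exp (- pi * of_int k ^ 2 / t) * cos (2 * pi * of_int k * u)) * cos (2 * pi * of_int j * u))
        (\<lambda>u. \<psi> u * cos (2 * pi * of_int j * u)) (finite_subsets_at_top UNIV)"
      by (intro uniform_lim_mult uniform_limit_const compact_imp_bounded compact_continuous_image)
         (auto intro!: continuous_intros)
    obtain I J where I: "\<And>X. ((\<lambda>u. (\<Sum>k\<in>X. exp (- pi * of_int k ^ 2 / t) * cos (2 * pi * of_int k * u)) * cos (2 * pi * of_int j * u)) has_integral I X) {0..1}"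
      and J: "((\<lambda>u. \<psi> u * cos (2 * pi * of_int j * u)) has_integral J) {0..1}" and IJ: "(I \<longlongrightarrow> J) (finite_subsets_at_top UNIV)"
      by (rule uniform_limit_integral[OF unif]) (auto intro!: continuous_intros)
    \<comment> \<open>For j \<noteq> 0 the indices j and -j contribute one half each, with equal
      Gaussians; for j = 0 both halves fall on k = 0.\<close>
    define c where "c k = exp (- pi * of_int k ^ 2 / t) * ((1/2) * ((if k - j = 0 then 1 else 0) + (if k + j = 0 then 1 else 0)))" for k :: int
    have "I X = (\<Sum>k\<in>X. c k)" if "finite X" for X
    proof (rule has_integral_unique[OF I])
      have "((\<lambda>u. \<Sum>k\<in>X. exp (- pi * of_int k ^ 2 / t) * ((1/2) * (cos (2 * pi * of_int (k - j) * u) + cos (2 * pi * of_int (k + j) * u))))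
          has_integral (\<Sum>k\<in>X. c k)) {0..1}"
        unfolding c_def
        by (intro has_integral_sum that has_integral_mult_right has_integral_add cos_integral_unit)
      moreover have "(1/2) * (cos (2 * pi * of_int (k - j) * u) + cos (2 * pi * of_int (k + j) * u)) =
          cos (2 * pi * of_int k * u) * cos (2 * pi * of_int j * u)" for k u
        by (simp add: ring_distribs cos_add cos_diff)
      ultimately show "((\<lambda>u. (\<Sum>k\<in>X. exp (- pi * of_int k ^ 2 / t) * cos (2 * pi * of_int k * u)) * cos (2 * pi * of_int j * u)) has_integral (\<Sum>k\<in>X. c k)) {0..1}"
        by (simp only: sum_distrib_right mult.assoc)
    qed
    then have "\<forall>\<^sub>F X in finite_subsets_at_top UNIV. I X = (\<Sum>k\<in>X. c k)"
      by (auto intro: eventually_finite_subsets_at_top_weakI)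
    with IJ have "(c has_sum J) UNIV"
      unfolding has_sum_def by (rule Lim_transform_eventually)
    moreover have "(c has_sum exp (- pi * of_int j ^ 2 / t)) UNIV"
    proof (rule has_sum_finite_neutralI[of "{j, - j}"])
      show "exp (- pi * of_int j ^ 2 / t) = sum c {j, - j}"
        by (cases "j = 0") (auto simp: c_def)
    qed (auto simp: c_def)
    ultimately have "J = exp (- pi * of_int j ^ 2 / t)" by (rule has_sum_unique)
    then show ?thesis using J by simp
  qed
  have "\<phi> u - (1 / sqrt t) * \<psi> u = 0"
  proof (rule even_periodic_eq_0_if_cos_coeffs_0[of "\<lambda>u. \<phi> u - (1 / sqrt t) * \<psi> u"])
    show "continuous_on UNIV (\<lambda>u. \<phi> u - (1 / sqrt t) * \<psi> u)"
      by (intro continuous_intros cont\<phi>' cont\<psi>)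
    fix j :: int
    have "((\<lambda>u. \<phi> u * cos (2 * pi * of_int j * u) - (1 / sqrt t) * (\<psi> u * cos (2 * pi * of_int j * u))) has_integral
       (exp (- pi * of_int j ^ 2 / t) / sqrt t - (1 / sqrt t) * exp (- pi * of_int j ^ 2 / t))) {0..1}"
      by (intro has_integral_diff has_integral_mult_right coeff\<phi> coeff\<psi>)
    then show "((\<lambda>u. (\<phi> u - (1 / sqrt t) * \<psi> u) * cos (2 * pi * of_int j * u)) has_integral 0) {0..1}"
      by (simp add: algebra_simps)
  qed (simp_all add: per\<phi> per\<psi> even\<phi> even\<psi>)
  then show ?thesis by (simp add: \<phi>_def \<psi>_def)
qed

section \<open>Theta series and their inversion\<close>

text \<open>Weierstrass' theorem on locally uniform limits, with convergence supplied by a local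
  majorant. Its second claim, termwise differentiation, later turns the Poisson formula of weight
  1/2 into that of weight 3/2.\<close>

lemma holomorphic_infsum:
  fixes f :: "'a \<Rightarrow> complex \<Rightarrow> complex"
  assumes "open S" and hol: "\<And>n. f n holomorphic_on S"
    and bound: "\<And>z. z \<in> S \<Longrightarrow> \<exists>r>0. \<exists>M. cball z r \<subseteq> S \<and> M summable_on UNIV \<and>
      (\<forall>n. \<forall>w\<in>cball z r. norm (f n w) \<le> M n)"
  shows "(\<lambda>z. \<Sum>\<^sub>\<infinity>n. f n z) holomorphic_on S"
    and "z \<in> S \<Longrightarrow> ((\<lambda>n. deriv (f n) z) has_sum deriv (\<lambda>z. \<Sum>\<^sub>\<infinity>n. f n z) z) UNIV"
proof -
  let ?F = "\<lambda>z. \<Sum>\<^sub>\<infinity>n. f n z"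
  have main: "\<exists>D. (?F has_field_derivative D) (at z) \<and> ((\<lambda>n. deriv (f n) z) has_sum D) UNIV" if z: "z \<in> S" for z
  proof -
    obtain r M where r: "r > 0" "cball z r \<subseteq> S" and M: "M summable_on UNIV"
      and fM: "\<And>n w. w \<in> cball z r \<Longrightarrow> norm (f n w) \<le> M n"
      using bound[OF z] by blast
    have unif: "uniform_limit (cball z r) (\<lambda>X w. \<Sum>n\<in>X. f n w) ?F (finite_subsets_at_top UNIV)"
      by (rule Weierstrass_m_test_general[OF _ M]) (use fM in auto)
    have der: "(f n has_field_derivative deriv (f n) w) (at w)" if "w \<in> S" for n w
      using holomorphic_derivI[OF hol \<open>open S\<close> that] .
    have ev: "\<forall>\<^sub>F X in finite_subsets_at_top UNIV. continuous_on (cball z r) (\<lambda>w. \<Sum>n\<in>X. f n w) \<and>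
        (\<forall>w\<in>ball z r. ((\<lambda>w. \<Sum>n\<in>X. f n w) has_field_derivative (\<Sum>n\<in>X. deriv (f n) w)) (at w))"
      using r(2)
      by (intro always_eventually allI conjI ballI continuous_on_sum DERIV_sum der
          continuous_on_subset[OF holomorphic_on_imp_continuous_on[OF hol]]) auto
    obtain g' where g': "\<And>w. w \<in> ball z r \<Longrightarrow> (?F has_field_derivative g' w) (at w) \<and>
        ((\<lambda>X. \<Sum>n\<in>X. deriv (f n) w) \<longlongrightarrow> g' w) (finite_subsets_at_top UNIV)"
      by (rule has_complex_derivative_uniform_limit[OF ev unif finite_subsets_at_top_neq_bot r(1)]) blast
    show ?thesis using g'[of z] r(1) unfolding has_sum_def by (intro exI[of _ "g' z"]) simp
  qed
  then show "?F holomorphic_on S"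
    using \<open>open S\<close> by (auto simp: holomorphic_on_open)
  show "((\<lambda>n. deriv (f n) z) has_sum deriv ?F z) UNIV" if "z \<in> S"
    using main[OF that] DERIV_imp_deriv by blast
qed

text \<open>The closed ball of radius Re z / 2 around z stays in the region Re s >= Re z / 2, so a
  majorant depending only on a lower bound of the real part is a local majorant.\<close>

lemma holomorphic_infsum_right_halfplane:
  fixes f :: "'a \<Rightarrow> complex \<Rightarrow> complex"
  assumes hol: "\<And>n. f n holomorphic_on {s. Re s > 0}"
    and M: "\<And>r. r > 0 \<Longrightarrow> M r summable_on UNIV"
    and le: "\<And>r n s. 0 < r \<Longrightarrow> r \<le> Re s \<Longrightarrow> norm (f n s) \<le> M r n"
  shows "(\<lambda>s. \<Sum>\<^sub>\<infinity>n. f n s) holomorphic_on {s. Re s > 0}"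
proof (rule holomorphic_infsum(1)[OF open_halfspace_Re_gt hol])
  fix z assume "z \<in> {s. Re s > 0}"
  then have z: "Re z / 2 > 0" by simp
  have half: "Re z / 2 \<le> Re w" if "w \<in> cball z (Re z / 2)" for w
    using that abs_Re_le_cmod[of "z - w"] by (auto simp: dist_norm)
  show "\<exists>r>0. \<exists>M. cball z r \<subseteq> {s. Re s > 0} \<and> M summable_on UNIV \<and> (\<forall>n. \<forall>w\<in>cball z r. norm (f n w) \<le> M n)"
  proof (intro exI[of _ "Re z / 2"] exI[of _ "M (Re z / 2)"] conjI allI ballI z M le half)
    show "cball z (Re z / 2) \<subseteq> {s. Re s > 0}"
    proof
      fix w assume "w \<in> cball z (Re z / 2)"
      from half[OF this] z show "w \<in> {s. Re s > 0}" by simp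
    qed
  qed
qed

text \<open>Carries formulas from real parameters, where all roots are positive, to complex ones;
  the interval supplies the accumulation point for the identity theorem.\<close>

lemma holomorphic_eq_if_eq_on_reals:
  assumes "f holomorphic_on S" "g holomorphic_on S" "open S" "connected S"
    and "a < b" "\<And>x. a < x \<Longrightarrow> x < b \<Longrightarrow> of_real x \<in> S" "\<And>x. a < x \<Longrightarrow> x < b \<Longrightarrow> f (of_real x) = g (of_real x)"
    and "z \<in> S"
  shows "f z = g z"
proof -
  define x where "x = (a + b) / 2"
  have x: "a < x" "x < b" using assms(5) by (auto simp: x_def)
  have "complex_of_real x islimpt complex_of_real ` {a<..<b}"
    unfolding islimpt_approachable
  proof (intro allI impI)
    fix e :: real assume "e > 0"
    define y where "y = x + min (e / 2) ((b - x) / 2)"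
    have "a < y" "y < b" "y \<noteq> x" "\<bar>y - x\<bar> < e"
      using x \<open>e > 0\<close> by (auto simp: y_def min_def field_simps)
    then show "\<exists>x'\<in>complex_of_real ` {a<..<b}. x' \<noteq> of_real x \<and> dist x' (of_real x) < e"
      by (intro bexI[of _ "of_real y"]) (auto simp: dist_real_def)
  qed
  then have "f z - g z = 0"
    using assms x
    by (intro analytic_continuation[of "\<lambda>z. f z - g z" S "complex_of_real ` {a<..<b}" "of_real x" z] holomorphic_on_diff) auto
  then show ?thesis by simp
qed

text \<open>The variable s is -i\<tau> up to scaling: the upper half plane becomes the right half
  plane, inversion becomes s to 1/s up to scaling, and for positive s the exponentials are real
  Gaussians.\<close>

definition gtheta :: "nat \<Rightarrow> (int \<Rightarrow> complex) \<Rightarrow> complex \<Rightarrow> complex" where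
  "gtheta j b s = (\<Sum>\<^sub>\<infinity>n. b n * of_int n ^ j * exp (- of_real pi * of_int n ^ 2 * s))"

lemma gtheta_term_bound:
  assumes "norm (b n) \<le> B" "r \<le> Re s"
  shows "norm (b n * of_int n ^ j * exp (- of_real pi * of_int n ^ 2 * s)) \<le>
    B * (\<bar>of_int n\<bar> ^ j * exp (- (pi * r) * of_int n ^ 2))"
proof -
  have "exp (- (pi * (of_int n ^ 2 * Re s))) \<le> exp (- (pi * (of_int n ^ 2 * r)))"
    using assms(2) by (auto intro!: mult_left_mono)
  moreover have "norm (exp (- of_real pi * of_int n ^ 2 * s)) = exp (- (pi * (of_int n ^ 2 * Re s)))"
  proof -
    have "(of_int n :: complex) ^ 2 = of_real (of_int n ^ 2)" by simp
    then have "- of_real pi * of_int n ^ 2 * s = of_real (- pi * of_int n ^ 2) * s"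
      by (simp only: of_real_mult of_real_minus)
    then show ?thesis by (simp only: norm_exp_eq_Re Re_complex_of_real times_complex.sel Im_complex_of_real) (simp add: mult_ac)
  qed
  ultimately show ?thesis
    using assms(1) order_trans[OF norm_ge_zero assms(1)]
    by (auto simp: norm_mult norm_power mult_ac intro!: mult_mono mult_left_mono)
qed

context
  fixes b :: "int \<Rightarrow> complex" and B :: real
  assumes b: "\<And>n. norm (b n) \<le> B"
begin

lemma gtheta_term_le:
  "r \<le> Re s \<Longrightarrow> norm (b n * of_int n ^ j * exp (- of_real pi * of_int n ^ 2 * s)) \<le>
    B * (\<bar>of_int n\<bar> ^ j * exp (- (pi * r) * of_int n ^ 2))"
  by (rule gtheta_term_bound, rule b)

lemma gtheta_has_sum:
  assumes "Re s > 0"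
  shows "((\<lambda>n. b n * of_int n ^ j * exp (- of_real pi * of_int n ^ 2 * s)) has_sum gtheta j b s) UNIV"
proof -
  have "(\<lambda>n::int. B * (\<bar>of_int n\<bar> ^ j * exp (- (pi * Re s) * of_int n ^ 2))) summable_on UNIV"
    using assms by (intro summable_on_cmult_right summable_power_gauss_int) auto
  then have "(\<lambda>n. norm (b n * of_int n ^ j * exp (- of_real pi * of_int n ^ 2 * s))) summable_on UNIV"
    by (rule summable_on_comparison_test) (rule gtheta_term_le[OF order_refl], rule norm_ge_zero)
  then show ?thesis
    unfolding gtheta_def by (rule has_sum_infsum[OF abs_summable_summable])
qed

lemma gtheta_norm_le:
  assumes "r > 0" "r \<le> Re s"
  shows "norm (gtheta j b s) \<le> B * (\<Sum>\<^sub>\<infinity>n::int. \<bar>of_int n\<bar> ^ j * exp (- (pi * r) * of_int n ^ 2))"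
proof -
  have bd: "((\<lambda>n::int. B * (\<bar>of_int n\<bar> ^ j * exp (- (pi * r) * of_int n ^ 2))) has_sum
      (B * (\<Sum>\<^sub>\<infinity>n::int. \<bar>of_int n\<bar> ^ j * exp (- (pi * r) * of_int n ^ 2)))) UNIV"
    using assms by (intro has_sum_cmult_right has_sum_infsum summable_power_gauss_int) auto
  have "Re s > 0" using assms by simp
  from gtheta_has_sum[OF this, of j] bd show ?thesis
    by (rule norm_infsum_le) (rule gtheta_term_le[OF assms(2)])
qed

lemma gtheta_holomorphic: "gtheta j b holomorphic_on {s. Re s > 0}"
proof -
  have "(\<lambda>s. \<Sum>\<^sub>\<infinity>n. b n * of_int n ^ j * exp (- of_real pi * of_int n ^ 2 * s)) holomorphic_on {s. Re s > 0}"
  proof (rule holomorphic_infsum_right_halfplane)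
    show "(\<lambda>n::int. B * (\<bar>of_int n\<bar> ^ j * exp (- (pi * r) * of_int n ^ 2))) summable_on UNIV" if "r > 0" for r
      using that by (intro summable_on_cmult_right summable_power_gauss_int) auto
  next
    fix r s and n :: int assume "0 < r" "r \<le> Re s"
    from gtheta_term_le[OF this(2)]
    show "norm (b n * of_int n ^ j * exp (- of_real pi * of_int n ^ 2 * s)) \<le> B * (\<bar>of_int n\<bar> ^ j * exp (- (pi * r) * of_int n ^ 2))" .
  qed (auto intro!: holomorphic_intros)
  then show ?thesis by (simp add: gtheta_def[abs_def])
qed

end

section \<open>Poisson summation with exponentials and complex parameters\<close>

lemma poisson_gauss_0_real:
  fixes t u :: real
  assumes t: "t > 0"
  shows "(\<Sum>\<^sub>\<infinity>l::int. exp (- of_real pi * of_real t * (of_int l + of_real u) ^ 2)) =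
    of_real (1 / sqrt t) * gtheta 0 (\<lambda>k. exp (- 2 * of_real pi * \<i> * of_int k * of_real u)) (1 / of_real t)"
proof -
  let ?e = "\<lambda>k::int. exp (- of_real pi * of_int k ^ 2 * (1 / of_real t)) :: complex"
  define X where "X = gtheta 0 (\<lambda>k. exp (- 2 * of_real pi * \<i> * of_int k * of_real u)) (1 / of_real t)"
  have "((\<lambda>k. exp (- 2 * of_real pi * \<i> * of_int k * of_real u) * of_int k ^ 0 * ?e k) has_sum X) UNIV"
    unfolding X_def using t by (intro gtheta_has_sum[of _ 1]) (auto simp: norm_exp_eq_Re)
  then have X1: "((\<lambda>k. exp (- 2 * of_real pi * \<i> * of_int k * of_real u) * ?e k) has_sum X) UNIV"
    by simp
  \<comment> \<open>The sum X does not change under k to -k; averaging the two forms turns the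
    exponential into a cosine.\<close>
  then have X2: "((\<lambda>k. exp (2 * of_real pi * \<i> * of_int k * of_real u) * ?e k) has_sum X) UNIV"
    by (subst has_sum_reindex_bij_witness[of _ uminus uminus]) auto
  have "((\<lambda>k. (exp (- 2 * of_real pi * \<i> * of_int k * of_real u) * ?e k +
      exp (2 * of_real pi * \<i> * of_int k * of_real u) * ?e k) / 2) has_sum (X + X) / 2) UNIV"
    by (intro has_sum_divide_const has_sum_add X1 X2)
  moreover have "(exp (- 2 * of_real pi * \<i> * of_int k * of_real u) * ?e k +
      exp (2 * of_real pi * \<i> * of_int k * of_real u) * ?e k) / 2 =
      of_real (exp (- pi * of_int k ^ 2 / t) * cos (2 * pi * of_int k * u))" for k
  proof -
    have cos: "complex_of_real (cos (2 * pi * of_int k * u)) =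
        (exp (2 * of_real pi * \<i> * of_int k * of_real u) + exp (- 2 * of_real pi * \<i> * of_int k * of_real u)) / 2"
      unfolding cos_of_real[symmetric] cos_exp_eq by (simp add: mult_ac)
    have exp: "complex_of_real (exp (- pi * of_int k ^ 2 / t)) = ?e k"
      by (simp flip: exp_of_real)
    have "(x * e + y * e) / 2 = e * ((y + x) / 2)" for x y e :: complex
      by (simp add: algebra_simps)
    then show ?thesis unfolding of_real_mult cos exp .
  qed
  ultimately have "((\<lambda>k. complex_of_real (exp (- pi * of_int k ^ 2 / t) * cos (2 * pi * of_int k * u))) has_sum X) UNIV"
    by simp
  moreover have "(\<lambda>k::int. exp (- pi * of_int k ^ 2 / t) * cos (2 * pi * of_int k * u)) summable_on UNIV"
  proof (rule abs_summable_summable, rule summable_on_comparison_test)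
    show "(\<lambda>k::int. exp (- (pi / t) * of_int k ^ 2)) summable_on UNIV"
      using t by (intro summable_gauss_int) auto
  qed (auto simp: abs_mult mult_left_le)
  ultimately have X: "X = of_real (\<Sum>\<^sub>\<infinity>k::int. exp (- pi * of_int k ^ 2 / t) * cos (2 * pi * of_int k * u))"
    by (intro has_sum_unique[OF _ has_sum_of_real[OF has_sum_infsum]])
  have "(\<lambda>l::int. exp (- pi * t * (of_int l + u) ^ 2)) summable_on UNIV"
  proof (rule summable_on_comparison_test)
    show "(\<lambda>l::int. exp (pi * t * \<bar>u\<bar> ^ 2) * exp (- (pi * t / 2) * of_int l ^ 2)) summable_on UNIV"
      using t by (intro summable_on_cmult_right summable_gauss_int) auto
  qed (use gauss_term_bound[OF t order_refl[of "\<bar>u\<bar>"]] in auto)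
  then have L: "((\<lambda>l::int. complex_of_real (exp (- pi * t * (of_int l + u) ^ 2))) has_sum
      of_real (\<Sum>\<^sub>\<infinity>l::int. exp (- pi * t * (of_int l + u) ^ 2))) UNIV"
    by (intro has_sum_of_real has_sum_infsum)
  moreover have "exp (- of_real pi * of_real t * (of_int l + of_real u) ^ 2) =
      complex_of_real (exp (- pi * t * (of_int l + u) ^ 2))" for l
    by (simp flip: exp_of_real)
  ultimately show ?thesis
    using infsumI[OF L] poisson_gauss_real[OF t, of u] X by (simp add: X_def del: of_real_exp)
qed

lemma norm_gauss_translate_le:
  assumes "r > 0" "r \<le> Re t" "\<bar>u\<bar> \<le> R"
  shows "norm (exp (- of_real pi * t * (of_int l + of_real u) ^ 2)) \<le>
    exp (pi * r * R ^ 2) * exp (- (pi * r / 2) * of_int l ^ 2)"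
proof -
  have "norm (exp (- of_real pi * t * (of_int l + of_real u) ^ 2)) = exp (- pi * Re t * (of_int l + u) ^ 2)"
  proof -
    have "(of_int l + of_real u :: complex) ^ 2 = of_real ((of_int l + u) ^ 2)" by simp
    then have "- of_real pi * t * (of_int l + of_real u) ^ 2 = of_real (- pi * (of_int l + u) ^ 2) * t"
      by (simp only: of_real_mult of_real_minus) (simp add: mult_ac)
    then show ?thesis by (simp only: norm_exp_eq_Re Re_complex_of_real times_complex.sel Im_complex_of_real) (simp add: mult_ac)
  qed
  also have "\<dots> \<le> exp (- pi * r * (of_int l + u) ^ 2)"
    using assms by (auto intro!: mult_mono)
  also have "\<dots> \<le> exp (pi * r * R ^ 2) * exp (- (pi * r / 2) * of_int l ^ 2)"
    using assms by (intro gauss_term_bound) auto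
  finally show ?thesis .
qed

text \<open>Differentiate the identity of \<open>poisson_gauss_0_real\<close> in u. To do so
  termwise, u is extended to a complex variable U in which both sides are entire; the derivative
  brings down l + U on one side and k on the other.\<close>

lemma poisson_gauss_1_real:
  fixes t u :: real
  assumes t: "t > 0"
  shows "(\<Sum>\<^sub>\<infinity>l::int. (of_int l + of_real u) * exp (- of_real pi * of_real t * (of_int l + of_real u) ^ 2)) =
    \<i> * of_real (1 / (t * sqrt t)) * gtheta 1 (\<lambda>k. exp (- 2 * of_real pi * \<i> * of_int k * of_real u)) (1 / of_real t)"
proof -
  define f where "f l U = exp (- of_real pi * of_real t * (of_int l + U) ^ 2)" for l :: int and U :: complex
  define g where "g k U = exp (- 2 * of_real pi * \<i> * of_int k * U) * exp (- of_real pi * of_int k ^ 2 / of_real t)" for k :: int and U :: complex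
  have fhol: "f l holomorphic_on UNIV" and ghol: "g l holomorphic_on UNIV" for l
    unfolding f_def g_def by (auto intro!: holomorphic_intros)
  have fder: "deriv (f l) U = - 2 * of_real pi * of_real t * ((of_int l + U) * f l U)" for l U
    unfolding f_def by (rule DERIV_imp_deriv) (auto intro!: derivative_eq_intros)
  have gder: "deriv (g l) U = - 2 * of_real pi * \<i> * (of_int l * g l U)" for l U
    unfolding g_def by (rule DERIV_imp_deriv) (auto intro!: derivative_eq_intros)
  have fbound: "norm (f l U) \<le> exp (pi * t * R ^ 2) * (exp (pi * t * R ^ 2) * exp (- (pi * t / 2) * of_int l ^ 2))"
    if "norm U \<le> R" for l U R
  proof -
    have "norm (f l U) = exp (- pi * t * ((of_int l + Re U) ^ 2 - Im U ^ 2))"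
      by (simp add: f_def norm_exp_eq_Re power2_eq_square algebra_simps)
    also have "\<dots> = exp (pi * t * Im U ^ 2) * exp (- pi * t * (of_int l + Re U) ^ 2)"
      by (simp add: algebra_simps flip: exp_add)
    also have "\<dots> \<le> exp (pi * t * R ^ 2) * (exp (pi * t * R ^ 2) * exp (- (pi * t / 2) * of_int l ^ 2))"
    proof (intro mult_mono gauss_term_bound[OF t])
      have "\<bar>Im U\<bar> \<le> R" using that abs_Im_le_cmod order_trans by blast
      then have "Im U ^ 2 \<le> R ^ 2" by (metis abs_ge_zero power2_abs power_mono)
      then show "exp (pi * t * Im U ^ 2) \<le> exp (pi * t * R ^ 2)" using t by simp
      show "\<bar>Re U\<bar> \<le> R" using that abs_Re_le_cmod order_trans by blast
    qed auto
    finally show ?thesis .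
  qed
  \<comment> \<open>The linear term 2 pi k Im U is absorbed by completing the square (k - 2 t Im
    U)^2, at the price of half of the Gaussian decay.\<close>
  have gbound: "norm (g k U) \<le> exp (2 * pi * t * R ^ 2) * exp (- (pi / (2 * t)) * of_int k ^ 2)"
    if "norm U \<le> R" for k U R
  proof -
    have "norm (g k U) = exp (2 * pi * of_int k * Im U - pi * of_int k ^ 2 / t)"
      by (simp add: g_def norm_exp_eq_Re norm_mult power2_eq_square flip: exp_add)
    also have "2 * pi * of_int k * Im U - pi * of_int k ^ 2 / t \<le> 2 * pi * t * R ^ 2 - (pi / (2 * t)) * of_int k ^ 2"
    proof -
      have "\<bar>Im U\<bar> \<le> R" using that abs_Im_le_cmod order_trans by blast
      then have "Im U ^ 2 \<le> R ^ 2" by (metis abs_ge_zero power2_abs power_mono)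
      have "0 \<le> (of_int k - 2 * t * Im U) ^ 2 / (2 * t)" using t by simp
      also have "\<dots> = of_int k ^ 2 / (2 * t) - 2 * of_int k * Im U + 2 * t * Im U ^ 2"
        using t by (simp add: power2_eq_square field_simps)
      also have "\<dots> \<le> of_int k ^ 2 / (2 * t) - 2 * of_int k * Im U + 2 * t * R ^ 2"
        using \<open>Im U ^ 2 \<le> R ^ 2\<close> t by simp
      finally have "0 \<le> pi * (of_int k ^ 2 / (2 * t) - 2 * of_int k * Im U + 2 * t * R ^ 2)" by simp
      moreover have "2 * (pi * of_int k ^ 2 / (2 * t)) = pi * of_int k ^ 2 / t" using t by simp
      ultimately show ?thesis by (simp add: algebra_simps)
    qed
    finally show ?thesis by (simp flip: exp_add)
  qed
  have loc: "norm w \<le> norm z + 1" if "w \<in> cball z 1" for w z :: complex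
    using that norm_triangle_ineq2[of w z] by (simp add: dist_norm norm_minus_commute)
  have fb: "\<exists>r>0. \<exists>M. cball z r \<subseteq> UNIV \<and> M summable_on UNIV \<and> (\<forall>n. \<forall>w\<in>cball z r. norm (f n w) \<le> M n)" for z
    using t
    by (intro exI[of _ 1] exI[of _ "\<lambda>l. exp (pi * t * (norm z + 1) ^ 2) * (exp (pi * t * (norm z + 1) ^ 2) * exp (- (pi * t / 2) * of_int l ^ 2))"]
        conjI allI ballI fbound loc summable_on_cmult_right summable_gauss_int) auto
  have gb: "\<exists>r>0. \<exists>M. cball z r \<subseteq> UNIV \<and> M summable_on UNIV \<and> (\<forall>n. \<forall>w\<in>cball z r. norm (g n w) \<le> M n)" for z
    using t
    by (intro exI[of _ 1] exI[of _ "\<lambda>l. exp (2 * pi * t * (norm z + 1) ^ 2) * exp (- (pi / (2 * t)) * of_int l ^ 2)"]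
        conjI allI ballI gbound loc summable_on_cmult_right summable_gauss_int) auto
  define F where "F U = (\<Sum>\<^sub>\<infinity>l. f l U)" for U
  define G where "G U = (\<Sum>\<^sub>\<infinity>l. g l U)" for U
  have Fhol: "F holomorphic_on UNIV" and Fsum: "((\<lambda>l. deriv (f l) U) has_sum deriv F U) UNIV" for U
    unfolding F_def using holomorphic_infsum[OF open_UNIV fhol fb] by auto
  have Ghol: "G holomorphic_on UNIV" and Gsum: "((\<lambda>l. deriv (g l) U) has_sum deriv G U) UNIV" for U
    unfolding G_def using holomorphic_infsum[OF open_UNIV ghol gb] by auto
  have "F U = of_real (1 / sqrt t) * G U" for U
  proof (rule holomorphic_eq_if_eq_on_reals[of F UNIV _ 0 1])
    fix x :: real
    show "F (of_real x) = of_real (1 / sqrt t) * G (of_real x)"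
      using poisson_gauss_0_real[OF t, of x] by (simp add: F_def G_def f_def g_def gtheta_def)
  qed (auto intro!: holomorphic_intros Fhol Ghol)
  then have "F = (\<lambda>U. of_real (1 / sqrt t) * G U)" by blast
  moreover have "(G has_field_derivative deriv G U) (at U)" for U
    using holomorphic_derivI[OF Ghol] by auto
  ultimately have "deriv F (of_real u) = of_real (1 / sqrt t) * deriv G (of_real u)"
    by (intro DERIV_imp_deriv) (metis DERIV_cmult)
  moreover have "deriv F (of_real u) = - 2 * of_real pi * of_real t * (\<Sum>\<^sub>\<infinity>l. (of_int l + of_real u) * f l (of_real u))"
    using infsumI[OF Fsum[of "of_real u"]] unfolding fder infsum_cmult_right' by simp
  moreover have "deriv G (of_real u) = - 2 * of_real pi * \<i> * gtheta 1 (\<lambda>k. exp (- 2 * of_real pi * \<i> * of_int k * of_real u)) (1 / of_real t)"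
    using infsumI[OF Gsum[of "of_real u"]] unfolding gder infsum_cmult_right' by (simp add: g_def gtheta_def mult_ac)
  ultimately show ?thesis
    using t by (simp add: f_def field_simps)
qed

lemma gauss_translate_has_sum:
  assumes "Re t > 0"
  shows "((\<lambda>l::int. (of_int l + of_real u) ^ j * exp (- of_real pi * t * (of_int l + of_real u) ^ 2)) has_sum
    (\<Sum>\<^sub>\<infinity>l::int. (of_int l + of_real u) ^ j * exp (- of_real pi * t * (of_int l + of_real u) ^ 2))) UNIV" (is ?sum)
    and "(\<lambda>t. \<Sum>\<^sub>\<infinity>l::int. (of_int l + of_real u) ^ j * exp (- of_real pi * t * (of_int l + of_real u) ^ 2))
      holomorphic_on {t. Re t > 0}" (is ?hol)
proof -
  \<comment> \<open>\<open>M\<close> bounds |l + u| by |l| + |u| and expands the j-th power, so that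
    each summand is a power of |l| times a Gaussian.\<close>
  define M where "M r n = exp (pi * r * \<bar>u\<bar> ^ 2) * (\<Sum>i\<le>j. of_nat (j choose i) * \<bar>u\<bar> ^ (j - i) * (\<bar>of_int n\<bar> ^ i * exp (- (pi * r / 2) * of_int n ^ 2)))"
    for r :: real and n :: int
  have M: "M r summable_on UNIV" if "r > 0" for r
  proof -
    have "(\<lambda>n::int. \<Sum>i\<in>A. of_nat (j choose i) * \<bar>u\<bar> ^ (j - i) * (\<bar>of_int n\<bar> ^ i * exp (- (pi * r / 2) * of_int n ^ 2))) summable_on UNIV"
      if "finite A" for A
      using that
    proof (induction A)
      case (insert i A)
      have "(\<lambda>n::int. of_nat (j choose i) * \<bar>u\<bar> ^ (j - i) * (\<bar>of_int n\<bar> ^ i * exp (- (pi * r / 2) * of_int n ^ 2))) summable_on UNIV"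
        using \<open>r > 0\<close> by (intro summable_on_cmult_right summable_power_gauss_int) auto
      from summable_on_add[OF this insert.IH] show ?case
        by (simp only: sum.insert[OF insert.hyps])
    qed simp
    then show ?thesis unfolding M_def by (intro summable_on_cmult_right) auto
  qed
  have le: "norm ((of_int l + of_real u) ^ j * exp (- of_real pi * t * (of_int l + of_real u) ^ 2)) \<le> M r l"
    if "0 < r" "r \<le> Re t" for t r and l :: int
  proof -
    have "norm (of_int l + of_real u :: complex) \<le> \<bar>of_int l\<bar> + \<bar>u\<bar>"
      by (metis norm_of_int norm_of_real norm_triangle_ineq)
    then have "norm ((of_int l + of_real u) ^ j :: complex) \<le> (\<bar>of_int l\<bar> + \<bar>u\<bar>) ^ j"
      by (simp add: norm_power power_mono)
    then have "norm ((of_int l + of_real u) ^ j * exp (- of_real pi * t * (of_int l + of_real u) ^ 2)) \<le>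
        (\<bar>of_int l\<bar> + \<bar>u\<bar>) ^ j * (exp (pi * r * \<bar>u\<bar> ^ 2) * exp (- (pi * r / 2) * of_int l ^ 2))"
      unfolding norm_mult by (intro mult_mono norm_gauss_translate_le that) auto
    also have "\<dots> = M r l"
      unfolding M_def binomial_ring by (simp add: sum_distrib_left sum_distrib_right mult_ac)
    finally show ?thesis .
  qed
  have "(\<lambda>l::int. norm ((of_int l + of_real u) ^ j * exp (- of_real pi * t * (of_int l + of_real u) ^ 2))) summable_on UNIV"
    using M[OF assms] by (rule summable_on_comparison_test) (rule le[OF assms order_refl], rule norm_ge_zero)
  then show ?sum by (rule has_sum_infsum[OF abs_summable_summable])
  show ?hol
    by (rule holomorphic_infsum_right_halfplane[OF _ M le]) (auto intro!: holomorphic_intros)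
qed

lemma Re_inverse_pos: "Re s > 0 \<Longrightarrow> Re (1 / s) > 0"
  by (auto simp: Re_divide intro!: divide_pos_pos add_pos_nonneg)

lemma Re_pos_not_nonpos_Reals: "Re s > 0 \<Longrightarrow> s \<notin> \<real>\<^sub>\<le>\<^sub>0"
  by (auto simp: complex_nonpos_Reals_iff)

text \<open>Analytic continuation in t from (0,1): both sides are holomorphic on the right half
  plane, where the principal power extends the real one. The bound j <= 1 reflects that x^j exp(-pi
  x^2) is an eigenfunction of the Fourier transform only in these cases.\<close>

lemma poisson_gauss:
  assumes t: "Re t > 0" and j: "j \<le> 1"
  shows "((\<lambda>l::int. (of_int l + of_real u) ^ j * exp (- of_real pi * t * (of_int l + of_real u) ^ 2)) has_sum
    (\<i> ^ j * t powr (- 1 / 2 - of_nat j) * gtheta j (\<lambda>k. exp (- 2 * of_real pi * \<i> * of_int k * of_real u)) (1 / t))) UNIV"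
proof -
  let ?L = "\<lambda>t. \<Sum>\<^sub>\<infinity>l::int. (of_int l + of_real u) ^ j * exp (- of_real pi * t * (of_int l + of_real u) ^ 2)"
  let ?b = "\<lambda>k::int. exp (- 2 * of_real pi * \<i> * of_int k * of_real u)"
  have hol: "(\<lambda>t. gtheta j ?b (1 / t)) holomorphic_on {t. Re t > 0}"
  proof -
    have "(gtheta j ?b \<circ> (\<lambda>t. 1 / t)) holomorphic_on {t. Re t > 0}"
    proof (rule holomorphic_on_compose_gen)
      show "(\<lambda>t. 1 / t) holomorphic_on {t. Re t > 0}"
        by (intro holomorphic_intros) auto
      show "gtheta j ?b holomorphic_on {s. Re s > 0}"
        by (rule gtheta_holomorphic[of _ 1]) (simp add: norm_exp_eq_Re)
    qed (use Re_inverse_pos in blast)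
    then show ?thesis by (simp add: o_def)
  qed
  have "?L t = \<i> ^ j * t powr (- 1 / 2 - of_nat j) * gtheta j ?b (1 / t)"
  proof (rule holomorphic_eq_if_eq_on_reals[of ?L "{t. Re t > 0}" _ 0 1])
    show "(\<lambda>t. \<i> ^ j * t powr (- 1 / 2 - of_nat j) * gtheta j ?b (1 / t)) holomorphic_on {t. Re t > 0}"
      by (intro holomorphic_intros hol) (auto dest: Re_pos_not_nonpos_Reals)
    show "connected {t. Re t > 0}"
      by (intro convex_connected convex_halfspace_Re_gt)
  next
    fix x :: real assume x: "0 < x" "x < 1"
    have 0: "x powr (- 1 / 2) = 1 / sqrt x"
      using x by (simp add: powr_minus_divide powr_half_sqrt)
    have 1: "x powr (- 3 / 2) = 1 / (x * sqrt x)"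
      using x powr_add[of x 1 "1/2"] by (simp add: powr_minus_divide powr_half_sqrt)
    show "?L (of_real x) = \<i> ^ j * of_real x powr (- 1 / 2 - of_nat j) * gtheta j ?b (1 / of_real x)"
    proof (cases "j = 0")
      case True
      then show ?thesis
        using poisson_gauss_0_real[OF x(1), of u] powr_of_real[of x "- 1 / 2"] 0 x by simp
    next
      case False
      then have "j = 1" using j by simp
      then show ?thesis
        using poisson_gauss_1_real[OF x(1), of u] powr_of_real[of x "- 3 / 2"] 1 x by simp
    qed
  qed (use t gauss_translate_has_sum(2) in \<open>auto intro: open_halfspace_Re_gt\<close>)
  then show ?thesis using gauss_translate_has_sum(1)[OF t, of u j] by simp
qed

lemma gtheta_sum:
  assumes "finite A" "\<And>r n. r \<in> A \<Longrightarrow> norm (b r n) \<le> 1" "Re s > 0"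
  shows "gtheta j (\<lambda>n. \<Sum>r\<in>A. c r * b r n) s = (\<Sum>r\<in>A. c r * gtheta j (b r) s)"
proof -
  have "((\<lambda>n. (\<Sum>r\<in>A. c r * b r n) * of_int n ^ j * exp (- of_real pi * of_int n ^ 2 * s)) has_sum
      (\<Sum>r\<in>A. c r * gtheta j (b r) s)) UNIV"
    using assms(1,2)
  proof (induction A rule: finite_induct)
    case (insert r A)
    have "((\<lambda>n. b r n * of_int n ^ j * exp (- of_real pi * of_int n ^ 2 * s)) has_sum gtheta j (b r) s) UNIV"
      using insert assms(3) by (intro gtheta_has_sum[of _ 1]) auto
    then have "((\<lambda>n. c r * (b r n * of_int n ^ j * exp (- of_real pi * of_int n ^ 2 * s)) +
        (\<Sum>r\<in>A. c r * b r n) * of_int n ^ j * exp (- of_real pi * of_int n ^ 2 * s)) has_sum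
        (c r * gtheta j (b r) s + (\<Sum>r\<in>A. c r * gtheta j (b r) s))) UNIV"
      using insert by (intro has_sum_add has_sum_cmult_right) auto
    then show ?case
      using insert(1,2) by (simp add: ring_distribs mult.assoc)
  qed simp
  then show ?thesis unfolding gtheta_def by (rule infsumI)
qed

lemma periodic_shift_mult:
  fixes b :: "int \<Rightarrow> 'a"
  assumes "\<And>n. b (n + K) = b n"
  shows "b (K * l + r) = b r"
proof (induction l rule: int_induct[of _ 0])
  case (step1 i)
  then show ?case using assms[of "K * i + r"] by (simp add: algebra_simps)
next
  case (step2 i)
  then show ?case using assms[of "K * (i - 1) + r"] by (simp add: algebra_simps)
qed simp

lemma periodic_bounded:
  fixes b :: "int \<Rightarrow> complex"
  assumes "K > 0" "\<And>n. b (n + K) = b n"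
  obtains B where "B > 0" "\<And>n. norm (b n) \<le> B"
proof
  show "(\<Sum>r\<in>{0..<K}. norm (b r)) + 1 > 0"
    by (intro add_nonneg_pos sum_nonneg) auto
  fix n
  have "b n = b (n mod K)"
    using periodic_shift_mult[of b K "n div K" "n mod K", OF assms(2)] by simp
  then have "norm (b n) \<le> (\<Sum>r\<in>{0..<K}. norm (b r))"
    using assms(1) by (simp, intro member_le_sum) auto
  then show "norm (b n) \<le> (\<Sum>r\<in>{0..<K}. norm (b r)) + 1" by simp
qed

text \<open>Write n = K l + r. Each residue class is a Gaussian sum over l with translation u = r/K
  and parameter t = K^2 s; collecting the classes gives the finite Fourier transform of b.\<close>

lemma gtheta_inversion:
  fixes K :: int
  assumes K: "K > 0" and per: "\<And>n. b (n + K) = b n" and s: "Re s > 0" and j: "j \<le> 1"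
  shows "gtheta j b s = \<i> ^ j * of_int K ^ j * (of_int K ^ 2 * s) powr (- 1 / 2 - of_nat j) *
    gtheta j (\<lambda>k. \<Sum>r\<in>{0..<K}. b r * exp (- 2 * of_real pi * \<i> * of_int k * of_real (of_int r / of_int K))) (1 / (of_int K ^ 2 * s))"
proof -
  define t where "t = of_int K ^ 2 * s"
  have "(of_int K :: complex) ^ 2 = of_real (of_int K ^ 2)" by simp
  then have t: "Re t > 0"
    using K s unfolding t_def by (simp only: Re_complex_of_real times_complex.sel Im_complex_of_real) simp
  let ?e = "\<lambda>r k. exp (- 2 * of_real pi * \<i> * of_int k * of_real (of_int r / of_int K))"
  let ?c = "\<i> ^ j * of_int K ^ j * t powr (- 1 / 2 - of_nat j)"
  let ?f = "\<lambda>n. b n * of_int n ^ j * exp (- of_real pi * of_int n ^ 2 * s)"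
  have part: "(?f has_sum ?c * (b r * gtheta j (?e r) (1 / t))) {n. n mod K = r}" if r: "r \<in> {0..<K}" for r
  proof -
    have eq: "of_int K * (of_int l + of_real (of_int r / of_int K)) = (of_int (K * l + r) :: complex)" for l
      using K by (simp add: field_simps)
    have "((\<lambda>l::int. (b r * of_int K ^ j) * ((of_int l + of_real (of_int r / of_int K)) ^ j * exp (- of_real pi * t * (of_int l + of_real (of_int r / of_int K)) ^ 2))) has_sum
      ((b r * of_int K ^ j) * (\<i> ^ j * t powr (- 1 / 2 - of_nat j) * gtheta j (?e r) (1 / t)))) UNIV"
      by (intro has_sum_cmult_right poisson_gauss t j)
    moreover have "(b r * of_int K ^ j) * ((of_int l + of_real (of_int r / of_int K)) ^ j * exp (- of_real pi * t * (of_int l + of_real (of_int r / of_int K)) ^ 2)) =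
        ?f (K * l + r)" for l
    proof -
      define x :: complex where "x = of_int l + of_real (of_int r / of_int K)"
      have 1: "t * x ^ 2 = of_int (K * l + r) ^ 2 * s"
        unfolding eq[symmetric] x_def by (simp add: t_def power_mult_distrib mult_ac)
      have 2: "of_int K ^ j * x ^ j = (of_int (K * l + r) :: complex) ^ j"
        unfolding eq[symmetric] x_def by (simp add: power_mult_distrib)
      have 3: "b (K * l + r) = b r" by (rule periodic_shift_mult) (rule per)
      have "(b r * of_int K ^ j) * (x ^ j * exp (- of_real pi * t * x ^ 2)) =
          b r * (of_int K ^ j * x ^ j) * exp (- of_real pi * (t * x ^ 2))"
        by (simp add: mult_ac)
      also have "\<dots> = ?f (K * l + r)"
        unfolding 1 2 3 by (simp add: mult_ac)
      finally show ?thesis unfolding x_def .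
    qed
    ultimately have "((\<lambda>l. ?f (K * l + r)) has_sum (?c * (b r * gtheta j (?e r) (1 / t)))) UNIV"
      by (simp only: mult_ac)
    moreover have "bij_betw (\<lambda>l. K * l + r) UNIV {n. n mod K = r}"
    proof (rule bij_betwI[where g = "\<lambda>n. n div K"])
      show "(\<lambda>l. K * l + r) \<in> UNIV \<rightarrow> {n. n mod K = r}" using r by auto
    qed (use r K in auto)
    ultimately show ?thesis
      using has_sum_reindex_bij_betw[of "\<lambda>l. K * l + r" UNIV "{n. n mod K = r}" ?f] by simp
  qed
  have "(?f has_sum (\<Sum>r\<in>{0..<K}. ?c * (b r * gtheta j (?e r) (1 / t)))) (\<Union>r\<in>{0..<K}. {n. n mod K = r})"
    by (rule sum_has_sum) (use part in auto)
  also have "(\<Union>r\<in>{0..<K}. {n. n mod K = r}) = UNIV"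
    using K by auto
  finally have "gtheta j b s = (\<Sum>r\<in>{0..<K}. ?c * (b r * gtheta j (?e r) (1 / t)))"
    unfolding gtheta_def by (rule infsumI)
  also have "\<dots> = ?c * gtheta j (\<lambda>k. \<Sum>r\<in>{0..<K}. b r * ?e r k) (1 / t)"
    using Re_inverse_pos[OF t] by (subst gtheta_sum) (auto simp: sum_distrib_left norm_exp_eq_Re)
  finally show ?thesis by (simp add: t_def)
qed

section \<open>Gauss sums and modular transformations\<close>

definition e2pi :: "real \<Rightarrow> complex" where
  "e2pi x = exp (2 * of_real pi * \<i> * of_real x)"

lemma e2pi_add: "e2pi (x + y) = e2pi x * e2pi y"
  by (simp add: e2pi_def ring_distribs exp_add)

lemma norm_e2pi [simp]: "norm (e2pi x) = 1"
  by (simp add: e2pi_def)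

lemma cnj_e2pi: "cnj (e2pi x) = e2pi (- x)"
  by (simp add: e2pi_def exp_cnj)

lemma e2pi_eq_1_iff: "e2pi x = 1 \<longleftrightarrow> x \<in> \<int>"
  unfolding e2pi_def exp_eq_1 by (auto simp: Ints_def)

lemma e2pi_of_int [simp]: "e2pi (of_int n) = 1"
  by (simp add: e2pi_eq_1_iff)

lemma e2pi_0 [simp]: "e2pi 0 = 1"
  using e2pi_of_int[of 0] by simp

lemma e2pi_add_of_int [simp]: "e2pi (x + of_int n) = e2pi x"
  by (simp add: e2pi_add)

lemma sum_periodic_shift:
  fixes F :: "int \<Rightarrow> 'a :: comm_monoid_add"
  assumes "K > 0" "\<And>n. F (n + K) = F n"
  shows "(\<Sum>n\<in>{0..<K}. F (n + t)) = (\<Sum>n\<in>{0..<K}. F n)"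
proof -
  have mod: "F (n mod K) = F n" for n
    using periodic_shift_mult[of F K "n div K" "n mod K", OF assms(2)] by simp
  show ?thesis
  proof (rule sum.reindex_bij_witness[of _ "\<lambda>n. (n - t) mod K" "\<lambda>n. (n + t) mod K"])
    fix n assume "n \<in> {0..<K}"
    then show "((n + t) mod K - t) mod K = n" "((n - t) mod K + t) mod K = n"
      by (auto simp: mod_simps)
  qed (use assms(1) mod in auto)
qed

text \<open>Replacing n by n + 1 permutes the residues and multiplies the sum by a root of unity
  different from 1.\<close>

lemma sum_e2pi_eq_0:
  fixes K h :: int
  assumes "K > 0" "\<not> K dvd h"
  shows "(\<Sum>n\<in>{0..<K}. e2pi (of_int (h * n) / of_int K)) = 0"
proof -
  let ?F = "\<lambda>n::int. e2pi (of_int (h * n) / of_int K)"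
  have "?F (n + K) = ?F n" for n
  proof -
    have "of_int (h * (n + K)) / of_int K = (of_int (h * n) / of_int K + of_int h :: real)"
      using assms(1) by (simp add: field_simps)
    then show ?thesis by simp
  qed
  then have "(\<Sum>n\<in>{0..<K}. ?F (n + 1)) = (\<Sum>n\<in>{0..<K}. ?F n)"
    by (intro sum_periodic_shift assms)
  moreover have "?F (n + 1) = e2pi (of_int h / of_int K) * ?F n" for n
    by (simp add: e2pi_add[symmetric] add_divide_distrib ring_distribs add.commute)
  ultimately have "e2pi (of_int h / of_int K) * (\<Sum>n\<in>{0..<K}. ?F n) = (\<Sum>n\<in>{0..<K}. ?F n)"
    by (simp only: sum_distrib_left)
  then have "(e2pi (of_int h / of_int K) - 1) * (\<Sum>n\<in>{0..<K}. ?F n) = 0"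
    by (simp only: left_diff_distrib) simp
  moreover have "of_int h / of_int K \<notin> (\<int> :: real set)"
  proof
    assume "of_int h / of_int K \<in> (\<int> :: real set)"
    then obtain l where "of_int h / of_int K = (of_int l :: real)" by (auto elim: Ints_cases)
    then have "(of_int h :: real) = of_int (l * K)"
      using assms(1) by (simp add: field_simps)
    then have "h = l * K" by (simp only: of_int_eq_iff)
    then show False using assms(2) by simp
  qed
  ultimately show ?thesis by (simp add: e2pi_eq_1_iff)
qed

text \<open>In the squared modulus put h + n for h: the quadratic terms in n cancel and a character
  n to e(ahn/K) remains, whose sum vanishes unless h = 0. Evenness of K makes the summand, with
  denominator 2K, periodic modulo K.\<close>

lemma norm_gauss_sum:
  fixes a K :: int
  assumes "K > 0" "even K" "coprime a K"
  shows "norm (\<Sum>n\<in>{0..<K}. e2pi (of_int (a * n ^ 2) / of_int (2 * K))) ^ 2 = of_int K"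
proof -
  define E where "E n = e2pi (of_int (a * n ^ 2) / of_int (2 * K))" for n
  have per: "E (n + K) = E n" for n
  proof -
    obtain k where k: "K = 2 * k" using assms(2) by auto
    have "of_int (a * (n + K) ^ 2) / of_int (2 * K) = (of_int (a * n ^ 2) / of_int (2 * K) + of_int (a * n + a * k) :: real)"
      using assms(1) by (simp add: k field_simps power2_eq_square)
    then show ?thesis by (simp only: E_def e2pi_add_of_int)
  qed
  have "of_real (norm (\<Sum>n\<in>{0..<K}. E n) ^ 2) = (\<Sum>n\<in>{0..<K}. E n) * cnj (\<Sum>n\<in>{0..<K}. E n)"
    by (rule complex_norm_square)
  also have "\<dots> = (\<Sum>n\<in>{0..<K}. (\<Sum>h\<in>{0..<K}. E h) * cnj (E n))"
    by (simp add: sum_distrib_left)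
  also have "\<dots> = (\<Sum>n\<in>{0..<K}. (\<Sum>h\<in>{0..<K}. E (h + n)) * cnj (E n))"
    by (subst sum_periodic_shift[of K E]) (auto simp: assms per)
  also have "\<dots> = (\<Sum>h\<in>{0..<K}. \<Sum>n\<in>{0..<K}. E (h + n) * cnj (E n))"
    by (simp add: sum_distrib_right, subst sum.swap) simp
  also have "\<dots> = (\<Sum>h\<in>{0..<K}. E h * (\<Sum>n\<in>{0..<K}. e2pi (of_int (a * h * n) / of_int K)))"
  proof -
    have "E (h + n) * cnj (E n) = E h * e2pi (of_int (a * h * n) / of_int K)" for h n
      unfolding E_def cnj_e2pi e2pi_add[symmetric] using assms(1)
      by (intro arg_cong[where f = e2pi]) (simp add: field_simps power2_eq_square)
    then show ?thesis by (simp add: sum_distrib_left)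
  qed
  also have "\<dots> = (\<Sum>h\<in>{0..<K}. if h = 0 then of_int K else 0)"
  proof (rule sum.cong[OF refl])
    fix h assume h: "h \<in> {0..<K}"
    show "E h * (\<Sum>n\<in>{0..<K}. e2pi (of_int (a * h * n) / of_int K)) = (if h = 0 then of_int K else 0)"
    proof (cases "h = 0")
      case True
      then show ?thesis using assms(1) by (simp add: E_def)
    next
      case False
      have "\<not> K dvd a * h"
        using False h assms(3) zdvd_not_zless[of h K] coprime_dvd_mult_right_iff[of K a h]
        by (auto simp: coprime_commute)
      then show ?thesis
        using False by (simp add: sum_e2pi_eq_0[OF assms(1) \<open>\<not> K dvd a * h\<close>] del: of_int_mult)
    qed
  qed
  also have "\<dots> = of_int K" using assms(1) by simp
  finally have "complex_of_real (norm (\<Sum>n\<in>{0..<K}. E n) ^ 2) = of_real (of_int K)" by simp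
  then show ?thesis unfolding E_def of_real_eq_iff .
qed

text \<open>A real translation of \<tau> only multiplies the coefficients by a phase. For a rational
  translation the phase is periodic in n, so the coefficients stay periodic with a larger
  period.\<close>

lemma gtheta_vertical_shift:
  "gtheta j f (s - 2 * \<i> * of_real x) = gtheta j (\<lambda>n. f n * e2pi (of_int (n ^ 2) * x)) s"
proof -
  have "exp (- of_real pi * of_int n ^ 2 * (s - 2 * \<i> * of_real x)) =
      e2pi (of_int (n ^ 2) * x) * exp (- of_real pi * of_int n ^ 2 * s)" for n :: int
    by (simp add: e2pi_def algebra_simps flip: exp_add)
  then show ?thesis by (simp add: gtheta_def mult_ac)
qed

section \<open>Branches and Moebius transformations\<close>

lemma powr_inverse_complex: "z \<notin> \<real>\<^sub>\<le>\<^sub>0 \<Longrightarrow> (1 / z) powr p = z powr (- p)" for z :: complex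
  by (cases "z = 0") (auto simp: powr_def Ln_inverse simp flip: inverse_eq_divide)

text \<open>The argument of -ir is -pi/2 and that of w lies in (0,pi), so their sum stays in the
  principal range.\<close>

lemma powr_mult_neg_i:
  assumes "Im w > 0" "r > 0"
  shows "(- \<i> * of_real r * w) powr p = (- \<i> * of_real r) powr p * w powr p"
proof -
  have "Ln (- \<i> * of_real r) = Ln (of_real r * - \<i>)" by (simp add: mult.commute)
  also have "\<dots> = Ln (of_real r) + Ln (- \<i>)"
    using assms(2) by (subst Ln_times_of_real) (auto simp: Ln_of_real)
  finally have L: "Im (Ln (- \<i> * of_real r)) = - pi / 2"
    using assms(2) by (simp add: Ln_of_real)
  have "w \<noteq> 0" using assms by auto
  have W: "0 < Im (Ln w)" "Im (Ln w) < pi"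
    using Im_Ln_pos_lt[OF \<open>w \<noteq> 0\<close>] Im_Ln_pos_lt_imp[of w] assms(1) \<open>w \<noteq> 0\<close> by auto
  have "Ln ((- \<i> * of_real r) * w) = Ln (- \<i> * of_real r) + Ln w"
    by (rule Ln_times_simple) (use L W \<open>w \<noteq> 0\<close> assms(2) in auto)
  then show ?thesis
    using assms(2) \<open>w \<noteq> 0\<close> by (simp add: powr_def exp_add ring_distribs)
qed

text \<open>
  \<open>utheta m j f \<tau>\<close> is the series \<open>\<Sum> f(n) n\<^sup>j q^(n\<^sup>2/4m)\<close>, of weight \<open>1/2 + j\<close> for \<open>j \<le> 1\<close>.
\<close>

definition utheta :: "int \<Rightarrow> nat \<Rightarrow> (int \<Rightarrow> complex) \<Rightarrow> complex \<Rightarrow> complex" where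
  "utheta m j f \<tau> = gtheta j f (- \<i> * \<tau> / (2 * of_int m))"

lemma Re_utheta_arg: "m > 0 \<Longrightarrow> Re (- \<i> * \<tau> / (2 * of_int m)) = Im \<tau> / (2 * of_int m)"
proof -
  have "- \<i> * \<tau> / (2 * of_int m) = - \<i> * \<tau> / of_real (2 * of_int m)" by simp
  then show ?thesis by (simp only: Re_divide_of_real) simp
qed

lemma mobius_im_pos:
  fixes a b c d :: int
  assumes "a * d - b * c = 1" "Im \<tau> > 0"
  shows "of_int c * \<tau> + of_int d \<noteq> 0"
    and "Im ((of_int a * \<tau> + of_int b) / (of_int c * \<tau> + of_int d)) = Im \<tau> / norm (of_int c * \<tau> + of_int d) ^ 2"
    and "Im ((of_int a * \<tau> + of_int b) / (of_int c * \<tau> + of_int d)) > 0"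
proof -
  show nz: "of_int c * \<tau> + of_int d \<noteq> 0"
  proof
    assume "of_int c * \<tau> + of_int d = 0"
    then have "Im (of_int c * \<tau> + of_int d) = 0" "Re (of_int c * \<tau> + of_int d) = 0" by simp_all
    then have "c = 0" "d = 0" using assms(2) by auto
    then show False using assms(1) by simp
  qed
  have det: "(of_int a * of_int d - of_int b * of_int c :: real) = 1"
    using assms(1) by (metis of_int_1 of_int_diff of_int_mult)
  have "Im (of_int a * \<tau> + of_int b) * Re (of_int c * \<tau> + of_int d) - Re (of_int a * \<tau> + of_int b) * Im (of_int c * \<tau> + of_int d)
     = (of_int a * of_int d - of_int b * of_int c) * Im \<tau>"
    by (simp add: algebra_simps)
  then show eq: "Im ((of_int a * \<tau> + of_int b) / (of_int c * \<tau> + of_int d)) = Im \<tau> / norm (of_int c * \<tau> + of_int d) ^ 2"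
    unfolding Im_divide cmod_power2 det by simp
  show "Im ((of_int a * \<tau> + of_int b) / (of_int c * \<tau> + of_int d)) > 0"
    unfolding eq using assms(2) nz by simp
qed

text \<open>Bruhat decomposition: for c \<noteq> 0 the action is a translation, an inversion and a
  translation.\<close>

lemma mobius_split:
  fixes a b c d :: int
  assumes "a * d - b * c = 1" "c \<noteq> 0" "of_int c * \<tau> + of_int d \<noteq> (0 :: complex)"
  shows "(of_int a * \<tau> + of_int b) / (of_int c * \<tau> + of_int d) = of_int a / of_int c - 1 / (of_int c * (of_int c * \<tau> + of_int d))"
proof -
  have det: "(of_int a * of_int d - of_int b * of_int c :: complex) = 1"
    using assms(1) by (metis of_int_1 of_int_diff of_int_mult)
  have "of_int c * (of_int a * \<tau> + of_int b) = of_int a * (of_int c * \<tau> + of_int d) - (of_int a * of_int d - of_int b * of_int c)"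
    by (simp add: algebra_simps)
  then have "of_int c * (of_int a * \<tau> + of_int b) = of_int a * (of_int c * \<tau> + of_int d) - 1"
    unfolding det .
  moreover have "(of_int a * \<tau> + of_int b) / (of_int c * \<tau> + of_int d) =
      (of_int c * (of_int a * \<tau> + of_int b)) / (of_int c * (of_int c * \<tau> + of_int d))"
    using assms(2) by simp
  ultimately show ?thesis
    using assms(2,3) by (simp only: diff_divide_distrib) simp
qed

text \<open>Up to a scalar this is the action of the matrix on coefficient functions in the Weil
  representation. For f of period 2m the summand has period 2mc in n, which explains the range of
  summation.\<close>

definition gauss_kernel :: "int \<Rightarrow> int \<Rightarrow> int \<Rightarrow> int \<Rightarrow> (int \<Rightarrow> complex) \<Rightarrow> int \<Rightarrow> complex" where
  "gauss_kernel m a c d f k =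
     (\<Sum>n\<in>{0..<2 * m * c}. f n * e2pi (of_int (a * n ^ 2 - 2 * n * k + d * k ^ 2) / of_int (4 * m * c)))"

text \<open>Translation by a/c multiplies f by a phase of period K = 2mc, inversion takes the finite
  Fourier transform modulo K, and translation by d/c adds the phase in k. Of the scalar \<xi> only
  the modulus is recorded.\<close>

lemma utheta_mobius:
  fixes a b c d m :: int
  assumes m: "m > 0" and f: "\<And>n. f (n + 2 * m) = f n" and det: "a * d - b * c = 1" and c: "c > 0" and j: "j \<le> 1"
  obtains \<xi> where "norm \<xi> = 1 / sqrt (of_int (2 * m * c))"
    "\<And>\<tau>. Im \<tau> > 0 \<Longrightarrow> utheta m j f ((of_int a * \<tau> + of_int b) / (of_int c * \<tau> + of_int d)) =
      \<xi> * (of_int c * \<tau> + of_int d) powr (1 / 2 + of_nat j) * utheta m j (gauss_kernel m a c d f) \<tau>"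
proof
  define K where "K = 2 * m * c"
  have K: "K > 0" using m c by (simp add: K_def)
  define \<xi> where "\<xi> = \<i> ^ j * of_int K ^ j * (- \<i> * of_real (1 / of_int K)) powr (1 / 2 + of_nat j)"
  have "norm \<xi> = of_int K ^ j * (1 / of_int K) powr (1 / 2 + real j)"
  proof -
    have "(1 / 2 + of_nat j :: complex) = of_real (1 / 2 + real j)" by simp
    then have "norm ((- \<i> * of_real (1 / of_int K)) powr (1 / 2 + of_nat j)) = norm (- \<i> * complex_of_real (1 / of_int K)) powr (1 / 2 + real j)"
      by (simp only: norm_powr_real_powr' Reals_of_real Re_complex_of_real)
    also have "norm (- \<i> * complex_of_real (1 / of_int K)) = 1 / of_int K" using K by (simp add: norm_divide)
    finally show ?thesis using K by (simp add: \<xi>_def norm_mult norm_power)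
  qed
  also have "\<dots> = 1 / sqrt (of_int K)"
    using K by (simp add: powr_divide powr_add powr_half_sqrt powr_realpow)
  finally show "norm \<xi> = 1 / sqrt (of_int (2 * m * c))" by (simp add: K_def)
  fix \<tau> assume \<tau>: "Im \<tau> > 0"
  define w where "w = of_int c * \<tau> + of_int d"
  have w0: "w \<noteq> 0" unfolding w_def by (rule mobius_im_pos(1)[OF det \<tau>])
  have Imw: "Im w > 0" using c \<tau> by (simp add: w_def)
  \<comment> \<open>What remains of the argument at the transformed point after the translation by
    a/c: multiplied by -i/2m, the term -1/(cw) becomes i/(2mcw).\<close>
  define s where "s = \<i> / (of_int K * w)"
  have K2s: "1 / (of_int K ^ 2 * s) = - \<i> * of_real (1 / of_int K) * w"
    using K w0 by (simp add: s_def power2_eq_square field_simps)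
  have "Re (- \<i> * of_real (1 / of_int K) * w) > 0"
  proof -
    have "- \<i> * of_real (1 / of_int K) * w = of_real (1 / of_int K) * (- \<i> * w)" by simp
    then show ?thesis using K Imw by (simp only: Re_complex_of_real times_complex.sel Im_complex_of_real) simp
  qed
  then have Rt: "Re (of_int K ^ 2 * s) > 0"
    using Re_inverse_pos[of "1 / (of_int K ^ 2 * s)"] unfolding K2s[symmetric] by simp
  have Rs: "Re s > 0"
  proof -
    have "(of_int K :: complex) ^ 2 = of_real (of_int K ^ 2)" by simp
    then have "Re (of_int K ^ 2 * s) = of_int K ^ 2 * Re s"
      by (simp only: Re_complex_of_real times_complex.sel Im_complex_of_real)
    then show ?thesis using Rt K by (simp add: zero_less_mult_iff)
  qed
  have per: "f (n + K) * e2pi (of_int ((n + K) ^ 2) * (of_int a / of_int (4 * m * c))) = f n * e2pi (of_int (n ^ 2) * (of_int a / of_int (4 * m * c)))" for n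
  proof -
    have "f (n + K) = f n"
      using periodic_shift_mult[of f "2 * m" c n, OF f] by (simp add: K_def add.commute)
    moreover have "of_int ((n + K) ^ 2) * (of_int a / of_int (4 * m * c)) = (of_int (n ^ 2) * (of_int a / of_int (4 * m * c)) + of_int (a * n + a * m * c) :: real)"
      using m c by (simp add: K_def field_simps power2_eq_square)
    ultimately show ?thesis by (simp only: e2pi_add_of_int)
  qed
  have "utheta m j f ((of_int a * \<tau> + of_int b) / (of_int c * \<tau> + of_int d)) = gtheta j f (s - 2 * \<i> * of_real (of_int a / of_int (4 * m * c)))"
  proof -
    have "c \<noteq> 0" using c by simp
    have "- \<i> * (of_int a / of_int c - 1 / (of_int c * w)) / (2 * of_int m) = s - 2 * \<i> * of_real (of_int a / of_int (4 * m * c))"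
      using m c w0 by (simp add: s_def K_def field_simps)
    then show ?thesis
      unfolding utheta_def mobius_split[OF det \<open>c \<noteq> 0\<close> w0[unfolded w_def]] w_def by simp
  qed
  also have "\<dots> = gtheta j (\<lambda>n. f n * e2pi (of_int (n ^ 2) * (of_int a / of_int (4 * m * c)))) s"
    by (rule gtheta_vertical_shift)
  also have "\<dots> = \<i> ^ j * of_int K ^ j * (of_int K ^ 2 * s) powr (- 1 / 2 - of_nat j) *
     gtheta j (\<lambda>k. \<Sum>r\<in>{0..<K}. f r * e2pi (of_int (r ^ 2) * (of_int a / of_int (4 * m * c))) * exp (- 2 * of_real pi * \<i> * of_int k * of_real (of_int r / of_int K))) (1 / (of_int K ^ 2 * s))"
    by (rule gtheta_inversion[where b = "\<lambda>n. f n * e2pi (of_int (n ^ 2) * (of_int a / of_int (4 * m * c)))", OF K per Rs j])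
  also have "(of_int K ^ 2 * s) powr (- 1 / 2 - of_nat j) = (1 / (of_int K ^ 2 * s)) powr (1 / 2 + of_nat j)"
    using powr_inverse_complex[OF Re_pos_not_nonpos_Reals[OF Rt], of "1 / 2 + of_nat j"] by simp
  \<comment> \<open>The product of -i/K and w does not cross the cut, so the power factors; its
    constant part goes into \<xi>.\<close>
  also have "\<dots> = (- \<i> * of_real (1 / of_int K)) powr (1 / 2 + of_nat j) * w powr (1 / 2 + of_nat j)"
    unfolding K2s using K by (intro powr_mult_neg_i Imw) auto
  also have "1 / (of_int K ^ 2 * s) = - \<i> * \<tau> / (2 * of_int m) - 2 * \<i> * of_real (of_int d / of_int (4 * m * c))"
    unfolding K2s using m c by (simp add: w_def K_def field_simps)
  also have "gtheta j (\<lambda>k. \<Sum>r\<in>{0..<K}. f r * e2pi (of_int (r ^ 2) * (of_int a / of_int (4 * m * c))) * exp (- 2 * of_real pi * \<i> * of_int k * of_real (of_int r / of_int K)))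
       (- \<i> * \<tau> / (2 * of_int m) - 2 * \<i> * of_real (of_int d / of_int (4 * m * c))) = utheta m j (gauss_kernel m a c d f) \<tau>"
  proof -
    have "(\<Sum>r\<in>{0..<K}. f r * e2pi (of_int (r ^ 2) * (of_int a / of_int (4 * m * c))) * exp (- 2 * of_real pi * \<i> * of_int k * of_real (of_int r / of_int K)))
        * e2pi (of_int (k ^ 2) * (of_int d / of_int (4 * m * c))) = gauss_kernel m a c d f k" for k
    proof -
      have "e2pi (of_int (r ^ 2) * (of_int a / of_int (4 * m * c))) * exp (- 2 * of_real pi * \<i> * of_int k * of_real (of_int r / of_int K)) * e2pi (of_int (k ^ 2) * (of_int d / of_int (4 * m * c)))
          = e2pi (of_int (a * r ^ 2 - 2 * r * k + d * k ^ 2) / of_int (4 * m * c))" for r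
      proof -
        have "exp (- 2 * of_real pi * \<i> * of_int k * of_real (of_int r / of_int K)) = e2pi (- (of_int k * of_int r / of_int K))"
          by (simp add: e2pi_def mult.assoc)
        then show ?thesis
          using m c by (simp only: e2pi_add[symmetric]) (rule arg_cong[where f = e2pi], simp add: K_def field_simps)
      qed
      then show ?thesis
        by (simp add: gauss_kernel_def K_def sum_distrib_right mult.assoc)
    qed
    then show ?thesis unfolding gtheta_vertical_shift utheta_def by simp
  qed
  finally show "utheta m j f ((of_int a * \<tau> + of_int b) / (of_int c * \<tau> + of_int d)) =
      \<xi> * (of_int c * \<tau> + of_int d) powr (1 / 2 + of_nat j) * utheta m j (gauss_kernel m a c d f) \<tau>"
    by (simp add: \<xi>_def w_def mult_ac)
qed

text \<open>
  The form \<open>Q(n, k) = an\<^sup>2 - 2nk + dk\<^sup>2\<close> satisfies \<open>Q(n + dh, k + h) = Q(n, k) + bc(2nh + dh\<^sup>2)\<close>, so on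
  \<open>\<Gamma>(4m)\<close> the kernel is a convolution. The substitution \<open>n \<mapsto> n + c\<close> then shows that only the residue class of
  \<open>0\<close> modulo \<open>2m\<close> contributes.
\<close>

lemma gauss_kernel_Gamma:
  fixes a b c d m :: int
  assumes m: "m > 0" and f: "\<And>n. f (n + 2 * m) = f n" and det: "a * d - b * c = 1" and c: "c > 0"
    and a1: "4 * m dvd a - 1" and b0: "4 * m dvd b" and c0: "4 * m dvd c" and d1: "4 * m dvd d - 1"
  obtains G where "norm G = sqrt (of_int (2 * m * c))" "gauss_kernel m a c d f = (\<lambda>k. G * f k)"
proof
  define K where "K = 2 * m * c"
  have K: "K > 0" using m c by (simp add: K_def)
  define E where "E n = e2pi (of_int (a * n ^ 2) / of_int (2 * K))" for n
  obtain b' where b': "b = 4 * m * b'" using b0 by (auto elim: dvdE)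
  obtain c' where c': "c = 4 * m * c'" using c0 by (auto elim: dvdE)
  obtain a' where "a - 1 = 4 * m * a'" using a1 by (auto elim: dvdE)
  then have a': "a = 4 * m * a' + 1" by simp
  obtain d' where "d - 1 = 4 * m * d'" using d1 by (auto elim: dvdE)
  then have d': "d = 4 * m * d' + 1" by simp
  have fper: "f (n + 2 * m * l) = f n" for n l
    using periodic_shift_mult[of f "2 * m" l n, OF f] by (simp add: add.commute)
  have Eper: "E (n + K) = E n" for n
  proof -
    have "of_int (a * (n + K) ^ 2) / of_int (2 * K) = (of_int (a * n ^ 2) / of_int (2 * K) + of_int (a * n + a * m * c) :: real)"
      using m c by (simp add: K_def field_simps power2_eq_square)
    then show ?thesis by (simp only: E_def e2pi_add_of_int)
  qed
  have shift: "gauss_kernel m a c d f h = (\<Sum>n\<in>{0..<K}. f (n + h) * E n)" for h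
  proof -
    define F where "F n = f n * e2pi (of_int (a * n ^ 2 - 2 * n * h + d * h ^ 2) / of_int (4 * m * c))" for n
    have "F (n + K) = F n" for n
    proof -
      have "of_int (a * (n + K) ^ 2 - 2 * (n + K) * h + d * h ^ 2) / of_int (4 * m * c) =
          (of_int (a * n ^ 2 - 2 * n * h + d * h ^ 2) / of_int (4 * m * c) + of_int (a * n + a * m * c - h) :: real)"
        using m c by (simp add: K_def field_simps power2_eq_square)
      moreover have "f (n + K) = f n" using fper[of n c] by (simp add: K_def)
      ultimately show ?thesis by (simp only: F_def e2pi_add_of_int)
    qed
    then have "gauss_kernel m a c d f h = (\<Sum>n\<in>{0..<K}. F (n + d * h))"
      using K by (subst sum_periodic_shift) (auto simp: gauss_kernel_def F_def K_def)
    moreover have "F (n + d * h) = f (n + h) * E n" for n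
    proof -
      have "n + d * h = (n + h) + 2 * m * (2 * d' * h)" by (simp add: d' algebra_simps)
      then have "f (n + d * h) = f (n + h)" using fper by metis
      \<comment> \<open>Since ad - 1 = bc and 4m divides b, the part depending on h is a multiple of
        4mc, so the phase is that for h = 0.\<close>
      have "a * (n + d * h) ^ 2 - 2 * (n + d * h) * h + d * h ^ 2 = a * n ^ 2 + (a * d - 1) * (2 * n * h + d * h ^ 2)"
        by (simp add: power2_eq_square algebra_simps)
      also have "a * d - 1 = 4 * m * c * b'" using det by (simp add: b' algebra_simps)
      finally have "of_int (a * (n + d * h) ^ 2 - 2 * (n + d * h) * h + d * h ^ 2) / of_int (4 * m * c) =
          (of_int (a * n ^ 2) / of_int (4 * m * c) + of_int (b' * (2 * n * h + d * h ^ 2)) :: real)"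
        using m c by (simp add: field_simps)
      then have "e2pi (of_int (a * (n + d * h) ^ 2 - 2 * (n + d * h) * h + d * h ^ 2) / of_int (4 * m * c)) = E n"
        by (simp only: e2pi_add_of_int) (simp add: E_def K_def mult.assoc)
      then show ?thesis using \<open>f (n + d * h) = f (n + h)\<close> by (simp only: F_def)
    qed
    ultimately show ?thesis by simp
  qed
  have cmod: "(n + c) mod (2 * m) = n mod (2 * m)" for n
  proof -
    have "n + c = n + 2 * m * (2 * c')" by (simp add: c')
    then show ?thesis by (simp only: mod_mult_self2)
  qed
  \<comment> \<open>Partial Gauss sum over the class of \<rho> modulo 2m. Since 2m divides c, the
    shift by c preserves the class; it will turn out to multiply the sum by e(\<rho>/2m).\<close>
  define S where "S \<rho> = (\<Sum>n\<in>{0..<K}. if n mod (2 * m) = \<rho> then E n else 0)" for \<rho>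
  have S0: "S \<rho> = 0" if \<rho>: "0 < \<rho>" "\<rho> < 2 * m" for \<rho>
  proof -
    define F where "F n = (if n mod (2 * m) = \<rho> then E n else 0)" for n
    have "F (n + K) = F n" for n
      using Eper[of n] by (simp add: F_def K_def)
    then have "(\<Sum>n\<in>{0..<K}. F (n + c)) = S \<rho>"
      using K by (subst sum_periodic_shift) (auto simp: F_def S_def)
    moreover have "F (n + c) = e2pi (of_int \<rho> / of_int (2 * m)) * F n" for n
    proof (cases "n mod (2 * m) = \<rho>")
      case True
      have "(n + c) mod (2 * m) = \<rho>" using True cmod by simp
      obtain l where l: "n = 2 * m * l + \<rho>" using True by (metis mult_div_mod_eq)
      \<comment> \<open>The cross term 2anc/(4mc) = an/(2m) is \<rho>/(2m) modulo 1 because a = 1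
        modulo 4m; the square term ac/(4m) is an integer.\<close>
      have "of_int (a * (n + c) ^ 2) / of_int (2 * K) =
         (of_int \<rho> / of_int (2 * m) + of_int (a * n ^ 2) / of_int (2 * K) + of_int (2 * a' * n + l + a * c') :: real)"
      proof -
        have "a * (n + c) ^ 2 = a * n ^ 2 + c * (2 * a * n + a * c)"
          by (simp add: power2_eq_square algebra_simps)
        also have "2 * a * n + a * c = 2 * (\<rho> + 2 * m * (2 * a' * n + l + a * c'))"
        proof -
          have "2 * a * n + a * c = 2 * n + 8 * m * a' * n + 4 * m * a * c'" by (simp add: a' c' algebra_simps)
          also have "\<dots> = 2 * (\<rho> + 2 * m * (2 * a' * n + l + a * c'))" by (simp add: l algebra_simps)
          finally show ?thesis .
        qed
        finally have "a * (n + c) ^ 2 = a * n ^ 2 + c * (2 * (\<rho> + 2 * m * (2 * a' * n + l + a * c')))" .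
        then show ?thesis using m c by (simp only: K_def) (simp add: field_simps)
      qed
      then have "E (n + c) = e2pi (of_int \<rho> / of_int (2 * m)) * E n"
        by (simp only: E_def e2pi_add e2pi_of_int mult_1_right)
      then show ?thesis using True \<open>(n + c) mod (2 * m) = \<rho>\<close> by (simp add: F_def)
    next
      case False
      then show ?thesis using cmod by (simp add: F_def)
    qed
    ultimately have "e2pi (of_int \<rho> / of_int (2 * m)) * (\<Sum>n\<in>{0..<K}. F n) = S \<rho>"
      by (simp only: sum_distrib_left)
    also have "(\<Sum>n\<in>{0..<K}. F n) = S \<rho>" by (simp add: S_def F_def)
    finally have "(e2pi (of_int \<rho> / of_int (2 * m)) - 1) * S \<rho> = 0"
      by (simp only: left_diff_distrib) simp
    moreover have "of_int \<rho> / of_int (2 * m) \<notin> (\<int> :: real set)"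
    proof
      assume "of_int \<rho> / of_int (2 * m) \<in> (\<int> :: real set)"
      then obtain l where "of_int \<rho> / of_int (2 * m) = (of_int l :: real)" by (auto elim: Ints_cases)
      then have "(of_int \<rho> :: real) = of_int (l * (2 * m))" using m by (simp add: field_simps)
      then have "\<rho> = l * (2 * m)" by (simp only: of_int_eq_iff)
      then show False using \<rho> zdvd_not_zless[of \<rho> "2 * m"] by auto
    qed
    ultimately show ?thesis by (simp add: e2pi_eq_1_iff)
  qed
  define G where "G = (\<Sum>n\<in>{0..<K}. E n)"
  have split: "(\<Sum>n\<in>{0..<K}. f (n + h) * E n) = (\<Sum>\<rho>\<in>{0..<2 * m}. f (\<rho> + h) * S \<rho>)"
    if fper: "\<And>n l. f (n + 2 * m * l) = f n" for f :: "int \<Rightarrow> complex" and h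
  proof -
    have "(\<Sum>\<rho>\<in>{0..<2 * m}. f (\<rho> + h) * S \<rho>) = (\<Sum>n\<in>{0..<K}. \<Sum>\<rho>\<in>{0..<2 * m}. if n mod (2 * m) = \<rho> then f (\<rho> + h) * E n else 0)"
      unfolding S_def sum_distrib_left by (subst sum.swap) (intro sum.cong refl, auto)
    also have "\<dots> = (\<Sum>n\<in>{0..<K}. f (n mod (2 * m) + h) * E n)"
      using m by (intro sum.cong refl) (subst sum.delta', auto)
    also have "\<dots> = (\<Sum>n\<in>{0..<K}. f (n + h) * E n)"
    proof (rule sum.cong[OF refl])
      fix n
      have "f (n mod (2 * m) + h) = f (n mod (2 * m) + h + 2 * m * (n div (2 * m)))" by (simp only: fper)
      also have "n mod (2 * m) + h + 2 * m * (n div (2 * m)) = n + h" by simp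
      finally show "f (n mod (2 * m) + h) * E n = f (n + h) * E n" by simp
    qed
    finally show ?thesis by simp
  qed
  have only0: "(\<Sum>\<rho>\<in>{0..<2 * m}. f (\<rho> + h) * S \<rho>) = f h * S 0" for f :: "int \<Rightarrow> complex" and h
  proof -
    have "(\<Sum>\<rho>\<in>{0..<2 * m}. f (\<rho> + h) * S \<rho>) = (\<Sum>\<rho>\<in>{0..<2 * m}. if \<rho> = 0 then f h * S 0 else 0)"
      by (intro sum.cong refl) (auto simp: S0)
    then show ?thesis using m by simp
  qed
  \<comment> \<open>The constant function 1 identifies the remaining scalar \<open>S 0\<close> with
    the full Gauss sum, whose modulus is known.\<close>
  have "G = S 0" using split[of "\<lambda>_. 1" 0] only0[of "\<lambda>_. 1" 0] by (simp add: G_def)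
  then show "gauss_kernel m a c d f = (\<lambda>k. G * f k)"
    using shift split[of f, OF fper] only0[of f] by (auto simp: mult.commute)
  have "coprime a K"
  proof -
    have "coprime a m" by (rule coprimeI) (metis a' dvd_add_right_iff dvd_triv_left dvd_mult2 mult.commute mult.assoc dvd_mult)
    moreover have "coprime a 2" by (simp add: a')
    moreover have "coprime a c"
      by (rule coprimeI) (metis det dvd_diff dvd_mult dvd_mult2)
    ultimately show ?thesis by (simp add: K_def)
  qed
  then have "norm G ^ 2 = of_int K"
    unfolding G_def E_def using K by (intro norm_gauss_sum) (auto simp: K_def)
  then show "norm G = sqrt (of_int (2 * m * c))"
    by (metis K_def norm_ge_zero real_sqrt_unique)
qed

lemma utheta_cmult: "utheta m j (\<lambda>k. G * f k) \<tau> = G * utheta m j f \<tau>"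
  unfolding utheta_def gtheta_def mult.assoc by (rule infsum_cmult_right')

text \<open>The modulus of the Gauss sum cancels that of the scalar from the inversion.\<close>

lemma utheta_Gamma_pos:
  fixes a b c d m :: int
  assumes m: "m > 0" and f: "\<And>n. f (n + 2 * m) = f n" and det: "a * d - b * c = 1" and c: "c > 0"
    and cong: "4 * m dvd a - 1" "4 * m dvd b" "4 * m dvd c" "4 * m dvd d - 1" and j: "j \<le> 1"
  obtains \<kappa> where "norm \<kappa> = 1"
    "\<And>\<tau>. Im \<tau> > 0 \<Longrightarrow> utheta m j f ((of_int a * \<tau> + of_int b) / (of_int c * \<tau> + of_int d)) =
      \<kappa> * (of_int c * \<tau> + of_int d) powr (1 / 2 + of_nat j) * utheta m j f \<tau>"
proof -
  obtain \<xi> where \<xi>: "norm \<xi> = 1 / sqrt (of_int (2 * m * c))"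
    "\<And>\<tau>. Im \<tau> > 0 \<Longrightarrow> utheta m j f ((of_int a * \<tau> + of_int b) / (of_int c * \<tau> + of_int d)) =
      \<xi> * (of_int c * \<tau> + of_int d) powr (1 / 2 + of_nat j) * utheta m j (gauss_kernel m a c d f) \<tau>"
    by (rule utheta_mobius[where f = f, OF m f det c j]) (rule that)
  obtain G where G: "norm G = sqrt (of_int (2 * m * c))" "gauss_kernel m a c d f = (\<lambda>k. G * f k)"
    by (rule gauss_kernel_Gamma[where f = f, OF m f det c cong]) (rule that)
  show ?thesis
  proof
    have "sqrt (of_int (2 * m * c)) \<noteq> 0" using m c by simp
    then show "norm (\<xi> * G) = 1" unfolding norm_mult \<xi>(1) G(1) by simp
    fix \<tau> assume "Im \<tau> > 0"
    show "utheta m j f ((of_int a * \<tau> + of_int b) / (of_int c * \<tau> + of_int d)) =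
      \<xi> * G * (of_int c * \<tau> + of_int d) powr (1 / 2 + of_nat j) * utheta m j f \<tau>"
      unfolding \<xi>(2)[OF \<open>Im \<tau> > 0\<close>] G(2) utheta_cmult by simp
  qed
qed

lemma unipotent_if_lower_left_0:
  fixes a b c d m :: int
  assumes "m > 0" "a * d - b * c = 1" "c = 0" "4 * m dvd d - 1"
  shows "a = 1" "d = 1"
proof -
  have ad: "a * d = 1" using assms(2,3) by simp
  then have "d = 1 \<or> d = - 1" using zmult_eq_1_iff[of a d] by blast
  moreover have "d \<noteq> - 1"
  proof
    assume "d = - 1"
    then have "4 * m dvd 2" using assms(4) by simp
    then show False using zdvd_imp_le[of "4 * m" 2] assms(1) by simp
  qed
  ultimately show "d = 1" by blast
  with ad show "a = 1" by simp
qed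

text \<open>For c < 0 the case of positive lower left entry is applied to the inverse matrix at the
  image point, since -\<gamma> would not lie in \<Gamma>(4m). The power inverts without a sign
  because c\<tau> + d is not real.\<close>

lemma utheta_Gamma:
  fixes a b c d m :: int
  assumes m: "m > 0" and f: "\<And>n. f (n + 2 * m) = f n" and det: "a * d - b * c = 1"
    and cong: "4 * m dvd a - 1" "4 * m dvd b" "4 * m dvd c" "4 * m dvd d - 1" and j: "j \<le> 1"
  obtains \<kappa> where "norm \<kappa> = 1"
    "\<And>\<tau>. Im \<tau> > 0 \<Longrightarrow> utheta m j f ((of_int a * \<tau> + of_int b) / (of_int c * \<tau> + of_int d)) =
      \<kappa> * (of_int c * \<tau> + of_int d) powr (1 / 2 + of_nat j) * utheta m j f \<tau>"
proof -
  consider "c > 0" | "c = 0" | "c < 0" by linarith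
  then show ?thesis
  proof cases
    case 1
    show ?thesis by (rule utheta_Gamma_pos[where f = f, OF m f det 1 cong j]) (rule that)
  next
    case 2
    have "a = 1" "d = 1" by (rule unipotent_if_lower_left_0[OF m det 2 cong(4)])+
    show ?thesis
    proof (rule that[of 1])
      fix \<tau> :: complex
      have "- \<i> * (\<tau> + of_int b) / (2 * of_int m) = - \<i> * \<tau> / (2 * of_int m) - 2 * \<i> * of_real (of_int b / of_int (4 * m))"
        using m by (simp add: field_simps)
      then have "utheta m j f (\<tau> + of_int b) = gtheta j (\<lambda>n. f n * e2pi (of_int (n ^ 2) * (of_int b / of_int (4 * m)))) (- \<i> * \<tau> / (2 * of_int m))"
        unfolding utheta_def by (simp only: gtheta_vertical_shift)
      moreover have "e2pi (of_int (n ^ 2) * (of_int b / of_int (4 * m))) = 1" for n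
      proof -
        obtain b' where "b = 4 * m * b'" using cong(2) by (auto elim: dvdE)
        then have "of_int (n ^ 2) * (of_int b / of_int (4 * m)) = (of_int (n ^ 2 * b') :: real)"
          using m by simp
        then show ?thesis by (simp only: e2pi_of_int)
      qed
      ultimately have "utheta m j f (\<tau> + of_int b) = utheta m j f \<tau>"
        by (simp add: utheta_def)
      then show "utheta m j f ((of_int a * \<tau> + of_int b) / (of_int c * \<tau> + of_int d)) =
          1 * (of_int c * \<tau> + of_int d) powr (1 / 2 + of_nat j) * utheta m j f \<tau>"
        by (simp add: \<open>c = 0\<close> \<open>d = 1\<close> \<open>a = 1\<close>)
    qed simp
  next
    case 3
    have det': "d * a - (- b) * (- c) = 1" using det by (simp add: mult.commute)
    obtain \<kappa> where \<kappa>: "norm \<kappa> = 1"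
      "\<And>\<tau>. Im \<tau> > 0 \<Longrightarrow> utheta m j f ((of_int d * \<tau> + of_int (- b)) / (of_int (- c) * \<tau> + of_int a)) =
      \<kappa> * (of_int (- c) * \<tau> + of_int a) powr (1 / 2 + of_nat j) * utheta m j f \<tau>"
    proof -
      have "- c > 0" "4 * m dvd - b" "4 * m dvd - c" using 3 cong by auto
      then show ?thesis
        by (rule utheta_Gamma_pos[where f = f, OF m f det' _ cong(4) _ _ cong(1) j]) (rule that)
    qed
    show ?thesis
    proof (rule that[of "1 / \<kappa>"])
      show "norm (1 / \<kappa>) = 1" using \<kappa>(1) by (simp add: norm_divide)
      fix \<tau> :: complex assume \<tau>: "Im \<tau> > 0"
      define w where "w = of_int c * \<tau> + of_int d"
      define \<tau>' where "\<tau>' = (of_int a * \<tau> + of_int b) / w"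
      have w: "w \<noteq> 0" unfolding w_def by (rule mobius_im_pos(1)[OF det \<tau>])
      have \<tau>': "Im \<tau>' > 0" unfolding \<tau>'_def w_def by (rule mobius_im_pos(3)[OF det \<tau>])
      have detC: "(of_int a * of_int d - of_int b * of_int c :: complex) = 1"
        using det by (metis of_int_1 of_int_diff of_int_mult)
      have "of_int (- c) * (of_int a * \<tau> + of_int b) + of_int a * w = of_int a * of_int d - of_int b * of_int c"
        by (simp add: w_def algebra_simps)
      then have 1: "of_int (- c) * \<tau>' + of_int a = 1 / w"
        using w unfolding detC \<tau>'_def by (simp add: field_simps)
      have "of_int d * (of_int a * \<tau> + of_int b) + of_int (- b) * w = (of_int a * of_int d - of_int b * of_int c) * \<tau>"
        by (simp add: w_def algebra_simps)
      then have "(of_int d * \<tau>' + of_int (- b)) * w = \<tau>"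
        using w unfolding detC \<tau>'_def by (simp add: field_simps)
      then have 2: "(of_int d * \<tau>' + of_int (- b)) / (1 / w) = \<tau>"
        by simp
      have "w \<notin> \<real>\<^sub>\<le>\<^sub>0"
        using 3 \<tau> by (auto simp: complex_nonpos_Reals_iff w_def)
      have "utheta m j f \<tau> = \<kappa> * w powr (- (1 / 2 + of_nat j)) * utheta m j f \<tau>'"
        using \<kappa>(2)[OF \<tau>'] unfolding 1 unfolding 2 powr_inverse_complex[OF \<open>w \<notin> \<real>\<^sub>\<le>\<^sub>0\<close>] .
      moreover have "w powr (- (1 / 2 + of_nat j)) = 1 / w powr (1 / 2 + of_nat j)"
        by (rule powr_minus_divide)
      moreover have "\<kappa> \<noteq> 0" "w powr (1 / 2 + of_nat j) \<noteq> 0" using \<kappa>(1) w by auto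
      ultimately have "utheta m j f \<tau>' = 1 / \<kappa> * w powr (1 / 2 + of_nat j) * utheta m j f \<tau>"
        by (simp add: field_simps)
      then show "utheta m j f ((of_int a * \<tau> + of_int b) / (of_int c * \<tau> + of_int d)) =
        1 / \<kappa> * (of_int c * \<tau> + of_int d) powr (1 / 2 + of_nat j) * utheta m j f \<tau>"
        unfolding \<tau>'_def w_def .
    qed
  qed
qed

section \<open>Growth at the cusps\<close>

lemma utheta_norm_le:
  assumes "m > 0" "\<And>n. norm (f n) \<le> B" "y > 0" "y \<le> Im \<tau>"
  shows "norm (utheta m j f \<tau>) \<le> B * (\<Sum>\<^sub>\<infinity>n::int. \<bar>of_int n\<bar> ^ j * exp (- (pi * (y / (2 * of_int m))) * of_int n ^ 2))"
  unfolding utheta_def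
proof (rule gtheta_norm_le)
  show "y / (2 * of_int m) > 0" "y / (2 * of_int m) \<le> Re (- \<i> * \<tau> / (2 * of_int m))"
    unfolding Re_utheta_arg[OF assms(1)] using assms by (simp_all add: divide_right_mono)
qed (rule assms(2))

lemma utheta_holomorphic:
  assumes "m > 0" "\<And>n. norm (f n) \<le> B"
  shows "utheta m j f holomorphic_on {\<tau>. Im \<tau> > 0}"
proof -
  have "(gtheta j f \<circ> (\<lambda>\<tau>. - \<i> * \<tau> / (2 * of_int m))) holomorphic_on {\<tau>. Im \<tau> > 0}"
  proof (rule holomorphic_on_compose_gen)
    show "(\<lambda>\<tau>. - \<i> * \<tau> / (2 * of_int m)) holomorphic_on {\<tau>. Im \<tau> > 0}"
      using assms(1) by (intro holomorphic_intros) auto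
    show "gtheta j f holomorphic_on {s. Re s > 0}"
      by (rule gtheta_holomorphic[OF assms(2)])
    show "(\<lambda>\<tau>. - \<i> * \<tau> / (2 * of_int m)) ` {\<tau>. Im \<tau> > 0} \<subseteq> {s. Re s > 0}"
    proof
      fix s assume "s \<in> (\<lambda>\<tau>. - \<i> * \<tau> / (2 * of_int m)) ` {\<tau>. Im \<tau> > 0}"
      then obtain \<tau> where "Im \<tau> > 0" "s = - \<i> * \<tau> / (2 * of_int m)" by blast
      then show "s \<in> {s. Re s > 0}" using assms(1) by (simp only: Re_utheta_arg mem_Collect_eq) simp
    qed
  qed
  then show ?thesis by (simp add: utheta_def[abs_def] o_def)
qed

text \<open>By \<open>utheta_mobius\<close> the automorphy factor cancels and leaves the theta
  series of the bounded function \<open>gauss_kernel m a c d f\<close>, which is bounded for Im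
  \<tau> >= 1. Passing to -\<gamma> when c < 0 changes the square root only by a unimodular
  factor.\<close>

lemma utheta_bounded_at_cusp:
  fixes a b c d m :: int
  assumes m: "m > 0" and f: "\<And>n. f (n + 2 * m) = f n" and det: "a * d - b * c = 1"
  obtains B where "\<And>\<tau>. Im \<tau> \<ge> 1 \<Longrightarrow>
    norm ((of_int c * \<tau> + of_int d) powr (- 1 / 2) * utheta m 0 f ((of_int a * \<tau> + of_int b) / (of_int c * \<tau> + of_int d))) \<le> B"
proof -
  have 2: "2 * m > 0" using m by simp
  obtain F where F: "\<And>n. norm (f n) \<le> F" by (rule periodic_bounded[where b = f, OF 2 f]) blast
  have half: "(- 1 / 2 :: complex) = of_real (- 1 / 2)" by simp
  have norm_half: "norm (w powr (- 1 / 2)) = norm w powr (- 1 / 2)" for w :: complex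
    unfolding half by (simp only: norm_powr_real_powr' Reals_of_real Re_complex_of_real)
  have pos: "\<exists>B. \<forall>\<tau>. Im \<tau> \<ge> 1 \<longrightarrow>
    norm ((of_int c * \<tau> + of_int d) powr (- 1 / 2) * utheta m 0 f ((of_int a * \<tau> + of_int b) / (of_int c * \<tau> + of_int d))) \<le> B"
    if det: "a * d - b * c = 1" and c: "c > 0" for a b c d
  proof -
    obtain \<xi> where \<xi>: "\<And>\<tau>. Im \<tau> > 0 \<Longrightarrow> utheta m 0 f ((of_int a * \<tau> + of_int b) / (of_int c * \<tau> + of_int d)) =
      \<xi> * (of_int c * \<tau> + of_int d) powr (1 / 2 + of_nat 0) * utheta m 0 (gauss_kernel m a c d f) \<tau>"
      by (rule utheta_mobius[where f = f and j = 0, OF m f det c le0]) (rule that)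
    have gk: "norm (gauss_kernel m a c d f k) \<le> (\<Sum>n\<in>{0..<2 * m * c}. norm (f n))" for k
      unfolding gauss_kernel_def by (rule sum_norm_le) (simp add: norm_mult)
    show ?thesis
    proof (intro exI allI impI)
      fix \<tau> :: complex assume \<tau>: "Im \<tau> \<ge> 1"
      define w where "w = of_int c * \<tau> + of_int d"
      have w: "w \<noteq> 0" unfolding w_def using \<tau> by (intro mobius_im_pos(1)[OF det]) simp
      have inv: "w powr (- 1 / 2) * w powr (1 / 2) = 1"
        using w powr_minus_divide[of w "1 / 2"] by simp
      have "utheta m 0 f ((of_int a * \<tau> + of_int b) / w) = \<xi> * w powr (1 / 2) * utheta m 0 (gauss_kernel m a c d f) \<tau>"
        using \<xi>[of \<tau>] \<tau> unfolding w_def[symmetric] by simp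
      then have "w powr (- 1 / 2) * utheta m 0 f ((of_int a * \<tau> + of_int b) / w) =
          (w powr (- 1 / 2) * w powr (1 / 2)) * (\<xi> * utheta m 0 (gauss_kernel m a c d f) \<tau>)"
        by (simp only: mult_ac)
      then have "norm (w powr (- 1 / 2) * utheta m 0 f ((of_int a * \<tau> + of_int b) / w)) = norm \<xi> * norm (utheta m 0 (gauss_kernel m a c d f) \<tau>)"
        unfolding inv by (simp only: norm_mult norm_one mult_1_left)
      also have "\<dots> \<le> norm \<xi> * ((\<Sum>n\<in>{0..<2 * m * c}. norm (f n)) * (\<Sum>\<^sub>\<infinity>n::int. \<bar>of_int n\<bar> ^ 0 * exp (- (pi * (1 / (2 * of_int m))) * of_int n ^ 2)))"
        using \<tau> by (intro mult_left_mono utheta_norm_le m gk) auto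
      finally show "norm ((of_int c * \<tau> + of_int d) powr (- 1 / 2) * utheta m 0 f ((of_int a * \<tau> + of_int b) / (of_int c * \<tau> + of_int d))) \<le> \<dots>"
        unfolding w_def .
    qed
  qed
  consider "c > 0" | "c = 0" | "c < 0" by linarith
  then show ?thesis
  proof cases
    case 1
    then show ?thesis using pos[OF det] that by blast
  next
    case 2
    then have "a * d = 1" using det by simp
    then have "(a = 1 \<and> d = 1) \<or> (a = - 1 \<and> d = - 1)" by (simp add: zmult_eq_1_iff)
    then have ad: "(of_int a * \<tau> + of_int b) / (of_int c * \<tau> + of_int d) = \<tau> + of_int (b * d)" "norm (of_int c * \<tau> + of_int d :: complex) = 1" for \<tau> :: complex
      using 2 by auto
    show ?thesis
    proof (rule that)
      fix \<tau> :: complex assume "Im \<tau> \<ge> 1"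
      have "norm (utheta m 0 f (\<tau> + of_int (b * d))) \<le> F * (\<Sum>\<^sub>\<infinity>n::int. \<bar>of_int n\<bar> ^ 0 * exp (- (pi * (1 / (2 * of_int m))) * of_int n ^ 2))"
        using \<open>Im \<tau> \<ge> 1\<close> by (intro utheta_norm_le m F) auto
      then show "norm ((of_int c * \<tau> + of_int d) powr (- 1 / 2) * utheta m 0 f ((of_int a * \<tau> + of_int b) / (of_int c * \<tau> + of_int d)))
          \<le> F * (\<Sum>\<^sub>\<infinity>n::int. \<bar>of_int n\<bar> ^ 0 * exp (- (pi * (1 / (2 * of_int m))) * of_int n ^ 2))"
        unfolding norm_mult norm_half ad by simp
    qed
  next
    case 3
    then obtain B where B: "\<And>\<tau>. Im \<tau> \<ge> 1 \<Longrightarrow>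
      norm ((of_int (- c) * \<tau> + of_int (- d)) powr (- 1 / 2) * utheta m 0 f ((of_int (- a) * \<tau> + of_int (- b)) / (of_int (- c) * \<tau> + of_int (- d)))) \<le> B"
      using pos[of "- a" "- d" "- b" "- c"] det by auto
    have neg: "of_int (- c) * \<tau> + of_int (- d) = - (of_int c * \<tau> + of_int d)" "of_int (- a) * \<tau> + of_int (- b) = - (of_int a * \<tau> + of_int b)" for \<tau> :: complex
      by simp_all
    have div: "- x / - y = x / y" for x y :: complex by simp
    show ?thesis
      by (rule that[of B]) (use B in \<open>simp only: neg div norm_mult norm_half norm_minus_cancel\<close>)
  qed
qed

section \<open>Matrices and multipliers\<close>

lemma det_carrier_2:
  fixes A :: "'a :: comm_ring_1 Matrix.mat"
  assumes A: "A \<in> carrier_mat 2 2"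
  shows "Determinant.det A = A $$ (0,0) * A $$ (1,1) - A $$ (0,1) * A $$ (1,0)"
proof -
  have "Determinant.det (mat_delete A 0 j) = mat_delete A 0 j $$ (0,0)" for j
    using A by (intro det_single) (auto simp: mat_delete_def)
  then show ?thesis
    using A laplace_expansion_row[OF A, of 0]
    by (simp add: numeral_2_eq_2 cofactor_def mat_delete_def)
qed

lemma SL2Z_iff:
  "\<gamma> \<in> SL2Z \<longleftrightarrow> \<gamma> \<in> carrier_mat 2 2 \<and> \<gamma> $$ (0,0) * \<gamma> $$ (1,1) - \<gamma> $$ (0,1) * \<gamma> $$ (1,0) = 1"
  unfolding SL2Z_def using det_carrier_2[of \<gamma>] by auto

text \<open>The determinant condition makes the entries of the lower row coprime, so no Legendre
  symbol in the product vanishes.\<close>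

lemma theta_factor_half_norm:
  assumes "a * \<gamma> $$ (1,1) - b * \<gamma> $$ (1,0) = 1"
  shows "norm (theta_factor (1/2) \<gamma>) = 1"
proof -
  let ?c = "\<gamma> $$ (1,0)" and ?d = "\<gamma> $$ (1,1)"
  have "\<bar>\<Prod>p\<in>#prime_factorization \<bar>?d\<bar>. Legendre ?c p\<bar> = 1"
  proof -
    have "\<bar>Legendre ?c p\<bar> = 1" if "p \<in># prime_factorization \<bar>?d\<bar>" for p
    proof -
      have p: "prime p" "p dvd ?d" using that by (auto simp: in_prime_factors_iff)
      have "\<not> p dvd ?c"
      proof
        assume "p dvd ?c"
        then have "p dvd a * ?d - b * ?c" using p(2) by (intro dvd_diff dvd_mult)
        then show False using assms p(1) by (simp add: not_prime_unit)
      qed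
      then show ?thesis by (auto simp: Legendre_def cong_0_iff)
    qed
    then have "\<bar>prod_mset (image_mset (Legendre ?c) M)\<bar> = 1" if "set_mset M \<subseteq> set_mset (prime_factorization \<bar>?d\<bar>)" for M
      using that by (induction M) (auto simp: abs_mult)
    then show ?thesis by blast
  qed
  then have "\<bar>jacobi_ext ?c ?d\<bar> = 1" by (simp add: jacobi_ext_def abs_mult)
  then have "norm (of_int (jacobi_ext ?c ?d) :: complex) = 1"
    unfolding norm_of_int of_int_abs[symmetric] by simp
  moreover have "norm (eps_odd ?d powr of_real (2 * (1/2))) = 1" by (simp add: eps_odd_def)
  ultimately show ?thesis by (simp add: theta_factor_def norm_mult)
qed

lemma Gamma_cong_entries:
  assumes "\<gamma> \<in> Gamma_cong N"
  shows "\<gamma> $$ (0,0) * \<gamma> $$ (1,1) - \<gamma> $$ (0,1) * \<gamma> $$ (1,0) = 1"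
    "N dvd \<gamma> $$ (0,0) - 1" "N dvd \<gamma> $$ (0,1)" "N dvd \<gamma> $$ (1,0)" "N dvd \<gamma> $$ (1,1) - 1"
  using assms by (auto simp: Gamma_cong_def SL2Z_iff cong_iff_dvd_diff)

lemma modular_form_utheta:
  fixes m :: int
  assumes m: "m > 0" and f: "\<And>n. f (n + 2 * m) = f n"
  shows "modular_form (Gamma_cong (4 * m)) (1/2) (utheta m 0 f)"
proof -
  have 2: "2 * m > 0" using m by simp
  obtain F where F: "\<And>n. norm (f n) \<le> F" by (rule periodic_bounded[where b = f, OF 2 f]) blast
  have "\<exists>v. norm v = 1 \<and> (\<forall>\<tau>. Im \<tau> > 0 \<longrightarrow> utheta m 0 f \<tau> - cnj v * slash_H (1/2) \<gamma> (utheta m 0 f) \<tau> = 0)"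
    if \<gamma>: "\<gamma> \<in> Gamma_cong (4 * m)" for \<gamma>
  proof -
    note det = Gamma_cong_entries(1)[OF \<gamma>] and cong = Gamma_cong_entries(2-5)[OF \<gamma>]
    obtain \<kappa> where \<kappa>: "norm \<kappa> = 1"
      "\<And>\<tau>. Im \<tau> > 0 \<Longrightarrow> utheta m 0 f (mob \<gamma> \<tau>) = \<kappa> * mob_denom \<gamma> \<tau> powr (1 / 2) * utheta m 0 f \<tau>"
      unfolding mob_def mob_denom_def
    proof (rule utheta_Gamma[where f = f and j = 0, OF m f det cong le0])
      fix \<kappa> assume "norm \<kappa> = 1"
        "\<And>\<tau>. Im \<tau> > 0 \<Longrightarrow> utheta m 0 f ((of_int (\<gamma> $$ (0,0)) * \<tau> + of_int (\<gamma> $$ (0,1))) / (of_int (\<gamma> $$ (1,0)) * \<tau> + of_int (\<gamma> $$ (1,1)))) =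
          \<kappa> * (of_int (\<gamma> $$ (1,0)) * \<tau> + of_int (\<gamma> $$ (1,1))) powr (1 / 2 + of_nat 0) * utheta m 0 f \<tau>"
      then show thesis by (intro that[of \<kappa>]) (simp_all add: mob_def mob_denom_def)
    qed
    \<comment> \<open>The multiplier enters conjugated: this choice makes \<open>cnj v\<close> the
      inverse of the product of the theta factor and \<kappa>, for each matrix separately.\<close>
    define v where "v = cnj (1 / (theta_factor (1/2) \<gamma> * \<kappa>))"
    have tf: "norm (theta_factor (1/2) \<gamma>) = 1" by (rule theta_factor_half_norm[OF det])
    show ?thesis
    proof (intro exI[of _ v] conjI allI impI)
      show "norm v = 1" by (simp only: v_def complex_mod_cnj norm_divide norm_mult tf \<kappa>(1)) simp
      fix \<tau> :: complex assume \<tau>: "Im \<tau> > 0"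
      have "mob_denom \<gamma> \<tau> \<noteq> 0" unfolding mob_denom_def by (rule mobius_im_pos(1)[OF det \<tau>])
      then have "mob_denom \<gamma> \<tau> powr of_real (- (1/2)) * mob_denom \<gamma> \<tau> powr (1 / 2) = 1"
        using powr_minus_divide[of "mob_denom \<gamma> \<tau>" "1 / 2"] by simp
      moreover have "theta_factor (1/2) \<gamma> \<noteq> 0" "\<kappa> \<noteq> 0" using tf \<kappa>(1) by auto
      ultimately show "utheta m 0 f \<tau> - cnj v * slash_H (1/2) \<gamma> (utheta m 0 f) \<tau> = 0"
        unfolding slash_H_def \<kappa>(2)[OF \<tau>] v_def by (simp add: field_simps)
    qed
  qed
  then obtain v where v: "\<And>\<gamma>. \<gamma> \<in> Gamma_cong (4 * m) \<Longrightarrow> norm (v \<gamma>) = 1 \<and>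
      (\<forall>\<tau>. Im \<tau> > 0 \<longrightarrow> utheta m 0 f \<tau> - cnj (v \<gamma>) * slash_H (1/2) \<gamma> (utheta m 0 f) \<tau> = 0)"
    by metis
  have "\<exists>Y B. \<forall>\<tau>. Im \<tau> > 0 \<and> Im \<tau> \<ge> Y \<longrightarrow>
        cmod (mob_denom \<gamma> \<tau> powr of_real (- (1/2)) * utheta m 0 f (mob \<gamma> \<tau>)) \<le> B" if "\<gamma> \<in> SL2Z" for \<gamma>
  proof -
    have det: "\<gamma> $$ (0,0) * \<gamma> $$ (1,1) - \<gamma> $$ (0,1) * \<gamma> $$ (1,0) = 1" using that by (simp add: SL2Z_iff)
    obtain B where "\<And>\<tau>. Im \<tau> \<ge> 1 \<Longrightarrow> norm (mob_denom \<gamma> \<tau> powr (- 1 / 2) * utheta m 0 f (mob \<gamma> \<tau>)) \<le> B"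
      by (rule utheta_bounded_at_cusp[where f = f, OF m f det]) (rule that, simp only: mob_def mob_denom_def)
    then show ?thesis by (intro exI[of _ 1] exI[of _ B]) simp
  qed
  note cusps = this
  show ?thesis
    unfolding modular_form_def modular_form_mult_def multiplier_def
  proof (intro exI[of _ v] conjI ballI allI impI)
    show "utheta m 0 f holomorphic_on {\<tau>. Im \<tau> > 0}" by (rule utheta_holomorphic[OF m F])
  qed (use v cusps in \<open>simp_all\<close>)
qed

section \<open>Decay at the cusps and integral representation\<close>

lemma power_le_fact_exp:
  fixes y :: real
  assumes "y \<ge> 0"
  shows "y ^ n \<le> fact n * exp y"
proof -
  have "(\<Sum>k\<in>{n}. y ^ k /\<^sub>R fact k) \<le> (\<Sum>k. y ^ k /\<^sub>R fact k)"
    using assms by (intro sum_le_suminf summable_exp_generic) auto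
  then have "y ^ n / fact n \<le> exp y" by (simp add: exp_def divide_inverse mult.commute)
  then show ?thesis by (simp add: field_simps)
qed

text \<open>The factor n removes the term n = 0. For n \<noteq> 0 half of the exponent gives the
  decay, as n^2 >= 1, and the other half keeps the series summable.\<close>

lemma gtheta_1_decay:
  assumes b: "\<And>n. norm (b n) \<le> B" and "r > 0" "r \<le> Re s"
  shows "norm (gtheta 1 b s) \<le> exp (- (pi / 2) * Re s) * (B * (\<Sum>\<^sub>\<infinity>n::int. \<bar>of_int n\<bar> ^ 1 * exp (- (pi * r / 2) * of_int n ^ 2)))"
proof -
  have B: "B \<ge> 0" using order_trans[OF norm_ge_zero b[of 0]] .
  have bd: "((\<lambda>n::int. exp (- (pi / 2) * Re s) * (B * (\<bar>of_int n\<bar> ^ 1 * exp (- (pi * r / 2) * of_int n ^ 2)))) has_sum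
      exp (- (pi / 2) * Re s) * (B * (\<Sum>\<^sub>\<infinity>n::int. \<bar>of_int n\<bar> ^ 1 * exp (- (pi * r / 2) * of_int n ^ 2)))) UNIV"
    using assms(2) by (intro has_sum_cmult_right has_sum_infsum summable_power_gauss_int) auto
  have "((\<lambda>n. b n * of_int n ^ 1 * exp (- of_real pi * of_int n ^ 2 * s)) has_sum gtheta 1 b s) UNIV"
    using assms by (intro gtheta_has_sum[OF b]) auto
  from this bd show ?thesis
  proof (rule norm_infsum_le)
    fix n :: int
    have "norm (b n * of_int n ^ 1 * exp (- of_real pi * of_int n ^ 2 * s)) \<le> B * (\<bar>of_int n\<bar> ^ 1 * exp (- (pi * Re s) * of_int n ^ 2))"
      by (rule gtheta_term_bound[OF b order_refl])
    also have "\<dots> \<le> B * (\<bar>of_int n\<bar> ^ 1 * (exp (- (pi / 2) * Re s) * exp (- (pi * r / 2) * of_int n ^ 2)))"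
    proof (cases "n = 0")
      case False
      then have "0 < n ^ 2" by simp
      then have "1 \<le> n ^ 2" by linarith
      then have "of_int 1 \<le> (of_int (n ^ 2) :: real)" by (simp only: of_int_le_iff)
      then have "1 \<le> (of_int n :: real) ^ 2" by simp
      then have "1 * Re s \<le> of_int n ^ 2 * Re s" "of_int n ^ 2 * r \<le> of_int n ^ 2 * Re s"
        using assms by (intro mult_right_mono mult_left_mono; simp)+
      then have "(pi / 2) * (Re s + of_int n ^ 2 * r) \<le> (pi / 2) * (2 * (of_int n ^ 2 * Re s))"
        by (intro mult_left_mono) auto
      then have "- (pi * Re s) * of_int n ^ 2 \<le> - (pi / 2) * Re s + - (pi * r / 2) * of_int n ^ 2"
        by (simp add: algebra_simps)
      then have "exp (- (pi * Re s) * of_int n ^ 2) \<le> exp (- (pi / 2) * Re s) * exp (- (pi * r / 2) * of_int n ^ 2)"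
        unfolding exp_add[symmetric] by simp
      then show ?thesis using B by (intro mult_left_mono) auto
    qed simp
    finally show "norm (b n * of_int n ^ 1 * exp (- of_real pi * of_int n ^ 2 * s)) \<le> exp (- (pi / 2) * Re s) * (B * (\<bar>of_int n\<bar> ^ 1 * exp (- (pi * r / 2) * of_int n ^ 2)))"
      by (simp add: mult_ac)
  qed
qed

text \<open>For large Re s the terms of the series decay. For small Re s inversion leads to 1/s,
  whose real part in the cone |Im s| <= Re s is at least 1/(2 Re s), and exponential decay in 1/Re s
  beats every power.\<close>

lemma gtheta_1_cone_bound:
  fixes K :: int
  assumes K: "K > 0" and per: "\<And>n. b (n + K) = b n"
  obtains \<delta> where "\<delta> > 0" "\<And>N. \<exists>C. \<forall>s. Re s > 0 \<longrightarrow> \<bar>Im s\<bar> \<le> Re s \<longrightarrow> norm (gtheta 1 b s) \<le> C * (Re s ^ N * exp (- \<delta> * Re s))"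
proof
  obtain B where B: "\<And>n. norm (b n) \<le> B" by (rule periodic_bounded[where b = b, OF K per]) blast
  define bh where "bh k = (\<Sum>r\<in>{0..<K}. b r * exp (- 2 * of_real pi * \<i> * of_int k * of_real (of_int r / of_int K)))" for k
  define B' where "B' = (\<Sum>r\<in>{0..<K}. norm (b r))"
  have B': "norm (bh k) \<le> B'" for k
    unfolding bh_def B'_def by (rule sum_norm_le) (simp add: norm_mult norm_exp_eq_Re)
  define C1 where "C1 = B * (\<Sum>\<^sub>\<infinity>n::int. \<bar>of_int n\<bar> ^ 1 * exp (- (pi * 1 / 2) * of_int n ^ 2))"
  \<comment> \<open>A lower bound for Re (1/t) with t = K^2 s, valid in the cone for Re s <=
    1.\<close>
  define r where "r = 1 / (2 * of_int K ^ 2 :: real)"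
  have r: "r > 0" using K by (simp add: r_def)
  define C2 where "C2 = B' * (\<Sum>\<^sub>\<infinity>n::int. \<bar>of_int n\<bar> ^ 1 * exp (- (pi * r / 2) * of_int n ^ 2))"
  have C1: "C1 \<ge> 0" unfolding C1_def using order_trans[OF norm_ge_zero B[of 0]]
    by (intro mult_nonneg_nonneg infsum_nonneg) auto
  have C2: "C2 \<ge> 0" unfolding C2_def using order_trans[OF norm_ge_zero B'[of 0]]
    by (intro mult_nonneg_nonneg infsum_nonneg) auto
  define \<beta> where "\<beta> = pi / 2 * r"
  have \<beta>: "\<beta> > 0" using r by (simp add: \<beta>_def)
  \<comment> \<open>The rate \<delta> = 1 works: for Re s >= 1 it is below pi/2, and for Re s < 1
    the factor exp(-Re s) is bounded below, which costs the constant \<open>exp 1\<close>.\<close>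
  show "(1::real) > 0" by simp
  fix N :: nat
  define C where "C = max C1 (of_int K * C2 * (fact (N + 2) / \<beta> ^ (N + 2)) * exp 1)"
  show "\<exists>C. \<forall>s. Re s > 0 \<longrightarrow> \<bar>Im s\<bar> \<le> Re s \<longrightarrow> norm (gtheta 1 b s) \<le> C * (Re s ^ N * exp (- 1 * Re s))"
  proof (intro exI[of _ C] allI impI)
    fix s assume s: "Re s > 0" "\<bar>Im s\<bar> \<le> Re s"
    show "norm (gtheta 1 b s) \<le> C * (Re s ^ N * exp (- 1 * Re s))"
    proof (cases "Re s \<ge> 1")
      case True
      have "norm (gtheta 1 b s) \<le> exp (- (pi / 2) * Re s) * C1"
        unfolding C1_def using True by (intro gtheta_1_decay[OF B]) auto
      also have "\<dots> \<le> (Re s ^ N * exp (- 1 * Re s)) * C"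
      proof (intro mult_mono)
        have "1 * Re s \<le> (pi / 2) * Re s" using pi_ge_two s by (intro mult_right_mono) auto
        then have "exp (- (pi / 2) * Re s) \<le> 1 * exp (- 1 * Re s)" by simp
        also have "\<dots> \<le> Re s ^ N * exp (- 1 * Re s)" using True by (intro mult_right_mono) auto
        finally show "exp (- (pi / 2) * Re s) \<le> Re s ^ N * exp (- 1 * Re s)" .
      qed (use C1 s in \<open>auto simp: C_def\<close>)
      finally show ?thesis by (simp add: mult_ac)
    next
      case False
      define t where "t = of_int K ^ 2 * s"
      have K2: "(of_int K :: complex) ^ 2 = of_real (of_int K ^ 2)" by simp
      have inv: "1 / t = of_real (1 / of_int K ^ 2) * (1 / s)" by (simp add: t_def)
      have "norm s ^ 2 \<le> 2 * Re s ^ 2"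
      proof -
        have "Im s ^ 2 \<le> Re s ^ 2" using s by (simp add: abs_le_square_iff[symmetric])
        then show ?thesis by (simp add: cmod_power2)
      qed
      then have "Re s / (2 * Re s ^ 2) \<le> Re s / norm s ^ 2"
        using s by (intro divide_left_mono) (auto simp: zero_less_mult_iff)
      also have "Re s / norm s ^ 2 = Re (1 / s)" by (simp add: Re_divide cmod_power2)
      also have "Re s / (2 * Re s ^ 2) = 1 / (2 * Re s)" using s by (simp add: power2_eq_square)
      finally have "(1 / of_int K ^ 2) * (1 / (2 * Re s)) \<le> (1 / of_int K ^ 2) * Re (1 / s)"
        by (intro mult_left_mono) auto
      also have "\<dots> = Re (1 / t)"
        unfolding inv by (simp only: Re_complex_of_real times_complex.sel Im_complex_of_real)
      finally have Rt: "r / Re s \<le> Re (1 / t)" by (simp add: r_def)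
      have "r \<le> r / Re s" using False s r by (simp add: field_simps)
      then have "norm (gtheta 1 bh (1 / t)) \<le> exp (- (pi / 2) * Re (1 / t)) * C2"
        unfolding C2_def using Rt r by (intro gtheta_1_decay[OF B']) auto
      also have "\<dots> \<le> exp (- (\<beta> / Re s)) * C2"
      proof (intro mult_right_mono C2)
        have "pi / 2 * (r / Re s) \<le> pi / 2 * Re (1 / t)" using Rt by (intro mult_left_mono) auto
        then show "exp (- (pi / 2) * Re (1 / t)) \<le> exp (- (\<beta> / Re s))" by (simp add: \<beta>_def)
      qed
      finally have 1: "norm (gtheta 1 bh (1 / t)) \<le> exp (- (\<beta> / Re s)) * C2" .
      have "norm t \<ge> Re s"
      proof -
        have "Re s \<le> norm s" by (rule complex_Re_le_cmod)
        also have "\<dots> \<le> of_int K ^ 2 * norm s" using K by (intro mult_le_cancel_right1[THEN iffD2]) (auto simp: one_le_power)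
        finally show ?thesis by (simp add: t_def norm_mult norm_power)
      qed
      \<comment> \<open>Rounding the exponent -3/2 to the integer -2 is allowed for Re s < 1; the
        powers lost are regained by applying \<open>power_le_fact_exp\<close> with N + 2.\<close>
      have 2: "norm (t powr (- 1 / 2 - of_nat 1)) \<le> 1 / Re s ^ 2"
      proof -
        have "(- 1 / 2 - of_nat 1 :: complex) = of_real (- 3 / 2)" by simp
        then have "norm (t powr (- 1 / 2 - of_nat 1)) = norm t powr (- 3 / 2)"
          by (simp only: norm_powr_real_powr' Reals_of_real Re_complex_of_real)
        also have "\<dots> \<le> Re s powr (- 3 / 2)"
          using s \<open>norm t \<ge> Re s\<close> by (intro powr_mono2') auto
        also have "\<dots> \<le> Re s powr (- 2)"
          using s False by (intro powr_mono') auto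
        also have "\<dots> = 1 / Re s ^ 2"
          using s by (simp add: powr_minus_divide)
        finally show ?thesis .
      qed
      have "gtheta 1 b s = \<i> ^ 1 * of_int K ^ 1 * t powr (- 1 / 2 - of_nat 1) * gtheta 1 bh (1 / t)"
        unfolding t_def bh_def by (rule gtheta_inversion[where b = b, OF K per s(1)]) simp
      then have "norm (gtheta 1 b s) = of_int K * (norm (t powr (- 1 / 2 - of_nat 1)) * norm (gtheta 1 bh (1 / t)))"
        using K by (simp add: norm_mult)
      also have "\<dots> \<le> of_int K * ((1 / Re s ^ 2) * (exp (- (\<beta> / Re s)) * C2))"
        using 1 2 K by (intro mult_left_mono mult_mono) auto
      also have "\<dots> \<le> of_int K * ((1 / Re s ^ 2) * (fact (N + 2) / \<beta> ^ (N + 2) * Re s ^ (N + 2) * C2))"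
      proof -
        have "(\<beta> / Re s) ^ (N + 2) \<le> fact (N + 2) * exp (\<beta> / Re s)"
          using \<beta> s by (intro power_le_fact_exp) auto
        then have "exp (- (\<beta> / Re s)) \<le> fact (N + 2) / \<beta> ^ (N + 2) * Re s ^ (N + 2)"
          using \<beta> s by (simp add: exp_minus field_simps)
        then show ?thesis using K C2 by (intro mult_left_mono mult_right_mono) auto
      qed
      also have "of_int K * ((1 / Re s ^ 2) * (fact (N + 2) / \<beta> ^ (N + 2) * Re s ^ (N + 2) * C2)) =
          (of_int K * C2 * (fact (N + 2) / \<beta> ^ (N + 2))) * Re s ^ N"
        using s by (simp add: power_add power2_eq_square)
      also have "\<dots> \<le> (of_int K * C2 * (fact (N + 2) / \<beta> ^ (N + 2))) * (Re s ^ N * (exp 1 * exp (- 1 * Re s)))"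
        using False s K C2 \<beta>
        by (intro mult_left_mono) (auto simp: mult_le_cancel_left1 simp flip: exp_add)
      also have "\<dots> = (of_int K * C2 * (fact (N + 2) / \<beta> ^ (N + 2)) * exp 1) * (Re s ^ N * exp (- 1 * Re s))"
        by (simp add: mult_ac)
      also have "\<dots> \<le> C * (Re s ^ N * exp (- 1 * Re s))"
        using s by (intro mult_right_mono) (auto simp: C_def)
      finally show ?thesis .
    qed
  qed
qed

text \<open>Translation moves the cusp p = P/Q to 0 at the cost of a phase, and phase and f together
  have period 2mQ. A cone is used rather than the vertical line alone, since geodesics ending at p
  will be compared with that line.\<close>

lemma utheta_1_cone_bound:
  fixes m :: int and p :: real
  assumes m: "m > 0" and f: "\<And>n. f (n + 2 * m) = f n" and p: "p \<in> \<rat>"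
  obtains \<delta> where "\<delta> > 0"
    "\<And>N. \<exists>C. \<forall>\<sigma>. Im \<sigma> > 0 \<longrightarrow> \<bar>Re \<sigma> - p\<bar> \<le> Im \<sigma> \<longrightarrow> norm (utheta m 1 f \<sigma>) \<le> C * (Im \<sigma> ^ N * exp (- \<delta> * Im \<sigma>))"
proof -
  obtain P Q :: int where PQ: "Q > 0" "p = of_int P / of_int Q"
    using p by (auto elim: Rats_cases')
  define K where "K = 2 * m * Q"
  have K: "K > 0" using m PQ by (simp add: K_def)
  define b where "b n = f n * e2pi (of_int (n ^ 2) * (p / (4 * of_int m)))" for n
  have per: "b (n + K) = b n" for n
  proof -
    have "f (n + K) = f n"
      using periodic_shift_mult[of f "2 * m" Q n, OF f] by (simp add: K_def add.commute)
    moreover have "of_int ((n + K) ^ 2) * (p / (4 * of_int m)) = (of_int (n ^ 2) * (p / (4 * of_int m)) + of_int (n * P + m * Q * P) :: real)"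
      using m PQ(1) unfolding PQ(2) by (simp add: K_def field_simps power2_eq_square)
    ultimately show ?thesis by (simp only: b_def e2pi_add_of_int)
  qed
  obtain \<delta> where \<delta>: "\<delta> > 0" "\<And>N. \<exists>C. \<forall>s. Re s > 0 \<longrightarrow> \<bar>Im s\<bar> \<le> Re s \<longrightarrow> norm (gtheta 1 b s) \<le> C * (Re s ^ N * exp (- \<delta> * Re s))"
    by (rule gtheta_1_cone_bound[where b = b, OF K per]) (rule that)
  show ?thesis
  proof (rule that[of "\<delta> / (2 * of_int m)"])
    show "\<delta> / (2 * of_int m) > 0" using \<delta> m by simp
    fix N
    obtain C where C: "\<And>s. Re s > 0 \<Longrightarrow> \<bar>Im s\<bar> \<le> Re s \<Longrightarrow> norm (gtheta 1 b s) \<le> C * (Re s ^ N * exp (- \<delta> * Re s))"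
      using \<delta>(2)[of N] by blast
    show "\<exists>C. \<forall>\<sigma>. Im \<sigma> > 0 \<longrightarrow> \<bar>Re \<sigma> - p\<bar> \<le> Im \<sigma> \<longrightarrow> norm (utheta m 1 f \<sigma>) \<le> C * (Im \<sigma> ^ N * exp (- (\<delta> / (2 * of_int m)) * Im \<sigma>))"
    proof (intro exI[of _ "C / (2 * of_int m) ^ N"] allI impI)
      fix \<sigma> assume \<sigma>: "Im \<sigma> > 0" "\<bar>Re \<sigma> - p\<bar> \<le> Im \<sigma>"
      define s where "s = - \<i> * (\<sigma> - of_real p) / (2 * of_int m)"
      have Re: "Re s = Im \<sigma> / (2 * of_int m)"
        unfolding s_def Re_utheta_arg[OF m] by simp
      have "s = (- \<i> * (\<sigma> - of_real p)) / of_real (2 * of_int m)" by (simp add: s_def)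
      then have Im: "Im s = - (Re \<sigma> - p) / (2 * of_int m)"
        by (simp only: Im_divide_of_real) simp
      have "- \<i> * \<sigma> / (2 * of_int m) = s - 2 * \<i> * of_real (p / (4 * of_int m))"
        using m by (simp add: s_def field_simps)
      then have "utheta m 1 f \<sigma> = gtheta 1 b s"
        unfolding utheta_def b_def by (simp only: gtheta_vertical_shift)
      moreover have "norm (gtheta 1 b s) \<le> C * (Re s ^ N * exp (- \<delta> * Re s))"
        using \<sigma> m by (intro C) (auto simp: Re Im divide_right_mono)
      ultimately show "norm (utheta m 1 f \<sigma>) \<le> C / (2 * of_int m) ^ N * (Im \<sigma> ^ N * exp (- (\<delta> / (2 * of_int m)) * Im \<sigma>))"
        by (simp add: Re power_divide)
    qed
  qed
qed

section \<open>Integrals over the half line\<close>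

lemma gamma_half_integral:
  fixes \<alpha> :: real
  assumes \<alpha>: "\<alpha> > 0"
  shows "has_bochner_integral lborel (\<lambda>t. indicator {0<..} t * (t powr (- 1 / 2) * exp (- \<alpha> * t))) (sqrt (pi / \<alpha>))"
proof -
  let ?g = "\<lambda>t::real. indicator {0<..} t * (t powr (- 1 / 2) * exp (- t))"
  have "((\<lambda>t. t powr (1 / 2 - 1) / exp t) has_integral Gamma (1 / 2 :: real)) {0..}"
    by (rule Gamma_integral_real) simp
  then have "((\<lambda>t. if t \<in> {0..} then t powr (1 / 2 - 1) / exp t else 0) has_integral sqrt pi) UNIV"
    by (simp only: has_integral_restrict_UNIV Gamma_one_half_real)
  then have "(?g has_integral sqrt pi) UNIV"
    by (rule has_integral_eq[rotated]) (auto simp: indicator_def exp_minus field_simps)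
  then have "integral\<^sup>N lborel ?g = ennreal (sqrt pi)"
    by (intro nn_integral_has_integral_lborel) (auto simp: indicator_def)
  then have "has_bochner_integral lborel ?g (sqrt pi)"
    by (intro has_bochner_integral_nn_integral) (auto simp: indicator_def)
  then have "has_bochner_integral lborel (\<lambda>t. ?g (0 + \<alpha> * t)) (sqrt pi /\<^sub>R \<bar>\<alpha>\<bar>)"
    using \<alpha> by (subst (asm) lborel_has_bochner_integral_real_affine_iff[of \<alpha> _ _ 0]) auto
  then have "has_bochner_integral lborel (\<lambda>t. \<alpha> powr (1 / 2) * ?g (0 + \<alpha> * t)) (\<alpha> powr (1 / 2) * (sqrt pi /\<^sub>R \<bar>\<alpha>\<bar>))"
    by (rule has_bochner_integral_mult_right)
  moreover have "\<alpha> powr (1 / 2) * ?g (0 + \<alpha> * t) = indicator {0<..} t * (t powr (- 1 / 2) * exp (- \<alpha> * t))" for t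
    using \<alpha> by (auto simp: indicator_def powr_mult zero_less_mult_iff powr_minus)
  moreover have "\<alpha> powr (1 / 2) * (sqrt pi /\<^sub>R \<bar>\<alpha>\<bar>) = sqrt (pi / \<alpha>)"
    using \<alpha> real_sqrt_mult_self[of \<alpha>] by (simp add: powr_half_sqrt real_sqrt_divide field_simps)
  ultimately show ?thesis by (simp only:)
qed

text \<open>t^(-1/2) exp(-\<delta>t) is the common majorant of the integrands below: the singularity
  at 0 comes from the square root, the decay from the weight 3/2 series.\<close>

lemma set_integrable_gamma_bound:
  fixes h :: "real \<Rightarrow> complex"
  assumes cont: "continuous_on {0<..} h" and "\<delta> > 0"
    and bound: "\<And>t. t > 0 \<Longrightarrow> norm (h t) \<le> C * (t powr (- 1 / 2) * exp (- \<delta> * t))"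
  shows "set_integrable lborel {0<..} h"
  unfolding set_integrable_def
proof (rule Bochner_Integration.integrable_bound)
  show "integrable lborel (\<lambda>t. C * (indicator {0<..} t * (t powr (- 1 / 2) * exp (- \<delta> * t))))"
    using gamma_half_integral[OF \<open>\<delta> > 0\<close>] by (intro integrable_mult_right) (auto simp: has_bochner_integral_iff)
  have "(\<lambda>t. indicator {0<..} t *\<^sub>R h t) \<in> borel_measurable borel"
    by (intro borel_measurable_continuous_on_indicator cont) auto
  then show "(\<lambda>t. indicator {0<..} t *\<^sub>R h t) \<in> borel_measurable lborel" by simp
  show "AE t in lborel. norm (indicator {0<..} t *\<^sub>R h t) \<le> norm (C * (indicator {0<..} t * (t powr (- 1 / 2) * exp (- \<delta> * t))))"
    using bound by (intro AE_I2) (auto simp: indicator_def intro: order_trans[OF _ abs_ge_self])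
qed

text \<open>Expresses a Lebesgue integral by increments of a primitive; the two ends may move along
  unrelated sequences.\<close>

lemma tendsto_improper_integral:
  fixes h :: "real \<Rightarrow> complex"
  assumes cont: "continuous_on {0<..} h" and int: "set_integrable lborel {0<..} h"
    and der: "\<And>t. t > 0 \<Longrightarrow> (P has_vector_derivative h t) (at t)"
    and a: "\<And>n. a n > 0" "a \<longlonglongrightarrow> 0" and b: "filterlim b at_top sequentially"
  shows "(\<lambda>n. P (b n) - P (a n)) \<longlonglongrightarrow> (LINT t:{0<..}|lborel. h t)"
proof -
  let ?s = "\<lambda>n t. indicator {a n..b n} t *\<^sub>R h t"
  have sub: "{a n..b n} \<subseteq> {0<..}" for n using a(1)[of n] by (auto intro: less_le_trans)
  have int_n: "set_integrable lborel {a n..b n} h" for n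
    by (rule set_integrable_subset[OF int _ sub]) simp
  have "(\<lambda>n. LINT t|lborel. ?s n t) \<longlonglongrightarrow> (LINT t|lborel. indicator {0<..} t *\<^sub>R h t)"
  proof (rule integral_dominated_convergence[where w = "\<lambda>t. norm (indicator {0<..} t *\<^sub>R h t)"])
    show "AE t in lborel. (\<lambda>n. ?s n t) \<longlonglongrightarrow> indicator {0<..} t *\<^sub>R h t"
    proof (rule AE_I2)
      fix t :: real
      show "(\<lambda>n. ?s n t) \<longlonglongrightarrow> indicator {0<..} t *\<^sub>R h t"
      proof (cases "t > 0")
        case True
        have "\<forall>\<^sub>F n in sequentially. a n < t" using a(2) True by (rule order_tendstoD(2))
        moreover have "\<forall>\<^sub>F n in sequentially. t \<le> b n" using b by (simp add: filterlim_at_top)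
        ultimately have "\<forall>\<^sub>F n in sequentially. indicator {0<..} t *\<^sub>R h t = ?s n t"
          by eventually_elim (use True in auto)
        then show ?thesis by (rule Lim_transform_eventually[OF tendsto_const])
      next
        case False
        then have zero: "?s n t = 0" for n using sub[of n] by (auto simp: indicator_def)
        show ?thesis unfolding zero using False by simp
      qed
    qed
    show "AE t in lborel. norm (?s n t) \<le> norm (indicator {0<..} t *\<^sub>R h t)" for n
      using sub[of n] by (intro AE_I2) (auto simp: indicator_def)
    show "integrable lborel (\<lambda>t. norm (indicator {0<..} t *\<^sub>R h t))"
      using int unfolding set_integrable_def by (rule integrable_norm)
    show "(\<lambda>t. indicator {0<..} t *\<^sub>R h t) \<in> borel_measurable lborel"
      using int unfolding set_integrable_def by (rule borel_measurable_integrable)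
    show "?s n \<in> borel_measurable lborel" for n
      using int_n unfolding set_integrable_def by (rule borel_measurable_integrable)
  qed
  moreover have "\<forall>\<^sub>F n in sequentially. (LINT t|lborel. ?s n t) = P (b n) - P (a n)"
  proof -
    have "\<forall>\<^sub>F n in sequentially. a n < 1" using a(2) by (rule order_tendstoD(2)) simp
    moreover have "\<forall>\<^sub>F n in sequentially. 1 \<le> b n" using b by (simp add: filterlim_at_top)
    ultimately show ?thesis
    proof eventually_elim
      case (elim n)
      have "(h has_integral P (b n) - P (a n)) {a n..b n}"
      proof (rule fundamental_theorem_of_calculus)
        fix t assume "t \<in> {a n..b n}"
        then have "t > 0" using a(1)[of n] by auto
        then show "(P has_vector_derivative h t) (at t within {a n..b n})"
          by (rule has_vector_derivative_at_within[OF der])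
      qed (use elim in simp)
      then have "P (b n) - P (a n) = integral {a n..b n} h" by (simp add: integral_unique)
      also have "\<dots> = (LINT t:{a n..b n}|lborel. h t)"
        by (rule set_borel_integral_eq_integral(2)[OF int_n, symmetric])
      finally show ?case by (simp add: set_lebesgue_integral_def)
    qed
  qed
  ultimately show ?thesis
    unfolding set_lebesgue_integral_def by (rule Lim_transform_eventually)
qed

text \<open>Since |u + it| >= t, the bound does not depend on the horizontal distance u.\<close>

lemma norm_Complex_powr_le:
  assumes "t > 0"
  shows "norm (Complex u t powr (- 1 / 2)) \<le> t powr (- 1 / 2)"
proof -
  have half: "(- 1 / 2 :: complex) = of_real (- 1 / 2)" by simp
  have "norm (Complex u t powr (- 1 / 2)) = norm (Complex u t) powr (- 1 / 2)"
    unfolding half by (simp only: norm_powr_real_powr' Reals_of_real Re_complex_of_real)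
  also have "\<dots> \<le> t powr (- 1 / 2)"
    using assms abs_Im_le_cmod[of "Complex u t"] by (intro powr_mono2') auto
  finally show ?thesis .
qed

lemma Im_pos_not_nonpos_Reals: "Im z > 0 \<Longrightarrow> z \<notin> \<real>\<^sub>\<le>\<^sub>0"
  by (auto simp: complex_nonpos_Reals_iff)

text \<open>On the line \<sigma> = \<tau> + it the form (\<sigma> - \<tau>)^(-1/2) d\<sigma> is
  t^(-1/2) dt times this constant; the last factor is the i of d\<sigma> = i dt.\<close>

definition sqrt_phase :: complex where
  "sqrt_phase = \<i> powr (- 1 / 2) * \<i>"

lemma sqrt_phase_nonzero: "sqrt_phase \<noteq> 0"
  by (simp add: sqrt_phase_def)

lemma imag_powr_half:
  assumes "t > 0"
  shows "Complex 0 t powr (- 1 / 2) * \<i> = of_real (t powr (- 1 / 2)) * sqrt_phase"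
proof -
  have "Complex 0 t = of_real t * \<i>" by (simp add: complex_eq_iff)
  moreover have "Ln (of_real t * \<i>) = Ln (of_real t) + Ln \<i>"
    using assms by (subst Ln_times_of_real) (auto simp: Ln_of_real)
  ultimately have "Complex 0 t powr s = of_real t powr s * \<i> powr s" for s
    using assms by (simp add: powr_def distrib_left exp_add)
  then have "Complex 0 t powr (- 1 / 2) = of_real t powr (- 1 / 2) * \<i> powr (- 1 / 2)" .
  also have "of_real t powr (- 1 / 2) = complex_of_real (t powr (- 1 / 2))"
    using powr_of_real[of t "- 1 / 2"] assms by simp
  finally show ?thesis by (simp add: sqrt_phase_def)
qed

text \<open>
  \<open>cusp_int m f p x\<close> is the integral of \<open>g(\<sigma>) (\<sigma> - x)^(-1/2)\<close> along the vertical line from the cusp \<open>p\<close> to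
  \<open>i\<infinity>\<close>, where \<open>g\<close> is the theta series of weight \<open>3/2\<close>.
\<close>

definition cusp_int :: "int \<Rightarrow> (int \<Rightarrow> complex) \<Rightarrow> real \<Rightarrow> real \<Rightarrow> complex" where
  "cusp_int m f p x = (LINT t:{0<..}|lborel. utheta m 1 f (Complex p t) * (Complex (p - x) t powr (- 1 / 2) * \<i>))"

text \<open>As \<open>sgn 0 = 0\<close>, the constant term is dropped; the 1/2 is that of the mean
  of the two expansions of \<open>f0\<close>.\<close>

definition half_sgn :: "(int \<Rightarrow> complex) \<Rightarrow> int \<Rightarrow> complex" where
  "half_sgn f n = of_int (sgn n) / 2 * f n"

section \<open>False theta series as integrals of weight 3/2 series\<close>

locale periodic_theta =
  fixes m :: int and f :: "int \<Rightarrow> complex"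
  assumes m: "m > 0" and f: "f (n + 2 * m) = f n"
begin

definition "coeff_bound = (SOME B. B > 0 \<and> (\<forall>n. norm (f n) \<le> B))"

lemma coeff_bound: "coeff_bound > 0" "norm (f n) \<le> coeff_bound"
proof -
  have "2 * m > 0" using m by simp
  then have "\<exists>B>0. \<forall>n. norm (f n) \<le> B"
    by (rule periodic_bounded[where b = f, OF _ f]) blast
  then have "coeff_bound > 0 \<and> (\<forall>n. norm (f n) \<le> coeff_bound)"
    unfolding coeff_bound_def by (rule someI_ex)
  then show "coeff_bound > 0" "norm (f n) \<le> coeff_bound" by auto
qed

lemma half_sgn_bound: "norm (half_sgn f n) \<le> coeff_bound"
proof -
  have "norm (half_sgn f n) \<le> 1 * coeff_bound"
    unfolding half_sgn_def norm_mult by (intro mult_mono coeff_bound) (auto simp: sgn_if)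
  then show ?thesis by simp
qed

lemma continuous_vertical: "continuous_on {0<..} (\<lambda>t. utheta m 1 f (Complex p (y + t)))" if "y \<ge> 0"
proof (rule continuous_on_compose2[OF holomorphic_on_imp_continuous_on[OF utheta_holomorphic[OF m coeff_bound(2)]]])
  have "(\<lambda>t. Complex p (y + t)) = (\<lambda>t. of_real p + \<i> * of_real (y + t))"
    by (auto simp: complex_eq_iff)
  then show "continuous_on {0<..} (\<lambda>t. Complex p (y + t))"
    by (auto intro!: continuous_intros)
qed (use that in auto)

lemma continuous_vertical_powr: "continuous_on {0<..} (\<lambda>t. Complex u t powr s)"
proof -
  have "(\<lambda>t. Complex u t) = (\<lambda>t. of_real u + \<i> * of_real t)"
    by (auto simp: complex_eq_iff)
  then have "continuous_on {0<..} (\<lambda>t. Complex u t)"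
    by (auto intro!: continuous_intros)
  then show ?thesis
    by (intro continuous_on_powr_complex continuous_on_const) (auto simp: complex_eq_iff)
qed

lemma vertical_bound:
  assumes "p \<in> \<rat>"
  obtains \<delta> where "\<delta> > 0" "\<And>N. \<exists>C\<ge>0. \<forall>t>0. norm (utheta m 1 f (Complex p t)) \<le> C * (t ^ N * exp (- \<delta> * t))"
proof -
  obtain \<delta> where \<delta>: "\<delta> > 0"
    "\<And>N. \<exists>C. \<forall>\<sigma>. Im \<sigma> > 0 \<longrightarrow> \<bar>Re \<sigma> - p\<bar> \<le> Im \<sigma> \<longrightarrow> norm (utheta m 1 f \<sigma>) \<le> C * (Im \<sigma> ^ N * exp (- \<delta> * Im \<sigma>))"
    by (rule utheta_1_cone_bound[where f = f, OF m f assms]) (rule that)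
  show ?thesis
  proof (rule that[OF \<delta>(1)])
    fix N
    obtain C where C: "\<forall>\<sigma>. Im \<sigma> > 0 \<longrightarrow> \<bar>Re \<sigma> - p\<bar> \<le> Im \<sigma> \<longrightarrow> norm (utheta m 1 f \<sigma>) \<le> C * (Im \<sigma> ^ N * exp (- \<delta> * Im \<sigma>))"
      using \<delta>(2)[of N] by blast
    have bd: "norm (utheta m 1 f (Complex p t)) \<le> C * (t ^ N * exp (- \<delta> * t))" if "t > 0" for t
      using C[rule_format, of "Complex p t"] that by simp
    have "0 \<le> C * (1 ^ N * exp (- \<delta> * 1))" using order_trans[OF norm_ge_zero bd[of 1]] by simp
    then have "C \<ge> 0" by (simp add: zero_le_mult_iff)
    then show "\<exists>C\<ge>0. \<forall>t>0. norm (utheta m 1 f (Complex p t)) \<le> C * (t ^ N * exp (- \<delta> * t))"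
      using bd by blast
  qed
qed

lemma cusp_integrable:
  assumes "p \<in> \<rat>"
  shows "set_integrable lborel {0<..} (\<lambda>t. utheta m 1 f (Complex p t) * (Complex (p - x) t powr (- 1 / 2) * \<i>))"
proof -
  obtain \<delta> where \<delta>: "\<delta> > 0" "\<And>N. \<exists>C\<ge>0. \<forall>t>0. norm (utheta m 1 f (Complex p t)) \<le> C * (t ^ N * exp (- \<delta> * t))"
    by (rule vertical_bound[OF assms]) (rule that)
  obtain C where C: "C \<ge> 0" "\<And>t. t > 0 \<Longrightarrow> norm (utheta m 1 f (Complex p t)) \<le> C * (t ^ 0 * exp (- \<delta> * t))"
    using \<delta>(2)[of 0] by blast
  show ?thesis
  proof (rule set_integrable_gamma_bound[OF _ \<delta>(1)])
    show "continuous_on {0<..} (\<lambda>t. utheta m 1 f (Complex p t) * (Complex (p - x) t powr (- 1 / 2) * \<i>))"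
      using continuous_vertical[of 0 p] by (intro continuous_on_mult continuous_vertical_powr continuous_on_const) simp
    fix t :: real assume t: "t > 0"
    have "norm (utheta m 1 f (Complex p t) * (Complex (p - x) t powr (- 1 / 2) * \<i>)) \<le> (C * (t ^ 0 * exp (- \<delta> * t))) * t powr (- 1 / 2)"
      unfolding norm_mult using C(1) by (intro mult_mono C(2) t) (auto simp: norm_Complex_powr_le[OF t, simplified])
    then show "norm (utheta m 1 f (Complex p t) * (Complex (p - x) t powr (- 1 / 2) * \<i>)) \<le> C * (t powr (- 1 / 2) * exp (- \<delta> * t))"
      by (simp add: mult_ac)
  qed
qed

text \<open>For n \<noteq> 0 the integral of t^(-1/2) exp(-pi n^2 t / 2m) is sqrt(2m) / |n|, and n /
  |n| = sgn n: integration against the inverse square root turns n f(n) into a multiple of sgn n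
  f(n).\<close>

lemma false_theta_integral:
  assumes \<tau>: "Im \<tau> > 0"
  shows "(LINT t:{0<..}|lborel. utheta m 1 f (\<tau> + \<i> * of_real t) * (Complex 0 t powr (- 1 / 2) * \<i>)) =
    2 * of_real (sqrt (2 * of_int m)) * sqrt_phase * utheta m 0 (half_sgn f) \<tau>"
proof -
  define E where "E n = exp (- of_real pi * of_int n ^ 2 * (- \<i> * \<tau> / (2 * of_int m)))" for n :: int
  define \<beta> where "\<beta> n = pi * of_int n ^ 2 / (2 * of_int m)" for n :: int
  define T where "T n t = f n * of_int n * E n * of_real (exp (- \<beta> n * t))" for n :: int and t :: real
  define w where "w t = complex_of_real (t powr (- 1 / 2)) * sqrt_phase" for t
  have r: "Re (- \<i> * \<tau> / (2 * of_int m)) > 0" unfolding Re_utheta_arg[OF m] using \<tau> m by simp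
  have T: "((\<lambda>n. T n t) has_sum utheta m 1 f (\<tau> + \<i> * of_real t)) UNIV" if "t > 0" for t
  proof -
    have "Re (- \<i> * (\<tau> + \<i> * of_real t) / (2 * of_int m)) > 0" unfolding Re_utheta_arg[OF m] using \<tau> m that by simp
    then have "((\<lambda>n. f n * of_int n ^ 1 * exp (- of_real pi * of_int n ^ 2 * (- \<i> * (\<tau> + \<i> * of_real t) / (2 * of_int m)))) has_sum utheta m 1 f (\<tau> + \<i> * of_real t)) UNIV"
      unfolding utheta_def by (rule gtheta_has_sum[OF coeff_bound(2)])
    moreover have "exp (- of_real pi * of_int n ^ 2 * (- \<i> * (\<tau> + \<i> * of_real t) / (2 * of_int m))) = E n * of_real (exp (- \<beta> n * t))" for n :: int
      using m by (simp add: E_def \<beta>_def field_simps flip: exp_of_real exp_add)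
    ultimately show ?thesis by (simp add: T_def mult.assoc)
  qed
  have int_T: "has_bochner_integral lborel (\<lambda>t. indicator {0<..} t *\<^sub>R (T n t * w t))
      (2 * of_real (sqrt (2 * of_int m)) * sqrt_phase * (half_sgn f n * E n))" for n
  proof (cases "n = 0")
    case True
    then show ?thesis by (simp add: T_def half_sgn_def has_bochner_integral_zero)
  next
    case False
    then have \<beta>: "\<beta> n > 0" using m by (simp add: \<beta>_def)
    have "has_bochner_integral lborel (\<lambda>t. complex_of_real (indicator {0<..} t * (t powr (- 1 / 2) * exp (- \<beta> n * t)))) (of_real (sqrt (pi / \<beta> n)))"
      by (rule has_bochner_integral_of_real[OF gamma_half_integral[OF \<beta>]])
    then have "has_bochner_integral lborel (\<lambda>t. (f n * of_int n * E n * sqrt_phase) * complex_of_real (indicator {0<..} t * (t powr (- 1 / 2) * exp (- \<beta> n * t))))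
        ((f n * of_int n * E n * sqrt_phase) * of_real (sqrt (pi / \<beta> n)))"
      by (rule has_bochner_integral_mult_right)
    moreover have "(f n * of_int n * E n * sqrt_phase) * complex_of_real (indicator {0<..} t * (t powr (- 1 / 2) * exp (- \<beta> n * t))) =
        indicator {0<..} t *\<^sub>R (T n t * w t)" for t
      by (auto simp: T_def w_def indicator_def)
    moreover have "(f n * of_int n * E n * sqrt_phase) * of_real (sqrt (pi / \<beta> n)) =
        2 * of_real (sqrt (2 * of_int m)) * sqrt_phase * (half_sgn f n * E n)"
    proof -
      have "sqrt (pi / \<beta> n) = sqrt (2 * of_int m) / \<bar>of_int n\<bar>"
        using False m by (simp add: \<beta>_def real_sqrt_divide real_sqrt_mult)
      moreover have "(of_int n :: complex) = of_int (sgn n) * of_real \<bar>of_int n\<bar>"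
        by (auto simp: sgn_if abs_if)
      moreover have "complex_of_real \<bar>of_int n\<bar> \<noteq> 0" using False by simp
      ultimately show ?thesis
        by (simp only: half_sgn_def of_real_divide) (simp add: field_simps)
    qed
    ultimately show ?thesis by (simp only:)
  qed
  let ?s = "\<lambda>N t. \<Sum>n\<in>{- int N..<int N}. indicator {0<..} t *\<^sub>R (T n t * w t)"
  have int_s: "has_bochner_integral lborel (?s N) (\<Sum>n\<in>{- int N..<int N}. 2 * of_real (sqrt (2 * of_int m)) * sqrt_phase * (half_sgn f n * E n))" for N
    by (intro has_bochner_integral_sum int_T)
  define S where "S = (\<Sum>\<^sub>\<infinity>n::int. \<bar>of_int n\<bar> ^ 1 * exp (- (pi * (Im \<tau> / (2 * of_int m))) * of_int n ^ 2))"
  \<comment> \<open>The smallest of the exponents \<open>\<beta> n\<close> with n \<noteq> 0, hence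
    a rate of decay in t common to all terms.\<close>
  define \<delta> where "\<delta> = pi / (2 * of_int m)"
  have \<delta>: "\<delta> > 0" using m by (simp add: \<delta>_def)
  have Tle: "norm (T n t) \<le> (coeff_bound * exp (- \<delta> * t)) * (\<bar>of_int n\<bar> ^ 1 * exp (- (pi * (Im \<tau> / (2 * of_int m))) * of_int n ^ 2))" if "t > 0" for n t
  proof (cases "n = 0")
    case False
    have "norm (E n) = exp (- (pi * (Im \<tau> / (2 * of_int m))) * of_int n ^ 2)"
    proof -
      have "(- of_real pi * of_int n ^ 2 :: complex) = of_real (- pi * of_int n ^ 2)" by simp
      then have "Re (- of_real pi * of_int n ^ 2 * (- \<i> * \<tau> / (2 * of_int m))) = (- pi * of_int n ^ 2) * Re (- \<i> * \<tau> / (2 * of_int m))"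
        by (simp only: Re_complex_of_real times_complex.sel Im_complex_of_real mult_zero_left diff_zero)
      then show ?thesis unfolding E_def norm_exp_eq_Re Re_utheta_arg[OF m] by (simp add: mult_ac)
    qed
    moreover have "exp (- \<beta> n * t) \<le> exp (- \<delta> * t)"
    proof -
      have "0 < n ^ 2" using False by simp
      then have "1 \<le> n ^ 2" by linarith
      then have "of_int 1 \<le> (of_int (n ^ 2) :: real)" by (simp only: of_int_le_iff)
      then have "\<delta> * 1 \<le> \<delta> * of_int n ^ 2" using \<delta> by (intro mult_left_mono) auto
      then have "\<delta> \<le> \<beta> n" by (simp add: \<delta>_def \<beta>_def)
      then show ?thesis using that by simp
    qed
    moreover have "norm (T n t) = norm (f n) * exp (- \<beta> n * t) * (\<bar>of_int n\<bar> * norm (E n))"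
      by (simp add: T_def norm_mult)
    ultimately show ?thesis
      using coeff_bound(1) coeff_bound(2)[of n] by (auto intro!: mult_mono)
  qed (simp add: T_def)
  have "(\<lambda>N. LINT t|lborel. ?s N t) \<longlonglongrightarrow> (LINT t|lborel. indicator {0<..} t *\<^sub>R (utheta m 1 f (\<tau> + \<i> * of_real t) * w t))"
  proof (rule integral_dominated_convergence[where w = "\<lambda>t. (coeff_bound * S * norm sqrt_phase) * (indicator {0<..} t * (t powr (- 1 / 2) * exp (- \<delta> * t)))"])
    show "integrable lborel (\<lambda>t. (coeff_bound * S * norm sqrt_phase) * (indicator {0<..} t * (t powr (- 1 / 2) * exp (- \<delta> * t))))"
      using gamma_half_integral[OF \<delta>] by (intro integrable_mult_right) (auto simp: has_bochner_integral_iff)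
    show meas: "?s N \<in> borel_measurable lborel" for N
      using int_s[of N] unfolding has_bochner_integral_iff by (intro borel_measurable_integrable) blast
    have lim: "(\<lambda>N. ?s N t) \<longlonglongrightarrow> indicator {0<..} t *\<^sub>R (utheta m 1 f (\<tau> + \<i> * of_real t) * w t)" for t
    proof (cases "t > 0")
      case True
      have "(\<lambda>N. \<Sum>n\<in>{- int N..<int N}. T n t) \<longlonglongrightarrow> utheta m 1 f (\<tau> + \<i> * of_real t)"
        using T[OF True] unfolding has_sum_def by (rule filterlim_compose[OF _ filterlim_symmetric_intervals])
      then have "(\<lambda>N. (\<Sum>n\<in>{- int N..<int N}. T n t) * w t) \<longlonglongrightarrow> utheta m 1 f (\<tau> + \<i> * of_real t) * w t"
        by (intro tendsto_mult_right)
      then show ?thesis using True by (simp add: sum_distrib_right)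
    qed simp
    then show "AE t in lborel. (\<lambda>N. ?s N t) \<longlonglongrightarrow> indicator {0<..} t *\<^sub>R (utheta m 1 f (\<tau> + \<i> * of_real t) * w t)" by simp
    show "(\<lambda>t. indicator {0<..} t *\<^sub>R (utheta m 1 f (\<tau> + \<i> * of_real t) * w t)) \<in> borel_measurable lborel"
      by (rule borel_measurable_LIMSEQ_metric[OF meas lim])
    show "AE t in lborel. norm (?s N t) \<le> (coeff_bound * S * norm sqrt_phase) * (indicator {0<..} t * (t powr (- 1 / 2) * exp (- \<delta> * t)))" for N
    proof (rule AE_I2)
      fix t :: real
      show "norm (?s N t) \<le> (coeff_bound * S * norm sqrt_phase) * (indicator {0<..} t * (t powr (- 1 / 2) * exp (- \<delta> * t)))"
      proof (cases "t > 0")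
        case True
        have "norm (\<Sum>n\<in>{- int N..<int N}. T n t) \<le> (\<Sum>n\<in>{- int N..<int N}. (coeff_bound * exp (- \<delta> * t)) * (\<bar>of_int n\<bar> ^ 1 * exp (- (pi * (Im \<tau> / (2 * of_int m))) * of_int n ^ 2)))"
          by (rule sum_norm_le) (rule Tle[OF True])
        also have "\<dots> = (coeff_bound * exp (- \<delta> * t)) * (\<Sum>n\<in>{- int N..<int N}. \<bar>of_int n\<bar> ^ 1 * exp (- (pi * (Im \<tau> / (2 * of_int m))) * of_int n ^ 2))"
          by (simp only: sum_distrib_left)
        also have "\<dots> \<le> (coeff_bound * exp (- \<delta> * t)) * S"
          unfolding S_def using coeff_bound(1) \<tau> m
          by (intro mult_left_mono finite_sum_le_infsum summable_power_gauss_int) auto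
        finally have "norm (\<Sum>n\<in>{- int N..<int N}. T n t) * norm (w t) \<le> (coeff_bound * exp (- \<delta> * t)) * S * norm (w t)"
          by (rule mult_right_mono) simp
        also have "norm (w t) = t powr (- 1 / 2) * norm sqrt_phase" by (simp add: w_def norm_mult)
        finally have "norm ((\<Sum>n\<in>{- int N..<int N}. T n t) * w t) \<le> coeff_bound * exp (- \<delta> * t) * S * (t powr (- 1 / 2) * norm sqrt_phase)"
          by (simp add: norm_mult w_def)
        moreover have "?s N t = (\<Sum>n\<in>{- int N..<int N}. T n t) * w t"
          using True by (simp add: sum_distrib_right)
        ultimately show ?thesis using True by (simp only:) (simp add: mult_ac)
      qed simp
    qed
  qed
  moreover have "(\<lambda>N. LINT t|lborel. ?s N t) \<longlonglongrightarrow> 2 * of_real (sqrt (2 * of_int m)) * sqrt_phase * utheta m 0 (half_sgn f) \<tau>"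
  proof -
    have "((\<lambda>n. half_sgn f n * of_int n ^ 0 * E n) has_sum utheta m 0 (half_sgn f) \<tau>) UNIV"
      unfolding utheta_def E_def by (rule gtheta_has_sum[OF half_sgn_bound r])
    then have "(\<lambda>N. \<Sum>n\<in>{- int N..<int N}. half_sgn f n * of_int n ^ 0 * E n) \<longlonglongrightarrow> utheta m 0 (half_sgn f) \<tau>"
      unfolding has_sum_def by (rule filterlim_compose[OF _ filterlim_symmetric_intervals])
    then have "(\<lambda>N. 2 * of_real (sqrt (2 * of_int m)) * sqrt_phase * (\<Sum>n\<in>{- int N..<int N}. half_sgn f n * of_int n ^ 0 * E n))
        \<longlonglongrightarrow> 2 * of_real (sqrt (2 * of_int m)) * sqrt_phase * utheta m 0 (half_sgn f) \<tau>"
      by (intro tendsto_mult_left)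
    moreover have "(LINT t|lborel. ?s N t) = 2 * of_real (sqrt (2 * of_int m)) * sqrt_phase * (\<Sum>n\<in>{- int N..<int N}. half_sgn f n * of_int n ^ 0 * E n)" for N
      using has_bochner_integral_integral_eq[OF int_s[of N]] by (simp add: sum_distrib_left)
    ultimately show ?thesis by simp
  qed
  ultimately have "(LINT t|lborel. indicator {0<..} t *\<^sub>R (utheta m 1 f (\<tau> + \<i> * of_real t) * w t)) =
      2 * of_real (sqrt (2 * of_int m)) * sqrt_phase * utheta m 0 (half_sgn f) \<tau>"
    by (rule LIMSEQ_unique)
  moreover have "indicator {0<..} t *\<^sub>R (utheta m 1 f (\<tau> + \<i> * of_real t) * w t) =
      indicator {0<..} t *\<^sub>R (utheta m 1 f (\<tau> + \<i> * of_real t) * (Complex 0 t powr (- 1 / 2) * \<i>))" for t :: real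
    using imag_powr_half[of t] by (cases "t > 0") (simp_all add: w_def)
  ultimately show ?thesis by (simp only: set_lebesgue_integral_def)
qed

text \<open>The path from x + iy is parametrized by the distance t from its starting point, so the
  singular factor does not depend on y and only the theta series moves. Its bound on the vertical
  line above x gives a majorant uniform in y.\<close>

lemma false_theta_radial_limit:
  assumes x: "x \<in> \<rat>"
  shows "((\<lambda>y. 2 * of_real (sqrt (2 * of_int m)) * sqrt_phase * utheta m 0 (half_sgn f) (Complex x y)) \<longlongrightarrow> cusp_int m f x x) (at_right 0)"
  unfolding tendsto_at_iff_sequentially
proof (intro allI impI)
  fix Y :: "nat \<Rightarrow> real" assume "\<forall>i. Y i \<in> {0<..} - {0}" and Y0: "Y \<longlonglongrightarrow> 0"
  then have Y: "Y i > 0" for i by auto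
  let ?w = "\<lambda>t. Complex 0 t powr (- 1 / 2) * \<i>"
  obtain \<delta> where \<delta>: "\<delta> > 0" "\<And>N. \<exists>C\<ge>0. \<forall>t>0. norm (utheta m 1 f (Complex x t)) \<le> C * (t ^ N * exp (- \<delta> * t))"
    by (rule vertical_bound[OF x]) (rule that)
  obtain C where C: "C \<ge> 0" "\<And>t. t > 0 \<Longrightarrow> norm (utheta m 1 f (Complex x t)) \<le> C * (t ^ 0 * exp (- \<delta> * t))"
    using \<delta>(2)[of 0] by blast
  have "(\<lambda>i. LINT t|lborel. indicator {0<..} t *\<^sub>R (utheta m 1 f (Complex x (Y i + t)) * ?w t)) \<longlonglongrightarrow>
      (LINT t|lborel. indicator {0<..} t *\<^sub>R (utheta m 1 f (Complex x t) * ?w t))"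
  proof (rule integral_dominated_convergence[where w = "\<lambda>t. C * (indicator {0<..} t * (t powr (- 1 / 2) * exp (- \<delta> * t)))"])
    show "integrable lborel (\<lambda>t. C * (indicator {0<..} t * (t powr (- 1 / 2) * exp (- \<delta> * t))))"
      using gamma_half_integral[OF \<delta>(1)] by (intro integrable_mult_right) (auto simp: has_bochner_integral_iff)
    have meas: "(\<lambda>t. indicator {0<..} t *\<^sub>R (utheta m 1 f (Complex x (y + t)) * ?w t)) \<in> borel_measurable lborel" if "y \<ge> 0" for y
    proof -
      have "(\<lambda>t. indicator {0<..} t *\<^sub>R (utheta m 1 f (Complex x (y + t)) * ?w t)) \<in> borel_measurable borel"
        by (intro borel_measurable_continuous_on_indicator continuous_on_mult continuous_vertical[OF that] continuous_vertical_powr continuous_on_const) auto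
      then show ?thesis by simp
    qed
    show "(\<lambda>t. indicator {0<..} t *\<^sub>R (utheta m 1 f (Complex x t) * ?w t)) \<in> borel_measurable lborel"
      using meas[of 0] by simp
    show "(\<lambda>t. indicator {0<..} t *\<^sub>R (utheta m 1 f (Complex x (Y i + t)) * ?w t)) \<in> borel_measurable lborel" for i
      using meas[of "Y i"] Y[of i] by simp
    show "AE t in lborel. (\<lambda>i. indicator {0<..} t *\<^sub>R (utheta m 1 f (Complex x (Y i + t)) * ?w t)) \<longlonglongrightarrow>
        indicator {0<..} t *\<^sub>R (utheta m 1 f (Complex x t) * ?w t)"
    proof (rule AE_I2)
      fix t :: real
      show "(\<lambda>i. indicator {0<..} t *\<^sub>R (utheta m 1 f (Complex x (Y i + t)) * ?w t)) \<longlonglongrightarrow>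
        indicator {0<..} t *\<^sub>R (utheta m 1 f (Complex x t) * ?w t)"
      proof (cases "t > 0")
        case True
        have "continuous_on {0<..} (\<lambda>t. utheta m 1 f (Complex x (0 + t)))" by (rule continuous_vertical) simp
        then have "isCont (\<lambda>t. utheta m 1 f (Complex x t)) t"
          using True by (simp add: continuous_on_eq_continuous_at)
        moreover have "(\<lambda>i. Y i + t) \<longlonglongrightarrow> t" using tendsto_add[OF Y0 tendsto_const[of t]] by simp
        ultimately have "(\<lambda>i. utheta m 1 f (Complex x (Y i + t))) \<longlonglongrightarrow> utheta m 1 f (Complex x t)"
          by (rule isCont_tendsto_compose)
        then show ?thesis by (intro tendsto_scaleR tendsto_mult tendsto_const)
      qed simp
    qed
    show "AE t in lborel. norm (indicator {0<..} t *\<^sub>R (utheta m 1 f (Complex x (Y i + t)) * ?w t)) \<le>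
        C * (indicator {0<..} t * (t powr (- 1 / 2) * exp (- \<delta> * t)))" for i
    proof (rule AE_I2)
      fix t :: real
      show "norm (indicator {0<..} t *\<^sub>R (utheta m 1 f (Complex x (Y i + t)) * ?w t)) \<le>
        C * (indicator {0<..} t * (t powr (- 1 / 2) * exp (- \<delta> * t)))"
      proof (cases "t > 0")
        case True
        have "norm (utheta m 1 f (Complex x (Y i + t))) \<le> C * ((Y i + t) ^ 0 * exp (- \<delta> * (Y i + t)))"
          using True Y[of i] by (intro C) auto
        also have "\<dots> \<le> C * exp (- \<delta> * t)"
          using C(1) \<delta>(1) Y[of i] by (auto intro!: mult_left_mono)
        finally have "norm (utheta m 1 f (Complex x (Y i + t))) * norm (?w t) \<le> (C * exp (- \<delta> * t)) * t powr (- 1 / 2)"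
          using C(1) norm_Complex_powr_le[OF True, of 0] by (intro mult_mono) (auto simp: norm_mult)
        then show ?thesis using True by (simp add: norm_mult mult_ac)
      qed simp
    qed
  qed
  moreover have "(LINT t|lborel. indicator {0<..} t *\<^sub>R (utheta m 1 f (Complex x (Y i + t)) * ?w t)) =
      2 * of_real (sqrt (2 * of_int m)) * sqrt_phase * utheta m 0 (half_sgn f) (Complex x (Y i))" for i
  proof -
    have "Complex x (Y i) + \<i> * of_real t = Complex x (Y i + t)" for t by (simp add: complex_eq_iff)
    then show ?thesis
      using false_theta_integral[of "Complex x (Y i)"] Y[of i] by (simp add: set_lebesgue_integral_def)
  qed
  ultimately show "((\<lambda>y. 2 * of_real (sqrt (2 * of_int m)) * sqrt_phase * utheta m 0 (half_sgn f) (Complex x y)) \<circ> Y) \<longlonglongrightarrow> cusp_int m f x x"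
    by (simp add: cusp_int_def set_lebesgue_integral_def o_def)
qed

end

section \<open>The error of modularity\<close>

lemma powr_neg_half_mult_self: "w \<noteq> 0 \<Longrightarrow> w powr (- 1 / 2) * w powr (- 1 / 2) = 1 / w" for w :: complex
proof -
  assume "w \<noteq> 0"
  have "w powr (- 1 / 2) * w powr (- 1 / 2) = w powr (- 1)"
    by (simp add: powr_add[symmetric])
  also have "\<dots> = 1 / w" using \<open>w \<noteq> 0\<close> by (simp add: powr_minus_divide)
  finally show ?thesis .
qed

lemma mobius_diff:
  fixes a b c d :: int and z w :: complex
  assumes "a * d - b * c = 1" "of_int c * z + of_int d \<noteq> 0" "of_int c * w + of_int d \<noteq> 0"
  shows "(of_int a * z + of_int b) / (of_int c * z + of_int d) - (of_int a * w + of_int b) / (of_int c * w + of_int d) =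
    (z - w) / ((of_int c * z + of_int d) * (of_int c * w + of_int d))"
proof -
  have det: "(of_int a * of_int d - of_int b * of_int c :: complex) = 1"
    using assms(1) by (metis of_int_1 of_int_diff of_int_mult)
  have "(of_int a * z + of_int b) * (of_int c * w + of_int d) - (of_int a * w + of_int b) * (of_int c * z + of_int d) =
      (of_int a * of_int d - of_int b * of_int c) * (z - w)"
    by (simp add: algebra_simps)
  then show ?thesis using assms(2,3) by (simp add: det diff_frac_eq)
qed

lemma mobius_real:
  fixes a b c d :: int and x :: real
  shows "(of_int a * complex_of_real x + of_int b) / (of_int c * of_real x + of_int d) =
    of_real ((of_int a * x + of_int b) / (of_int c * x + of_int d))"
  by simp

text \<open>
  Both sides have the same square, and they agree at \<open>z = cnj \<sigma>\<close>; by connectedness of the lower half plane there is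
  no sign ambiguity. The limit \<open>z \<longrightarrow> x\<close> from below produces \<^const>\<open>real_automorphy\<close>.
\<close>

lemma powr_neg_half_mobius_diff:
  fixes a b c d :: int
  assumes det: "a * d - b * c = 1" and \<sigma>: "Im \<sigma> > 0" and z: "Im z < 0" and "c \<noteq> 0"
  defines "\<gamma> \<equiv> \<lambda>z. (of_int a * z + of_int b) / (of_int c * z + of_int d)"
  shows "(\<gamma> \<sigma> - \<gamma> z) powr (- 1 / 2) * (of_int c * \<sigma> + of_int d) powr (- 1 / 2) * (of_int c * z + of_int d) powr (- 1 / 2) =
    (\<sigma> - z) powr (- 1 / 2)"
proof -
  define L where "L = {z. Im z < 0}"
  define w where "w = of_int c * \<sigma> + of_int d"
  have w: "w \<noteq> 0" "Im w \<noteq> 0" using mobius_im_pos(1)[OF det \<sigma>] \<sigma> \<open>c \<noteq> 0\<close> by (auto simp: w_def)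
  have \<gamma>cnj: "\<gamma> (cnj z) = cnj (\<gamma> z)" for z by (simp add: \<gamma>_def)
  have \<gamma>\<sigma>: "Im (\<gamma> \<sigma>) = Im \<sigma> / norm w ^ 2" "Im (\<gamma> \<sigma>) > 0"
    unfolding \<gamma>_def w_def by (rule mobius_im_pos(2,3)[OF det \<sigma>])+
  have \<gamma>L: "Im (\<gamma> z) < 0" if "z \<in> L" for z
  proof -
    have "Im (\<gamma> (cnj z)) > 0" unfolding \<gamma>_def using that by (intro mobius_im_pos(3)[OF det]) (simp add: L_def)
    then show ?thesis by (simp add: \<gamma>cnj)
  qed
  \<comment> \<open>Since c \<noteq> 0, the factor cz + d does not meet the cut on L, so its
    principal power is continuous there.\<close>
  have cz: "Im (of_int c * z + of_int d) \<noteq> 0" if "z \<in> L" for z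
    using that \<open>c \<noteq> 0\<close> by (simp add: L_def)
  have cz0: "of_int c * z + of_int d \<noteq> 0" if "z \<in> L" for z
    using cz[OF that] by (metis zero_complex.sel(2))
  define R where "R z = (\<gamma> \<sigma> - \<gamma> z) powr (- 1 / 2) * w powr (- 1 / 2) * (of_int c * z + of_int d) powr (- 1 / 2) / (\<sigma> - z) powr (- 1 / 2)" for z
  have ne: "\<gamma> \<sigma> - \<gamma> z \<noteq> 0" "\<sigma> - z \<noteq> 0" if "z \<in> L" for z
  proof -
    have "Im (\<gamma> \<sigma> - \<gamma> z) > 0" "Im (\<sigma> - z) > 0" using \<gamma>\<sigma>(2) \<gamma>L[OF that] \<sigma> that by (auto simp: L_def)
    then show "\<gamma> \<sigma> - \<gamma> z \<noteq> 0" "\<sigma> - z \<noteq> 0" by (auto simp del: minus_complex.sel)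
  qed
  have "continuous_on L R"
    unfolding R_def
  proof (intro continuous_on_mult continuous_on_divide continuous_on_powr_complex continuous_on_diff continuous_on_add continuous_on_const continuous_on_id)
    show "continuous_on L \<gamma>" unfolding \<gamma>_def by (intro continuous_intros) (use cz0 in auto)
  next
    show "L \<subseteq> {z. 0 \<le> Re (\<gamma> \<sigma> - \<gamma> z) \<or> Im (\<gamma> \<sigma> - \<gamma> z) \<noteq> 0}"
      using \<gamma>\<sigma>(2) \<gamma>L by fastforce
    show "L \<subseteq> {z. 0 \<le> Re (of_int c * z + of_int d) \<or> Im (of_int c * z + of_int d) \<noteq> 0}"
      using cz by blast
    show "L \<subseteq> {z. 0 \<le> Re (\<sigma> - z) \<or> Im (\<sigma> - z) \<noteq> 0}"
      using \<sigma> by (auto simp: L_def)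
  qed (use ne cz0 w in auto)
  moreover have "R z * R z = 1" if z: "z \<in> L" for z
  proof -
    have "R z * R z = ((\<gamma> \<sigma> - \<gamma> z) powr (- 1 / 2) * (\<gamma> \<sigma> - \<gamma> z) powr (- 1 / 2)) * (w powr (- 1 / 2) * w powr (- 1 / 2)) *
        ((of_int c * z + of_int d) powr (- 1 / 2) * (of_int c * z + of_int d) powr (- 1 / 2)) / ((\<sigma> - z) powr (- 1 / 2) * (\<sigma> - z) powr (- 1 / 2))"
      by (simp add: R_def mult_ac)
    also have "\<dots> = (1 / (\<gamma> \<sigma> - \<gamma> z)) * (1 / w) * (1 / (of_int c * z + of_int d)) / (1 / (\<sigma> - z))"
      using powr_neg_half_mult_self[OF ne(1)[OF z]] powr_neg_half_mult_self[OF ne(2)[OF z]] powr_neg_half_mult_self[OF w(1)] powr_neg_half_mult_self[OF cz0[OF z]]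
      by (simp only:)
    also have "\<gamma> \<sigma> - \<gamma> z = (\<sigma> - z) / (w * (of_int c * z + of_int d))"
      unfolding \<gamma>_def w_def by (rule mobius_diff[OF det]) (use w cz0[OF z] in \<open>auto simp: w_def\<close>)
    finally have "R z * R z = (1 / ((\<sigma> - z) / (w * (of_int c * z + of_int d)))) * (1 / w) * (1 / (of_int c * z + of_int d)) / (1 / (\<sigma> - z))" .
    moreover have "(1 / (A / (w * u))) * (1 / w) * (1 / u) / (1 / A) = 1" if "A \<noteq> 0" "u \<noteq> 0" for A u
      using that w(1) by (simp add: field_simps)
    ultimately show ?thesis using cz0[OF z] ne(2)[OF z] by (simp only:)
  qed
  then have "R ` L \<subseteq> {1, - 1}" by (auto simp: square_eq_1_iff)
  then have "finite (R ` L)" by (rule finite_subset) simp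
  moreover have "connected L" unfolding L_def by (intro convex_connected convex_halfspace_Im_lt)
  ultimately have "R constant_on L" by (intro continuous_finite_range_constant)
  \<comment> \<open>At the conjugate point both differences are positive multiples of i and the two
    automorphy factors are complex conjugates, so every root can be computed.\<close>
  moreover have "R (cnj \<sigma>) = 1"
  proof -
    define y where "y = Im \<sigma>"
    have y: "y > 0" using \<sigma> by (simp add: y_def)
    have 1: "\<sigma> - cnj \<sigma> = of_real (2 * y) * \<i>" by (simp add: complex_eq_iff y_def)
    have 2: "\<gamma> \<sigma> - \<gamma> (cnj \<sigma>) = of_real (2 * y / norm w ^ 2) * \<i>"
      unfolding \<gamma>cnj using \<gamma>\<sigma>(1) by (simp add: complex_eq_iff y_def)
    have powi: "(of_real r * \<i>) powr s = of_real r powr s * \<i> powr s" if "r > 0" for r s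
    proof -
      have "Ln (of_real r * \<i>) = Ln (of_real r) + Ln \<i>"
        using that by (subst Ln_times_of_real) (auto simp: Ln_of_real)
      then show ?thesis using that by (simp add: powr_def distrib_left exp_add)
    qed
    have powrr: "(of_real r :: complex) powr (- 1 / 2) = of_real (1 / sqrt r)" if "r > 0" for r
      using powr_of_real[of r "- 1 / 2"] that by (simp add: powr_minus_divide powr_half_sqrt)
    have 3: "w powr (- 1 / 2) * (of_int c * cnj \<sigma> + of_int d) powr (- 1 / 2) = of_real (1 / norm w)"
    proof -
      have "of_int c * cnj \<sigma> + of_int d = cnj w" by (simp add: w_def)
      moreover have "cnj w powr (- 1 / 2) = cnj (w powr (- 1 / 2))"
        using w by (subst cnj_powr) auto
      moreover have "w powr (- 1 / 2) * cnj (w powr (- 1 / 2)) = of_real (norm (w powr (- 1 / 2)) ^ 2)"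
        by (rule complex_norm_square[symmetric])
      moreover have "norm (w powr (- 1 / 2)) ^ 2 = 1 / norm w"
        using powr_neg_half_mult_self[OF w(1)]
        by (simp only: power2_eq_square norm_mult[symmetric]) (simp add: norm_divide)
      ultimately show ?thesis by (simp only:)
    qed
    have "sqrt (2 * y / norm w ^ 2) = sqrt (2 * y) / norm w" by (simp add: real_sqrt_divide)
    moreover have "R (cnj \<sigma>) = (\<gamma> \<sigma> - \<gamma> (cnj \<sigma>)) powr (- 1 / 2) * (w powr (- 1 / 2) * (of_int c * cnj \<sigma> + of_int d) powr (- 1 / 2)) / (\<sigma> - cnj \<sigma>) powr (- 1 / 2)"
      by (simp add: R_def mult_ac)
    moreover have "2 * y / norm w ^ 2 > 0" "2 * y > 0" using y w by auto
    ultimately show ?thesis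
      unfolding 3 1 2 using w y by (simp only: powi powrr) (simp add: field_simps)
  qed
  ultimately have "R z = 1"
    using \<sigma> z unfolding constant_on_def L_def by auto
  then show ?thesis
    using ne(2)[of z] z by (simp add: R_def w_def L_def field_simps)
qed

text \<open>Solve the identity of \<open>powr_neg_half_mobius_diff\<close> for (cz + d)^(-1/2) and
  let z tend to x from below. The powers of the differences are continuous at x, because
  \<gamma>\<sigma> - \<gamma>x and \<sigma> - x have positive imaginary part; so the limit exists
  and satisfies the same identity.\<close>

lemma real_automorphy_half:
  fixes a b c d :: int and x :: real
  assumes det: "a * d - b * c = 1" and "c \<noteq> 0" and x: "of_int c * x + of_int d \<noteq> 0"
    and entries: "\<gamma> $$ (1,0) = c" "\<gamma> $$ (1,1) = d"
  shows "real_automorphy (1/2) \<gamma> x \<noteq> 0"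
    and "Im \<sigma> > 0 \<Longrightarrow> ((of_int a * \<sigma> + of_int b) / (of_int c * \<sigma> + of_int d) - of_real ((of_int a * x + of_int b) / (of_int c * x + of_int d))) powr (- 1 / 2)
        * (of_int c * \<sigma> + of_int d) powr (- 1 / 2) * real_automorphy (1/2) \<gamma> x = (\<sigma> - of_real x) powr (- 1 / 2)"
proof -
  let ?g = "\<lambda>z :: complex. (of_int a * z + of_int b) / (of_int c * z + of_int d)"
  have main: "real_automorphy (1/2) \<gamma> x \<noteq> 0 \<and> (?g \<sigma> - ?g (of_real x)) powr (- 1 / 2) * (of_int c * \<sigma> + of_int d) powr (- 1 / 2) * real_automorphy (1/2) \<gamma> x = (\<sigma> - of_real x) powr (- 1 / 2)"
    if \<sigma>: "Im \<sigma> > 0" for \<sigma>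
  proof -
    have lim: "((\<lambda>y. Complex x (- y)) \<longlongrightarrow> Complex x 0) (at_right 0)"
      by (intro tendsto_Complex tendsto_const) (auto intro!: tendsto_eq_intros)
    have x': "of_int c * Complex x 0 + of_int d \<noteq> 0"
      using x by (simp add: complex_eq_iff)
    have Imx: "Im (?g \<sigma> - ?g (Complex x 0)) > 0"
    proof -
      have "?g (Complex x 0) = of_real ((of_int a * x + of_int b) / (of_int c * x + of_int d))"
        using mobius_real[of a x b c d] by (simp add: complex_of_real_def)
      then have "Im (?g (Complex x 0)) = 0" by (simp only: Im_complex_of_real)
      then show ?thesis using mobius_im_pos(3)[OF det \<sigma>] by simp
    qed
    have w0: "of_int c * \<sigma> + of_int d \<noteq> 0" by (rule mobius_im_pos(1)[OF det \<sigma>])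
    define l where "l y = (?g \<sigma> - ?g (Complex x (- y))) powr (- 1 / 2) * (of_int c * \<sigma> + of_int d) powr (- 1 / 2)" for y
    define l0 where "l0 = (?g \<sigma> - ?g (Complex x 0)) powr (- 1 / 2) * (of_int c * \<sigma> + of_int d) powr (- 1 / 2)"
    have l: "(l \<longlongrightarrow> l0) (at_right 0)"
      unfolding l_def l0_def
      by (intro tendsto_mult tendsto_powr_complex tendsto_diff tendsto_divide tendsto_add tendsto_const lim x' Im_pos_not_nonpos_Reals Imx)
    have "?g \<sigma> - ?g (Complex x 0) \<noteq> 0" using Imx by (metis less_irrefl zero_complex.sel(2))
    then have l0: "l0 \<noteq> 0" using w0 by (simp add: l0_def)
    have "((\<lambda>y. (\<sigma> - Complex x (- y)) powr (- 1 / 2) / l y) \<longlongrightarrow> (\<sigma> - Complex x 0) powr (- 1 / 2) / l0) (at_right 0)"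
      using \<sigma> by (intro tendsto_divide l l0 tendsto_powr_complex tendsto_diff tendsto_const lim Im_pos_not_nonpos_Reals) simp
    moreover have "\<forall>\<^sub>F y in at_right 0. (\<sigma> - Complex x (- y)) powr (- 1 / 2) / l y = mob_denom \<gamma> (Complex x (- y)) powr of_real (- (1/2))"
      using eventually_at_right_less[of "0::real"] tendsto_imp_eventually_ne[OF l l0]
    proof eventually_elim
      case (elim y)
      have "l y * (of_int c * Complex x (- y) + of_int d) powr (- 1 / 2) = (\<sigma> - Complex x (- y)) powr (- 1 / 2)"
        unfolding l_def using elim by (intro powr_neg_half_mobius_diff[OF det \<sigma> _ \<open>c \<noteq> 0\<close>]) simp
      moreover have "mob_denom \<gamma> (Complex x (- y)) = of_int c * Complex x (- y) + of_int d"
        by (simp only: mob_denom_def entries)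
      ultimately show ?case using elim by (simp add: field_simps)
    qed
    ultimately have "((\<lambda>y. mob_denom \<gamma> (Complex x (- y)) powr of_real (- (1/2))) \<longlongrightarrow> (\<sigma> - Complex x 0) powr (- 1 / 2) / l0) (at_right 0)"
      by (rule Lim_transform_eventually)
    then have "real_automorphy (1/2) \<gamma> x = (\<sigma> - Complex x 0) powr (- 1 / 2) / l0"
      unfolding real_automorphy_def by (intro tendsto_Lim) auto
    moreover have "\<sigma> - Complex x 0 \<noteq> 0" using \<sigma> by (auto simp: complex_eq_iff)
    ultimately show ?thesis
      using l0 by (simp add: l0_def complex_of_real_def)
  qed
  show "real_automorphy (1/2) \<gamma> x \<noteq> 0" using main[of \<i>] by simp
  show "Im \<sigma> > 0 \<Longrightarrow> (?g \<sigma> - of_real ((of_int a * x + of_int b) / (of_int c * x + of_int d))) powr (- 1 / 2)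
        * (of_int c * \<sigma> + of_int d) powr (- 1 / 2) * real_automorphy (1/2) \<gamma> x = (\<sigma> - of_real x) powr (- 1 / 2)"
    using main[of \<sigma>] unfolding mobius_real by blast
qed

section \<open>Primitives and comparison of paths\<close>

context periodic_theta
begin

text \<open>Replaces contour integrals of g(\<sigma>) (\<sigma> - x)^(-1/2): along any path in the
  upper half plane the integral is a difference of values of P, so comparing paths means comparing
  endpoints.\<close>

definition primitive_at :: "real \<Rightarrow> (complex \<Rightarrow> complex) \<Rightarrow> bool" where
  "primitive_at x P \<longleftrightarrow>
     (\<forall>\<sigma>. Im \<sigma> > 0 \<longrightarrow> (P has_field_derivative utheta m 1 f \<sigma> * (\<sigma> - of_real x) powr (- 1 / 2)) (at \<sigma>))"

lemma primitiveD:
  "primitive_at x P \<Longrightarrow> Im \<sigma> > 0 \<Longrightarrow> (P has_field_derivative utheta m 1 f \<sigma> * (\<sigma> - of_real x) powr (- 1 / 2)) (at \<sigma>)"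
  unfolding primitive_at_def by blast

lemma primitive_exists: "\<exists>P. primitive_at x P"
proof -
  have "(\<lambda>\<sigma>. utheta m 1 f \<sigma> * (\<sigma> - of_real x) powr (- 1 / 2)) holomorphic_on {\<tau>. Im \<tau> > 0}"
    by (intro holomorphic_intros utheta_holomorphic[OF m coeff_bound(2)]) (auto simp: complex_nonpos_Reals_iff)
  then obtain P where "\<And>\<sigma>. \<sigma> \<in> {\<tau>. Im \<tau> > 0} \<Longrightarrow> (P has_field_derivative utheta m 1 f \<sigma> * (\<sigma> - of_real x) powr (- 1 / 2)) (at \<sigma> within {\<tau>. Im \<tau> > 0})"
    by (rule holomorphic_convex_primitive'[OF convex_halfspace_Im_gt open_halfspace_Im_gt]) blast
  then show ?thesis
    unfolding primitive_at_def
    by (intro exI[of _ P] allI impI) (simp add: at_within_open[OF _ open_halfspace_Im_gt])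
qed

lemma primitive_vertical_limit:
  assumes P: "primitive_at x P" and p: "p \<in> \<rat>"
    and u: "\<And>n. u n > 0" "u \<longlonglongrightarrow> 0" and v: "filterlim v at_top sequentially"
  shows "(\<lambda>n. P (Complex p (v n)) - P (Complex p (u n))) \<longlonglongrightarrow> cusp_int m f p x"
  unfolding cusp_int_def
proof (rule tendsto_improper_integral[OF _ cusp_integrable[OF p] _ u v])
  show "continuous_on {0<..} (\<lambda>t. utheta m 1 f (Complex p t) * (Complex (p - x) t powr (- 1 / 2) * \<i>))"
    using continuous_vertical[of 0 p] by (intro continuous_on_mult continuous_vertical_powr continuous_on_const) simp
  fix t :: real assume t: "t > 0"
  have eq: "Complex p = (\<lambda>t. of_real p + of_real t * \<i>)" by (auto simp: complex_eq_iff)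
  have "(Complex p has_vector_derivative \<i>) (at t)"
    unfolding eq by (auto intro!: derivative_eq_intros)
  moreover have "(P has_field_derivative utheta m 1 f (Complex p t) * (Complex p t - of_real x) powr (- 1 / 2)) (at (Complex p t))"
    by (rule primitiveD[OF P]) (simp add: t)
  ultimately have "(P \<circ> Complex p has_vector_derivative \<i> * (utheta m 1 f (Complex p t) * (Complex p t - of_real x) powr (- 1 / 2))) (at t)"
    by (rule field_vector_diff_chain_at)
  moreover have "Complex p t - of_real x = Complex (p - x) t" by (simp add: complex_eq_iff)
  ultimately show "((\<lambda>t. P (Complex p t)) has_vector_derivative utheta m 1 f (Complex p t) * (Complex (p - x) t powr (- 1 / 2) * \<i>)) (at t)"
    by (simp add: o_def mult_ac)
qed

text \<open>For D \<noteq> 0 the point r + iv/(1 + iDv) runs on the geodesic from r to r + 1/D. It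
  differs from r + iv by O(v^2), while in the cone the derivative of P is O(v^(-1/2)); so one
  endpoint may replace the other in the limit.\<close>

lemma primitive_near_cusp:
  assumes P: "primitive_at x P" and r: "r \<in> \<rat>" and v: "\<And>n. v n > 0" "v \<longlonglongrightarrow> 0"
  shows "(\<lambda>n. P (of_real r + \<i> * of_real (v n) / (1 + \<i> * of_real (D * v n))) - P (Complex r (v n))) \<longlonglongrightarrow> 0"
proof -
  obtain \<delta> where \<delta>: "\<delta> > 0"
    "\<And>N. \<exists>C. \<forall>\<sigma>. Im \<sigma> > 0 \<longrightarrow> \<bar>Re \<sigma> - r\<bar> \<le> Im \<sigma> \<longrightarrow> norm (utheta m 1 f \<sigma>) \<le> C * (Im \<sigma> ^ N * exp (- \<delta> * Im \<sigma>))"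
    by (rule utheta_1_cone_bound[where f = f, OF m f r]) (rule that)
  obtain C where C: "\<And>\<sigma>. Im \<sigma> > 0 \<Longrightarrow> \<bar>Re \<sigma> - r\<bar> \<le> Im \<sigma> \<Longrightarrow> norm (utheta m 1 f \<sigma>) \<le> C * (Im \<sigma> ^ 0 * exp (- \<delta> * Im \<sigma>))"
    using \<delta>(2)[of 0] by blast
  have C0: "norm (utheta m 1 f \<sigma>) \<le> \<bar>C\<bar>" if "Im \<sigma> > 0" "\<bar>Re \<sigma> - r\<bar> \<le> Im \<sigma>" for \<sigma>
  proof -
    have "norm (utheta m 1 f \<sigma>) \<le> C * exp (- \<delta> * Im \<sigma>)"
      using C[OF that] by simp
    also have "\<dots> \<le> \<bar>C\<bar> * exp (- \<delta> * Im \<sigma>)"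
      by (intro mult_right_mono) auto
    also have "\<dots> \<le> \<bar>C\<bar> * 1" using \<delta>(1) that by (intro mult_left_mono) auto
    finally show ?thesis by simp
  qed
  \<comment> \<open>For |D| v <= 1/2 both points lie in the ball of radius v/2 around r + iv, where
    Im z >= v/2 and z stays in the cone at r.\<close>
  have bound: "norm (P (of_real r + \<i> * of_real v / (1 + \<i> * of_real (D * v))) - P (Complex r v)) \<le> (\<bar>C\<bar> * (v / 2) powr (- 1 / 2)) * (\<bar>D\<bar> * v ^ 2)"
    if v: "v > 0" "\<bar>D\<bar> * v \<le> 1 / 2" for v
  proof -
    define \<sigma> where "\<sigma> = of_real r + \<i> * of_real v / (1 + \<i> * of_real (D * v))"
    have n1: "norm (1 + \<i> * complex_of_real (D * v)) \<ge> 1"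
      using abs_Re_le_cmod[of "1 + \<i> * complex_of_real (D * v)"] by simp
    then have nz: "1 + \<i> * complex_of_real (D * v) \<noteq> 0" by auto
    have "\<i> * of_real v / (1 + \<i> * of_real (D * v)) - \<i> * of_real v = of_real (D * v ^ 2) / (1 + \<i> * of_real (D * v))"
      using nz by (simp add: field_simps power2_eq_square)
    then have "\<sigma> - Complex r v = of_real (D * v ^ 2) / (1 + \<i> * of_real (D * v))"
      by (simp add: \<sigma>_def Complex_eq)
    then have "norm (\<sigma> - Complex r v) = \<bar>D\<bar> * v ^ 2 / norm (1 + \<i> * complex_of_real (D * v))"
      by (simp add: norm_divide norm_mult norm_power abs_mult)
    also have "\<dots> \<le> \<bar>D\<bar> * v ^ 2 / 1" using n1 by (intro divide_left_mono) auto
    finally have dist: "norm (\<sigma> - Complex r v) \<le> \<bar>D\<bar> * v ^ 2" by simp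
    have rad: "\<bar>D\<bar> * v ^ 2 \<le> v / 2"
      using mult_right_mono[OF v(2), of v] v(1) by (simp add: power2_eq_square)
    have "norm (P \<sigma> - P (Complex r v)) \<le> (\<bar>C\<bar> * (v / 2) powr (- 1 / 2)) * norm (\<sigma> - Complex r v)"
    proof (rule field_differentiable_bound[of "cball (Complex r v) (v / 2)" P])
      fix z assume z: "z \<in> cball (Complex r v) (v / 2)"
      then have "\<bar>Im z - v\<bar> \<le> v / 2" "\<bar>Re z - r\<bar> \<le> v / 2"
        using abs_Im_le_cmod[of "z - Complex r v"] abs_Re_le_cmod[of "z - Complex r v"]
        by (auto simp: dist_norm norm_minus_commute)
      then have Im: "Im z \<ge> v / 2" "Im z > 0" "\<bar>Re z - r\<bar> \<le> Im z" using v(1) by linarith+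
      show "(P has_field_derivative utheta m 1 f z * (z - of_real x) powr (- 1 / 2)) (at z within cball (Complex r v) (v / 2))"
        by (rule has_field_derivative_at_within[OF primitiveD[OF P Im(2)]])
      have zx: "z - of_real x = Complex (Re z - x) (Im z)" by (simp add: complex_eq_iff)
      have "norm ((z - of_real x) powr (- 1 / 2)) \<le> Im z powr (- 1 / 2)"
        unfolding zx by (rule norm_Complex_powr_le[OF Im(2)])
      also have "\<dots> \<le> (v / 2) powr (- 1 / 2)" using Im v by (intro powr_mono2') auto
      finally show "norm (utheta m 1 f z * (z - of_real x) powr (- 1 / 2)) \<le> \<bar>C\<bar> * (v / 2) powr (- 1 / 2)"
        unfolding norm_mult using C0[OF Im(2,3)] by (intro mult_mono) auto
    qed (use dist rad v in \<open>auto simp: dist_norm norm_minus_commute\<close>)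
    also have "\<dots> \<le> (\<bar>C\<bar> * (v / 2) powr (- 1 / 2)) * (\<bar>D\<bar> * v ^ 2)"
      using dist by (intro mult_left_mono) auto
    finally show ?thesis by (simp add: \<sigma>_def)
  qed
  have "\<forall>\<^sub>F n in sequentially. \<bar>D\<bar> * v n \<le> 1 / 2"
  proof -
    have "(\<lambda>n. \<bar>D\<bar> * v n) \<longlonglongrightarrow> \<bar>D\<bar> * 0" by (intro tendsto_intros v(2))
    then have "\<forall>\<^sub>F n in sequentially. \<bar>D\<bar> * v n < 1 / 2" by (rule order_tendstoD(2)) simp
    then show ?thesis by (rule eventually_mono) simp
  qed
  then have "\<forall>\<^sub>F n in sequentially. norm (P (of_real r + \<i> * of_real (v n) / (1 + \<i> * of_real (D * v n))) - P (Complex r (v n)))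
      \<le> (\<bar>C\<bar> * (v n / 2) powr (- 1 / 2)) * (\<bar>D\<bar> * v n ^ 2)"
    by (rule eventually_mono) (rule bound[OF v(1)])
  moreover have "(\<lambda>n. (\<bar>C\<bar> * (v n / 2) powr (- 1 / 2)) * (\<bar>D\<bar> * v n ^ 2)) \<longlonglongrightarrow> 0"
  proof -
    have "(\<lambda>n. (4 * \<bar>C\<bar> * \<bar>D\<bar>) * (v n / 2) powr (3 / 2)) \<longlonglongrightarrow> (4 * \<bar>C\<bar> * \<bar>D\<bar>) * (0 / 2) powr (3 / 2)"
      by (intro tendsto_mult_left tendsto_powr' tendsto_divide v(2) tendsto_const) (use v(1) in \<open>auto simp: less_imp_le\<close>)
    moreover have "(4 * \<bar>C\<bar> * \<bar>D\<bar>) * (v n / 2) powr (3 / 2) = (\<bar>C\<bar> * (v n / 2) powr (- 1 / 2)) * (\<bar>D\<bar> * v n ^ 2)" for n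
    proof -
      have "(v n / 2) powr (3 / 2) = (v n / 2) powr (- 1 / 2 + 2)" by simp
      also have "\<dots> = (v n / 2) powr (- 1 / 2) * (v n / 2) powr 2" by (rule powr_add)
      also have "(v n / 2) powr 2 = (v n / 2) ^ 2" using v(1)[of n] by simp
      finally show ?thesis by (simp add: power_divide)
    qed
    ultimately show ?thesis by simp
  qed
  ultimately show ?thesis by (rule Lim_null_comparison)
qed

text \<open>The two points are joined by a horizontal segment of fixed length, on which the
  integrand at height T is O(T^(-1/2)).\<close>

lemma primitive_near_infinity:
  assumes P: "primitive_at x P" and p: "p \<in> \<rat>" and v: "filterlim v at_top sequentially"
  shows "(\<lambda>n. P (Complex x (v n)) - P (Complex p (v n))) \<longlonglongrightarrow> 0"
proof -
  obtain \<delta> where \<delta>: "\<delta> > 0"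
    "\<And>N. \<exists>C. \<forall>\<sigma>. Im \<sigma> > 0 \<longrightarrow> \<bar>Re \<sigma> - p\<bar> \<le> Im \<sigma> \<longrightarrow> norm (utheta m 1 f \<sigma>) \<le> C * (Im \<sigma> ^ N * exp (- \<delta> * Im \<sigma>))"
    by (rule utheta_1_cone_bound[where f = f, OF m f p]) (rule that)
  obtain C where C: "\<And>\<sigma>. Im \<sigma> > 0 \<Longrightarrow> \<bar>Re \<sigma> - p\<bar> \<le> Im \<sigma> \<Longrightarrow> norm (utheta m 1 f \<sigma>) \<le> C * (Im \<sigma> ^ 0 * exp (- \<delta> * Im \<sigma>))"
    using \<delta>(2)[of 0] by blast
  have bound: "norm (P (Complex x T) - P (Complex p T)) \<le> (\<bar>C\<bar> * T powr (- 1 / 2)) * \<bar>x - p\<bar>"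
    if T: "T > 0" "\<bar>x - p\<bar> \<le> T" for T
  proof -
    have "norm (P (Complex x T) - P (Complex p T)) \<le> (\<bar>C\<bar> * T powr (- 1 / 2)) * norm (Complex x T - Complex p T)"
    proof (rule field_differentiable_bound[of "closed_segment (Complex x T) (Complex p T)" P])
      fix z assume "z \<in> closed_segment (Complex x T) (Complex p T)"
      then obtain u where u: "0 \<le> u" "u \<le> 1" "z = (1 - u) *\<^sub>R Complex x T + u *\<^sub>R Complex p T"
        by (auto simp: closed_segment_def)
      have z: "Im z = T" "Re z - p = (1 - u) * (x - p)"
        unfolding u(3) by (simp_all add: algebra_simps)
      have "\<bar>Re z - p\<bar> = (1 - u) * \<bar>x - p\<bar>" unfolding z(2) using u by (simp add: abs_mult)
      also have "\<dots> \<le> 1 * \<bar>x - p\<bar>" using u by (intro mult_right_mono) auto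
      finally have Im: "Im z > 0" "\<bar>Re z - p\<bar> \<le> Im z"
        using T z(1) by auto
      show "(P has_field_derivative utheta m 1 f z * (z - of_real x) powr (- 1 / 2)) (at z within closed_segment (Complex x T) (Complex p T))"
        by (rule has_field_derivative_at_within[OF primitiveD[OF P Im(1)]])
      have zx: "z - of_real x = Complex (Re z - x) T" by (simp add: complex_eq_iff z)
      have "norm (utheta m 1 f z) \<le> C * exp (- \<delta> * Im z)"
        using C[OF Im] by simp
      also have "\<dots> \<le> \<bar>C\<bar> * exp (- \<delta> * Im z)"
        by (intro mult_right_mono) auto
      also have "\<dots> \<le> \<bar>C\<bar> * 1" using \<delta>(1) Im by (intro mult_left_mono) auto
      finally show "norm (utheta m 1 f z * (z - of_real x) powr (- 1 / 2)) \<le> \<bar>C\<bar> * T powr (- 1 / 2)"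
        unfolding norm_mult zx by (intro mult_mono norm_Complex_powr_le T) auto
    qed auto
    also have "norm (Complex x T - Complex p T) = \<bar>x - p\<bar>"
      by (simp add: norm_complex_def)
    finally show ?thesis .
  qed
  have "\<forall>\<^sub>F n in sequentially. v n \<ge> max 1 \<bar>x - p\<bar>" using v unfolding filterlim_at_top by blast
  then have "\<forall>\<^sub>F n in sequentially. norm (P (Complex x (v n)) - P (Complex p (v n))) \<le> (\<bar>C\<bar> * v n powr (- 1 / 2)) * \<bar>x - p\<bar>"
    by (rule eventually_mono) (rule bound, auto)
  moreover have "(\<lambda>n. (\<bar>C\<bar> * v n powr (- 1 / 2)) * \<bar>x - p\<bar>) \<longlonglongrightarrow> 0"
  proof -
    have "(\<lambda>n. (\<bar>C\<bar> * v n powr (- 1 / 2)) * \<bar>x - p\<bar>) \<longlonglongrightarrow> (\<bar>C\<bar> * 0) * \<bar>x - p\<bar>"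
      by (intro tendsto_mult_right tendsto_mult_left tendsto_neg_powr[OF _ v]) simp
    then show ?thesis by simp
  qed
  ultimately show ?thesis by (rule Lim_null_comparison)
qed

text \<open>
  The primitive \<open>P'\<close> at \<open>x' = \<gamma>x\<close> pulled back by \<open>\<gamma>\<close> is a multiple of the primitive \<open>P\<close> at \<open>x\<close> up to a constant, so
  the integral from \<open>x'\<close> to \<open>i\<infinity>\<close> becomes an integral along the geodesic \<open>S\<close> from \<open>x\<close> to \<open>p = \<gamma>^-1(i\<infinity>)\<close>. The claim is
  the vanishing of the integral of a closed form around the ideal triangle with vertices \<open>x\<close>, \<open>p\<close>, \<open>i\<infinity>\<close>.
\<close>

lemma cusp_transform:
  fixes a b c d :: int and x :: real
  assumes det: "a * d - b * c = 1" and "c \<noteq> 0" and x: "x \<in> \<rat>" "of_int c * x + of_int d \<noteq> 0"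
    and "\<kappa> \<noteq> 0" "E \<noteq> 0"
    and \<kappa>: "\<And>\<sigma>. Im \<sigma> > 0 \<Longrightarrow> utheta m 1 f ((of_int a * \<sigma> + of_int b) / (of_int c * \<sigma> + of_int d)) =
      \<kappa> * (of_int c * \<sigma> + of_int d) powr (3 / 2) * utheta m 1 f \<sigma>"
    and E: "\<And>\<sigma>. Im \<sigma> > 0 \<Longrightarrow> ((of_int a * \<sigma> + of_int b) / (of_int c * \<sigma> + of_int d) - of_real ((of_int a * x + of_int b) / (of_int c * x + of_int d))) powr (- 1 / 2)
        * (of_int c * \<sigma> + of_int d) powr (- 1 / 2) * E = (\<sigma> - of_real x) powr (- 1 / 2)"
  defines "x' \<equiv> (of_int a * x + of_int b) / (of_int c * x + of_int d)"
  shows "cusp_int m f x x - E / \<kappa> * cusp_int m f x' x' = cusp_int m f (- of_int d / of_int c) x"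
proof -
  let ?g = "\<lambda>\<sigma> :: complex. (of_int a * \<sigma> + of_int b) / (of_int c * \<sigma> + of_int d)"
  define p where "p = - of_int d / (of_int c :: real)"
  have p: "p \<in> \<rat>" by (simp add: p_def)
  have x': "x' \<in> \<rat>" using x(1) by (simp add: x'_def)
  have "x \<noteq> p" using x(2) \<open>c \<noteq> 0\<close> by (auto simp: p_def)
  define D where "D = 1 / (x - p)"
  have D: "D \<noteq> 0" "x = p + 1 / D" using \<open>x \<noteq> p\<close> by (auto simp: D_def)
  define C where "C = (of_int c :: real) ^ 2"
  have C: "C > 0" using \<open>c \<noteq> 0\<close> by (simp add: C_def)
  obtain P where P: "primitive_at x P" using primitive_exists by blast
  obtain P' where P': "primitive_at x' P'" using primitive_exists by blast
  \<comment> \<open>The preimage under \<gamma> of the vertical line x' + iT, that is, the geodesic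
    from x at T = 0 to p for T to infinity. The constants C and D arise from solving \<gamma>z = x'
    + iT, which is a/c - 1/(c^2 (z - p)) = x' + iT, for z.\<close>
  define S where "S = (\<lambda>T. of_real p + 1 / (of_real D - \<i> * of_real (C * T)))"
  have Dz: "of_real D - \<i> * of_real (C * T) \<noteq> 0" for T
    using D(1) by (auto simp: complex_eq_iff)
  have ImS: "Im (S T) > 0" if "T > 0" for T
  proof -
    have "Im (S T) = C * T / (D ^ 2 + (C * T) ^ 2)" by (simp add: S_def Im_divide)
    moreover have "D ^ 2 + (C * T) ^ 2 > 0" using D(1) by (intro add_pos_nonneg) auto
    ultimately show ?thesis using C that by simp
  qed
  have gS: "?g (S T) = Complex x' T" if T: "T > 0" for T
  proof -
    have cz: "of_int c * S T + of_int d = of_int c / (of_real D - \<i> * of_real (C * T))"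
    proof -
      have "complex_of_int c * of_real p = - of_int d" using \<open>c \<noteq> 0\<close> by (simp add: p_def)
      then show ?thesis by (simp add: S_def distrib_left)
    qed
    have "?g (S T) = of_int a / of_int c - 1 / (of_int c * (of_int c * S T + of_int d))"
      by (rule mobius_split[OF det \<open>c \<noteq> 0\<close> mobius_im_pos(1)[OF det ImS[OF T]]])
    also have "1 / (of_int c * (of_int c * S T + of_int d)) = (of_real D - \<i> * of_real (C * T)) / of_real C"
      unfolding cz using \<open>c \<noteq> 0\<close> Dz[of T] by (simp add: C_def power2_eq_square)
    also have "of_int a / of_int c - (of_real D - \<i> * of_real (C * T)) / of_real C = of_real (of_int a / of_int c - D / C) + \<i> * of_real T"
      using C by (simp add: field_simps)
    also have "of_int a / of_int c - D / C = x'"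
    proof -
      have cx: "complex_of_int c * of_real x + of_int d \<noteq> 0"
      proof -
        have "complex_of_int c * of_real x + of_int d = of_real (of_int c * x + of_int d)" by simp
        then show ?thesis using x(2) by (simp only: of_real_eq_0_iff not_False_eq_True)
      qed
      have "complex_of_real x' = of_int a / of_int c - 1 / (of_int c * (of_int c * of_real x + of_int d))"
        unfolding x'_def mobius_real[symmetric] by (rule mobius_split[OF det \<open>c \<noteq> 0\<close> cx])
      also have "\<dots> = of_real (of_int a / of_int c - 1 / (of_int c * (of_int c * x + of_int d)))" by simp
      finally have "x' = of_int a / of_int c - 1 / (of_int c * (of_int c * x + of_int d))" by (simp only: of_real_eq_iff)
      also have "of_int c * (of_int c * x + of_int d) = C * (x - p)"
        using \<open>c \<noteq> 0\<close> by (simp add: C_def p_def power2_eq_square field_simps)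
      finally show ?thesis by (simp add: D_def)
    qed
    finally show ?thesis by (simp add: complex_eq_iff)
  qed
  \<comment> \<open>The derivative of \<gamma> contributes (c\<sigma> + d)^(-2), the theta series
    (c\<sigma> + d)^(3/2) and the root of the difference (c\<sigma> + d)^(1/2): the powers cancel,
    so the primitives agree up to a factor and a constant.\<close>
  obtain k where k: "\<And>\<sigma>. Im \<sigma> > 0 \<Longrightarrow> P' (?g \<sigma>) - \<kappa> / E * P \<sigma> = k"
  proof -
    have "\<exists>k. \<forall>\<sigma>\<in>{\<tau>. Im \<tau> > 0}. P' (?g \<sigma>) - \<kappa> / E * P \<sigma> = k"
    proof (rule has_field_derivative_zero_constant)
      show "convex {\<tau>. Im \<tau> > 0}" by (rule convex_halfspace_Im_gt)
      fix \<sigma> assume "\<sigma> \<in> {\<tau>. Im \<tau> > 0}"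
      then have \<sigma>: "Im \<sigma> > 0" by simp
      define w where "w = of_int c * \<sigma> + of_int d"
      have w: "w \<noteq> 0" unfolding w_def by (rule mobius_im_pos(1)[OF det \<sigma>])
      have detC: "(of_int a * of_int d - of_int b * of_int c :: complex) = 1"
        using det by (metis of_int_1 of_int_diff of_int_mult)
      have "(?g has_field_derivative (of_int a * w - (of_int a * \<sigma> + of_int b) * of_int c) / (w * w)) (at \<sigma>)"
        unfolding w_def using w[unfolded w_def] by (auto intro!: derivative_eq_intros)
      also have "of_int a * w - (of_int a * \<sigma> + of_int b) * of_int c = of_int a * of_int d - of_int b * of_int c"
        by (simp add: w_def algebra_simps)
      finally have dg: "(?g has_field_derivative 1 / (w * w)) (at \<sigma>)" unfolding detC .
      have dP': "((\<lambda>\<sigma>. P' (?g \<sigma>)) has_field_derivative (utheta m 1 f (?g \<sigma>) * (?g \<sigma> - of_real x') powr (- 1 / 2)) * (1 / (w * w))) (at \<sigma>)"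
        by (rule DERIV_chain2[OF primitiveD[OF P' mobius_im_pos(3)[OF det \<sigma>]] dg])
      have dP: "((\<lambda>\<sigma>. \<kappa> / E * P \<sigma>) has_field_derivative \<kappa> / E * (utheta m 1 f \<sigma> * (\<sigma> - of_real x) powr (- 1 / 2))) (at \<sigma>)"
        by (rule DERIV_cmult[OF primitiveD[OF P \<sigma>]])
      have "w powr (3 / 2) = w powr (- 1 / 2 + 2)" by simp
      also have "\<dots> = w powr (- 1 / 2) * w powr 2" by (rule powr_add)
      also have "w powr 2 = w * w" using w powr_nat[of w 2] by (simp add: power2_eq_square)
      finally have w32: "w powr (3 / 2) = w powr (- 1 / 2) * (w * w)" .
      have "(utheta m 1 f (?g \<sigma>) * (?g \<sigma> - of_real x') powr (- 1 / 2)) * (1 / (w * w)) =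
          \<kappa> * utheta m 1 f \<sigma> * ((?g \<sigma> - of_real x') powr (- 1 / 2) * w powr (- 1 / 2))"
        unfolding \<kappa>[OF \<sigma>] unfolding w_def[symmetric] w32 using w by simp
      also have "(?g \<sigma> - of_real x') powr (- 1 / 2) * w powr (- 1 / 2) = (\<sigma> - of_real x) powr (- 1 / 2) / E"
        using E[OF \<sigma>] \<open>E \<noteq> 0\<close> unfolding x'_def w_def[symmetric] by (simp add: field_simps)
      finally have "(utheta m 1 f (?g \<sigma>) * (?g \<sigma> - of_real x') powr (- 1 / 2)) * (1 / (w * w)) =
          \<kappa> / E * (utheta m 1 f \<sigma> * (\<sigma> - of_real x) powr (- 1 / 2))"
        by simp
      with DERIV_diff[OF dP' dP] have "((\<lambda>\<sigma>. P' (?g \<sigma>) - \<kappa> / E * P \<sigma>) has_field_derivative 0) (at \<sigma>)"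
        by (simp only: diff_self)
      then show "((\<lambda>\<sigma>. P' (?g \<sigma>) - \<kappa> / E * P \<sigma>) has_field_derivative 0) (at \<sigma> within {\<tau>. Im \<tau> > 0})"
        by (rule has_field_derivative_at_within)
    qed
    then show ?thesis using that by blast
  qed
  define T where "T n = real (Suc n)" for n
  have T: "T n > 0" for n by (simp add: T_def)
  have Tinf: "filterlim T at_top sequentially"
    unfolding T_def by (rule filterlim_compose[OF filterlim_real_sequentially filterlim_Suc])
  have Tinv: "(\<lambda>n. 1 / T n) \<longlonglongrightarrow> 0"
    by (intro tendsto_divide_0[OF tendsto_const] filterlim_at_top_imp_at_infinity Tinf)
  \<comment> \<open>Heights at which the vertical lines at p and at x are cut off: for large T, to
    first order S(T) is p + i/(CT) and S(1/T) is x + iC/(D^2 T).\<close>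
  define v where "v n = 1 / (C * T n)" for n
  define v' where "v' n = C / (D ^ 2 * T n)" for n
  have v: "v n > 0" "v \<longlonglongrightarrow> 0" for n
    using C T[of n] tendsto_mult_left[OF Tinv, of "1 / C"] by (simp_all add: v_def[abs_def])
  have v': "v' n > 0" "v' \<longlonglongrightarrow> 0" for n
    using C T[of n] D(1) tendsto_mult_left[OF Tinv, of "C / D ^ 2"] by (simp_all add: v'_def[abs_def])
  have S1: "S (T n) = of_real p + \<i> * of_real (v n) / (1 + \<i> * of_real (D * v n))" for n
  proof -
    have "of_real D - \<i> * of_real (C * T n) = (1 + \<i> * of_real (D * v n)) * (- \<i> * of_real (C * T n))"
      using C T[of n] by (simp add: v_def field_simps)
    moreover have "\<i> * of_real (v n) = 1 / (- \<i> * of_real (C * T n))"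
      using C T[of n] by (simp add: v_def field_simps)
    ultimately show ?thesis by (simp add: S_def)
  qed
  have S2: "S (1 / T n) = of_real x + \<i> * of_real (v' n) / (1 + \<i> * of_real ((- D) * v' n))" for n
  proof -
    have "of_real D - \<i> * of_real (C * (1 / T n)) = of_real D * (1 + \<i> * of_real ((- D) * v' n))"
      using D(1) T[of n] by (simp add: v'_def power2_eq_square field_simps)
    then have nz: "1 + \<i> * of_real ((- D) * v' n) \<noteq> 0" using Dz[of "1 / T n"] by auto
    have "1 / (of_real D * (1 + \<i> * of_real ((- D) * v' n))) = of_real (1 / D) + \<i> * of_real (v' n) / (1 + \<i> * of_real ((- D) * v' n))"
      using nz D(1) by (simp add: field_simps)
    then show ?thesis
      unfolding S_def \<open>of_real D - \<i> * of_real (C * (1 / T n)) = of_real D * (1 + \<i> * of_real ((- D) * v' n))\<close> D(2) by simp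
  qed
  have l1: "(\<lambda>n. P (Complex x (T n)) - P (Complex x (v' n))) \<longlonglongrightarrow> cusp_int m f x x"
    by (rule primitive_vertical_limit[OF P x(1) v' Tinf])
  have l2: "(\<lambda>n. P (Complex p (T n)) - P (Complex p (v n))) \<longlonglongrightarrow> cusp_int m f p x"
    by (rule primitive_vertical_limit[OF P p v Tinf])
  have l3: "(\<lambda>n. P (S (T n)) - P (S (1 / T n))) \<longlonglongrightarrow> E / \<kappa> * cusp_int m f x' x'"
  proof -
    have "(\<lambda>n. E / \<kappa> * (P' (Complex x' (T n)) - P' (Complex x' (1 / T n)))) \<longlonglongrightarrow> E / \<kappa> * cusp_int m f x' x'"
      by (intro tendsto_mult_left primitive_vertical_limit[OF P' x' _ Tinv Tinf]) (simp add: T)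
    moreover have "E / \<kappa> * (P' (Complex x' (T n)) - P' (Complex x' (1 / T n))) = P (S (T n)) - P (S (1 / T n))" for n
    proof -
      have "1 / T n > 0" using T[of n] by simp
      have "P' (Complex x' (T n)) = k + \<kappa> / E * P (S (T n))"
        using k[OF ImS[OF T[of n]]] unfolding gS[OF T] by (simp add: algebra_simps)
      moreover have "P' (Complex x' (1 / T n)) = k + \<kappa> / E * P (S (1 / T n))"
        using k[OF ImS[OF \<open>1 / T n > 0\<close>]] unfolding gS[OF \<open>1 / T n > 0\<close>] by (simp add: algebra_simps)
      ultimately show ?thesis using \<open>\<kappa> \<noteq> 0\<close> \<open>E \<noteq> 0\<close> by (simp add: field_simps)
    qed
    ultimately show ?thesis by simp
  qed
  have l4: "(\<lambda>n. P (S (T n)) - P (Complex p (v n))) \<longlonglongrightarrow> 0"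
    unfolding S1 by (rule primitive_near_cusp[OF P p v])
  have l5: "(\<lambda>n. P (S (1 / T n)) - P (Complex x (v' n))) \<longlonglongrightarrow> 0"
    unfolding S2 by (rule primitive_near_cusp[OF P x(1) v'])
  have l6: "(\<lambda>n. P (Complex x (T n)) - P (Complex p (T n))) \<longlonglongrightarrow> 0"
    by (rule primitive_near_infinity[OF P p Tinf])
  \<comment> \<open>Regrouping the three path integrals gives one difference for each corner of the
    triangle, and each of these tends to 0.\<close>
  define X where "X n = (P (Complex x (T n)) - P (Complex x (v' n))) - (P (S (T n)) - P (S (1 / T n))) - (P (Complex p (T n)) - P (Complex p (v n)))" for n
  have "X \<longlonglongrightarrow> cusp_int m f x x - E / \<kappa> * cusp_int m f x' x' - cusp_int m f p x"
    unfolding X_def by (intro tendsto_diff l1 l2 l3)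
  moreover have "X \<longlonglongrightarrow> 0 + 0 - 0"
  proof -
    have "X = (\<lambda>n. (P (Complex x (T n)) - P (Complex p (T n))) + (P (S (1 / T n)) - P (Complex x (v' n))) - (P (S (T n)) - P (Complex p (v n))))"
      by (rule ext) (simp add: X_def)
    then show ?thesis by (simp only:) (intro tendsto_diff tendsto_add l4 l5 l6)
  qed
  ultimately have "cusp_int m f x x - E / \<kappa> * cusp_int m f x' x' - cusp_int m f p x = 0 + 0 - 0"
    by (rule LIMSEQ_unique)
  then show ?thesis by (simp add: p_def)
qed

end

section \<open>Smoothness of the error of modularity\<close>

text \<open>Allows differentiation under an integral sign by integrating a bound for the Taylor
  remainder.\<close>

lemma has_vector_derivative_if_quadratic_bound:
  fixes h :: "real \<Rightarrow> 'a :: real_normed_vector"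
  assumes "\<And>y. norm (h y - h x - (y - x) *\<^sub>R h') \<le> M * (y - x) ^ 2"
  shows "(h has_vector_derivative h') (at x)"
  unfolding has_vector_derivative_def
proof (rule has_derivativeI_sandwich[of 1 _ _ x])
  show "bounded_linear (\<lambda>x. x *\<^sub>R h')" by (rule bounded_linear_scaleR_left)
  show "((\<lambda>y. M * \<bar>y - x\<bar>) \<longlongrightarrow> 0) (at x)"
  proof -
    have "((\<lambda>y. M * \<bar>y - x\<bar>) \<longlongrightarrow> M * \<bar>x - x\<bar>) (at x)" by (intro tendsto_intros)
    then show ?thesis by simp
  qed
  fix y assume "y \<noteq> x"
  then show "norm (h y - h x - (y - x) *\<^sub>R h') / norm (y - x) \<le> M * \<bar>y - x\<bar>"
    using assms[of y] by (simp add: divide_le_eq power2_eq_square mult.assoc abs_mult_self_eq)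
qed simp

text \<open>Consecutive coefficients have ratio (1/2 + k)/(k + 1) in absolute value.\<close>

lemma norm_gbinomial_neg_half: "norm ((- 1 / 2 :: complex) gchoose k) \<le> 1"
proof (induction k)
  case (Suc k)
  have "(- 1 / 2 :: complex) gchoose (Suc k) = ((- 1 / 2) gchoose k) * ((- 1 / 2 - of_nat k) / of_nat (Suc k))"
    by (simp add: gbinomial_prod_rev)
  moreover have "norm ((- 1 / 2 - of_nat k) / of_nat (Suc k) :: complex) \<le> 1"
  proof -
    have "(- 1 / 2 - of_nat k :: complex) = - of_real (1 / 2 + real k)" by simp
    then have "norm (- 1 / 2 - of_nat k :: complex) = 1 / 2 + real k"
      by (simp only: norm_minus_cancel norm_of_real; simp)
    then show ?thesis by (simp only: norm_divide norm_of_nat; simp add: field_simps)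
  qed
  ultimately show ?case using Suc by (simp only: norm_mult) (intro mult_le_one, auto)
qed simp

text \<open>Both arguments lie in (0,pi), so their difference is a principal argument.\<close>

lemma powr_quotient_upper:
  fixes w z :: complex
  assumes "Im w > 0" "Im z > 0"
  shows "(z / w) powr s = z powr s / w powr s"
proof -
  have nz: "w \<noteq> 0" "z \<noteq> 0" using assms by auto
  have "Ln (1 / w) = - Ln w"
    using Ln_inverse[OF Im_pos_not_nonpos_Reals[OF assms(1)]] by (simp add: inverse_eq_divide)
  moreover have "0 < Im (Ln w)" "Im (Ln w) < pi" "0 < Im (Ln z)" "Im (Ln z) < pi"
    using Im_Ln_pos_lt[OF nz(1)] Im_Ln_pos_lt[OF nz(2)] Im_Ln_pos_lt_imp[of w] Im_Ln_pos_lt_imp[of z] assms nz by auto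
  ultimately have "Ln (z * (1 / w)) = Ln z + Ln (1 / w)"
    using nz by (intro Ln_times_simple) auto
  then have "Ln (z / w) = Ln z - Ln w"
    using \<open>Ln (1 / w) = - Ln w\<close> by simp
  then show ?thesis using nz by (simp add: powr_def right_diff_distrib exp_diff)
qed

lemma norm_Complex_powr_neg_le:
  assumes "t > 0"
  shows "norm (Complex u t powr (- 1 / 2 - of_nat n)) \<le> t powr (- 1 / 2) / t ^ n"
proof -
  have e: "(- 1 / 2 - of_nat n :: complex) = of_real (- 1 / 2 - real n)" by simp
  have "norm (Complex u t powr (- 1 / 2 - of_nat n)) = norm (Complex u t) powr (- 1 / 2 - real n)"
    unfolding e by (simp only: norm_powr_real_powr' Reals_of_real Re_complex_of_real)
  also have "\<dots> \<le> t powr (- 1 / 2 - real n)"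
    using assms abs_Im_le_cmod[of "Complex u t"] by (intro powr_mono2') auto
  also have "\<dots> = t powr (- 1 / 2) / t ^ n"
    using assms by (simp add: powr_diff powr_realpow)
  finally show ?thesis .
qed

section \<open>Derivatives and power series of the cusp integral\<close>

context periodic_theta
begin

text \<open>The n-th derivative in x of (\<sigma> - x)^(-1/2) at \<sigma> = p + it, including the i
  of d\<sigma>. The inner derivative -1 cancels the sign of the exponent, hence the rising
  factorial.\<close>

definition cusp_kernel :: "real \<Rightarrow> nat \<Rightarrow> real \<Rightarrow> real \<Rightarrow> complex" where
  "cusp_kernel p n t x = pochhammer (1 / 2) n * Complex (p - x) t powr (- 1 / 2 - of_nat n) * \<i>"

lemma norm_cusp_kernel_le:
  assumes "t > 0"
  shows "norm (cusp_kernel p n t x) \<le> norm (pochhammer (1 / 2 :: complex) n) * (t powr (- 1 / 2) / t ^ n)"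
  unfolding cusp_kernel_def norm_mult norm_ii mult_1_right
  by (intro mult_left_mono norm_Complex_powr_neg_le assms norm_ge_zero)

text \<open>The mean value inequality is applied twice on the real segment, to the kernel with x
  replaced by a complex variable. The constant bounds the derivative of order n + 2 uniformly in
  x.\<close>

lemma cusp_kernel_taylor:
  assumes t: "t > 0"
  shows "norm (cusp_kernel p n t y - cusp_kernel p n t x - of_real (y - x) * cusp_kernel p (Suc n) t x) \<le>
    norm (pochhammer (1 / 2 :: complex) (Suc (Suc n))) * (t powr (- 1 / 2) / t ^ Suc (Suc n)) * (y - x) ^ 2"
proof -
  define M where "M = norm (pochhammer (1 / 2 :: complex) (Suc (Suc n))) * (t powr (- 1 / 2) / t ^ Suc (Suc n))"
  define \<Phi> where "\<Phi> n z = pochhammer (1 / 2) n * (of_real p - z + \<i> * of_real t) powr (- 1 / 2 - of_nat n) * \<i>" for n z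
  have \<Phi>: "\<Phi> n (of_real x) = cusp_kernel p n t x" for n x
  proof -
    have "of_real p - of_real x + \<i> * of_real t = Complex (p - x) t" by (simp add: complex_eq_iff)
    then show ?thesis by (simp add: \<Phi>_def cusp_kernel_def)
  qed
  have der: "(\<Phi> n has_field_derivative \<Phi> (Suc n) z) (at z)" if "Im z = 0" for n z
  proof -
    have "of_real p - z + \<i> * of_real t \<notin> \<real>\<^sub>\<le>\<^sub>0"
      by (rule Im_pos_not_nonpos_Reals) (use that t in simp)
    then have "(\<Phi> n has_field_derivative pochhammer (1 / 2) n * ((- 1 / 2 - of_nat n) * (of_real p - z + \<i> * of_real t) powr (- 1 / 2 - of_nat n - 1) * (- 1)) * \<i>) (at z)"
      unfolding \<Phi>_def by (auto intro!: derivative_eq_intros)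
    moreover have "pochhammer (1 / 2) n * ((- 1 / 2 - of_nat n) * (of_real p - z + \<i> * of_real t) powr (- 1 / 2 - of_nat n - 1) * (- 1)) * \<i> = \<Phi> (Suc n) z"
    proof -
      have "(- 1 / 2 - of_nat n - 1 :: complex) = - 1 / 2 - of_nat (Suc n)" by simp
      then show ?thesis unfolding \<Phi>_def pochhammer_Suc by (simp only:) (simp add: algebra_simps)
    qed
    ultimately show ?thesis by simp
  qed
  have real_seg: "z = of_real (Re z)" "Re z \<in> closed_segment x y" if "z \<in> closed_segment (of_real x) (of_real y)" for x y z
    using that by (auto simp: closed_segment_of_real complex_eq_iff)
  have first: "norm (\<Phi> (Suc n) (of_real x') - \<Phi> (Suc n) (of_real x)) \<le> M * \<bar>x' - x\<bar>" for x'
  proof -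
    have "norm (\<Phi> (Suc n) (of_real x') - \<Phi> (Suc n) (of_real x)) \<le> M * norm (complex_of_real x' - of_real x)"
    proof (rule field_differentiable_bound[of "closed_segment (of_real x') (of_real x)"])
      fix z assume z: "z \<in> closed_segment (complex_of_real x') (of_real x)"
      have "Im z = 0" using real_seg(1)[OF z] by (metis Im_complex_of_real)
      then show "(\<Phi> (Suc n) has_field_derivative \<Phi> (Suc (Suc n)) z) (at z within closed_segment (of_real x') (of_real x))"
        by (rule has_field_derivative_at_within[OF der])
      have "norm (cusp_kernel p (Suc (Suc n)) t (Re z)) \<le> M"
        unfolding M_def by (rule norm_cusp_kernel_le[OF t])
      then show "norm (\<Phi> (Suc (Suc n)) z) \<le> M" using real_seg(1)[OF z] \<Phi> by metis
    qed auto
    then show ?thesis by (simp flip: of_real_diff)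
  qed
  have "norm ((\<Phi> n (of_real y) - of_real y * \<Phi> (Suc n) (of_real x)) - (\<Phi> n (of_real x) - of_real x * \<Phi> (Suc n) (of_real x)))
      \<le> (M * \<bar>y - x\<bar>) * norm (complex_of_real y - of_real x)"
  proof (rule field_differentiable_bound[of "closed_segment (of_real y) (of_real x)" "\<lambda>z. \<Phi> n z - z * \<Phi> (Suc n) (of_real x)" "\<lambda>z. \<Phi> (Suc n) z - \<Phi> (Suc n) (of_real x)"])
    fix z assume z: "z \<in> closed_segment (complex_of_real y) (of_real x)"
    have "Im z = 0" using real_seg(1)[OF z] by (metis Im_complex_of_real)
    have "((\<lambda>z. \<Phi> n z - z * \<Phi> (Suc n) (of_real x)) has_field_derivative \<Phi> (Suc n) z - \<Phi> (Suc n) (of_real x)) (at z)"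
      using der[OF \<open>Im z = 0\<close>] by (auto intro!: derivative_eq_intros)
    then show "((\<lambda>z. \<Phi> n z - z * \<Phi> (Suc n) (of_real x)) has_field_derivative \<Phi> (Suc n) z - \<Phi> (Suc n) (of_real x)) (at z within closed_segment (of_real y) (of_real x))"
      by (rule has_field_derivative_at_within)
    have "norm (\<Phi> (Suc n) z - \<Phi> (Suc n) (of_real x)) \<le> M * \<bar>Re z - x\<bar>"
      using first[of "Re z"] real_seg(1)[OF z] by metis
    also have "\<dots> \<le> M * \<bar>y - x\<bar>"
      using real_seg(2)[OF z] t by (intro mult_left_mono) (auto simp: M_def closed_segment_eq_real_ivl split: if_splits)
    finally show "norm (\<Phi> (Suc n) z - \<Phi> (Suc n) (of_real x)) \<le> M * \<bar>y - x\<bar>" .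
  qed auto
  also have "norm (complex_of_real y - of_real x) = \<bar>y - x\<bar>" by (simp flip: of_real_diff)
  also have "M * \<bar>y - x\<bar> * \<bar>y - x\<bar> = M * (y - x) ^ 2" by (simp add: power2_eq_square mult.assoc)
  finally show ?thesis
    unfolding \<Phi> M_def by (simp add: algebra_simps)
qed

lemma cusp_kernel_integrable:
  assumes "p \<in> \<rat>"
  shows "set_integrable lborel {0<..} (\<lambda>t. utheta m 1 f (Complex p t) * cusp_kernel p n t x)"
proof -
  obtain \<delta> where \<delta>: "\<delta> > 0" "\<And>N. \<exists>C\<ge>0. \<forall>t>0. norm (utheta m 1 f (Complex p t)) \<le> C * (t ^ N * exp (- \<delta> * t))"
    by (rule vertical_bound[OF assms]) (rule that)
  obtain C where C: "C \<ge> 0" "\<And>t. t > 0 \<Longrightarrow> norm (utheta m 1 f (Complex p t)) \<le> C * (t ^ n * exp (- \<delta> * t))"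
    using \<delta>(2)[of n] by blast
  show ?thesis
  proof (rule set_integrable_gamma_bound[OF _ \<delta>(1)])
    show "continuous_on {0<..} (\<lambda>t. utheta m 1 f (Complex p t) * cusp_kernel p n t x)"
      unfolding cusp_kernel_def
      using continuous_vertical[of 0 p] by (intro continuous_on_mult continuous_vertical_powr continuous_on_const) simp
    fix t :: real assume t: "t > 0"
    have "norm (utheta m 1 f (Complex p t) * cusp_kernel p n t x) \<le> (C * (t ^ n * exp (- \<delta> * t))) * (norm (pochhammer (1 / 2 :: complex) n) * (t powr (- 1 / 2) / t ^ n))"
      unfolding norm_mult using C(1) t by (intro mult_mono C(2) norm_cusp_kernel_le) auto
    also have "\<dots> = (C * norm (pochhammer (1 / 2 :: complex) n)) * (t powr (- 1 / 2) * exp (- \<delta> * t))"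
      using t by simp
    finally show "norm (utheta m 1 f (Complex p t) * cusp_kernel p n t x) \<le> (C * norm (pochhammer (1 / 2 :: complex) n)) * (t powr (- 1 / 2) * exp (- \<delta> * t))" .
  qed
qed

text \<open>Near t = 0 the Taylor remainder may grow like t^(-n - 5/2); decay of order n + 2 of the
  theta series at the rational cusp p reduces this to t^(-1/2). The bounds are uniform in x, so they
  include the cusp x = p itself.\<close>

lemma cusp_int_smooth:
  assumes p: "p \<in> \<rat>"
  shows "smooth_R (cusp_int m f p)"
proof -
  define D where "D n x = (LINT t:{0<..}|lborel. utheta m 1 f (Complex p t) * cusp_kernel p n t x)" for n x
  have "D 0 = cusp_int m f p"
    by (rule ext) (simp add: D_def cusp_int_def cusp_kernel_def)
  moreover have "(D n has_vector_derivative D (Suc n) x) (at x)" for n x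
  proof -
    let ?u = "\<lambda>t. utheta m 1 f (Complex p t)"
    obtain \<delta> where \<delta>: "\<delta> > 0" "\<And>N. \<exists>C\<ge>0. \<forall>t>0. norm (?u t) \<le> C * (t ^ N * exp (- \<delta> * t))"
      by (rule vertical_bound[OF p]) (rule that)
    obtain C where C: "C \<ge> 0" "\<And>t. t > 0 \<Longrightarrow> norm (?u t) \<le> C * (t ^ Suc (Suc n) * exp (- \<delta> * t))"
      using \<delta>(2)[of "Suc (Suc n)"] by blast
    define K where "K = norm (pochhammer (1 / 2 :: complex) (Suc (Suc n)))"
    show ?thesis
    proof (rule has_vector_derivative_if_quadratic_bound)
      fix y
      let ?r = "\<lambda>t. ?u t * cusp_kernel p n t y - ?u t * cusp_kernel p n t x - of_real (y - x) * (?u t * cusp_kernel p (Suc n) t x)"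
      note int_y = cusp_kernel_integrable[OF p, of n y] and int_x = cusp_kernel_integrable[OF p, of n x]
      note int_x' = set_integrable_mult_right[OF cusp_kernel_integrable[OF p, of "Suc n" x], of "of_real (y - x)"]
      have int: "set_integrable lborel {0<..} ?r"
        by (rule set_integral_diff(1)[OF set_integral_diff(1)[OF int_y int_x] int_x'])
      have "(LINT t:{0<..}|lborel. ?r t) = (LINT t:{0<..}|lborel. ?u t * cusp_kernel p n t y - ?u t * cusp_kernel p n t x) -
          (LINT t:{0<..}|lborel. of_real (y - x) * (?u t * cusp_kernel p (Suc n) t x))"
        by (rule set_integral_diff(2)[OF set_integral_diff(1)[OF int_y int_x] int_x'])
      also have "(LINT t:{0<..}|lborel. ?u t * cusp_kernel p n t y - ?u t * cusp_kernel p n t x) = D n y - D n x"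
        unfolding D_def by (rule set_integral_diff(2)[OF int_y int_x])
      also have "(LINT t:{0<..}|lborel. of_real (y - x) * (?u t * cusp_kernel p (Suc n) t x)) = (y - x) *\<^sub>R D (Suc n) x"
        unfolding D_def scaleR_conv_of_real by (rule set_integral_mult_right)
      finally have eq: "(LINT t:{0<..}|lborel. ?r t) = D n y - D n x - (y - x) *\<^sub>R D (Suc n) x" .
      have "norm (LINT t:{0<..}|lborel. ?r t) \<le> (LINT t|lborel. (C * K * (y - x) ^ 2) * (indicator {0<..} t * (t powr (- 1 / 2) * exp (- \<delta> * t))))"
        unfolding set_lebesgue_integral_def
      proof (rule Bochner_Integration.integral_norm_bound_integral)
        show "integrable lborel (\<lambda>t. indicator {0<..} t *\<^sub>R ?r t)" using int by (simp only: set_integrable_def)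
        show "integrable lborel (\<lambda>t. (C * K * (y - x) ^ 2) * (indicator {0<..} t * (t powr (- 1 / 2) * exp (- \<delta> * t))))"
          using gamma_half_integral[OF \<delta>(1)] by (intro integrable_mult_right) (auto simp: has_bochner_integral_iff)
        fix t :: real
        show "norm (indicator {0<..} t *\<^sub>R ?r t) \<le> (C * K * (y - x) ^ 2) * (indicator {0<..} t * (t powr (- 1 / 2) * exp (- \<delta> * t)))"
        proof (cases "t > 0")
          case True
          have "?r t = ?u t * (cusp_kernel p n t y - cusp_kernel p n t x - of_real (y - x) * cusp_kernel p (Suc n) t x)"
            by (simp add: algebra_simps)
          then have "norm (?r t) \<le> (C * (t ^ Suc (Suc n) * exp (- \<delta> * t))) * (K * (t powr (- 1 / 2) / t ^ Suc (Suc n)) * (y - x) ^ 2)"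
            unfolding K_def using C(1) True by (simp only: norm_mult) (intro mult_mono C(2) cusp_kernel_taylor, auto)
          also have "\<dots> = (C * K * (y - x) ^ 2) * (t powr (- 1 / 2) * exp (- \<delta> * t))"
            using True by simp
          finally show ?thesis using True by simp
        qed simp
      qed
      also have "\<dots> = (C * K * sqrt (pi / \<delta>)) * (y - x) ^ 2"
        using has_bochner_integral_integral_eq[OF gamma_half_integral[OF \<delta>(1)]] by simp
      finally show "norm (D n y - D n x - (y - x) *\<^sub>R D (Suc n) x) \<le> (C * K * sqrt (pi / \<delta>)) * (y - x) ^ 2"
        unfolding eq .
    qed
  qed
  ultimately show ?thesis
    unfolding smooth_R_def by (intro exI[of _ D] conjI allI)
qed

text \<open>Expand (w - h)^(-1/2) by the binomial series in h/w with w = p - x + it. Since |w| >= |p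
  - x| for all t, a geometric series dominates it for |h| < |p - x|, a radius that shrinks to 0 at
  the cusp.\<close>

lemma cusp_int_analytic:
  assumes p: "p \<in> \<rat>" and "x \<noteq> p"
  shows "real_analytic_at (cusp_int m f p) x"
proof -
  define \<rho> where "\<rho> = \<bar>p - x\<bar>"
  have \<rho>: "\<rho> > 0" using assms by (simp add: \<rho>_def)
  let ?u = "\<lambda>t. utheta m 1 f (Complex p t)"
  define w where "w t = Complex (p - x) t" for t
  have w: "norm (w t) \<ge> \<rho>" for t
    using abs_Re_le_cmod[of "w t"] by (simp add: w_def \<rho>_def)
  have w0: "w t \<noteq> 0" for t using w[of t] \<rho> by auto
  obtain \<delta> where \<delta>: "\<delta> > 0" "\<And>N. \<exists>C\<ge>0. \<forall>t>0. norm (?u t) \<le> C * (t ^ N * exp (- \<delta> * t))"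
    by (rule vertical_bound[OF p]) (rule that)
  obtain C where C: "C \<ge> 0" "\<And>t. t > 0 \<Longrightarrow> norm (?u t) \<le> C * (t ^ 0 * exp (- \<delta> * t))"
    using \<delta>(2)[of 0] by blast
  define G where "G h k t = ?u t * (w t powr (- 1 / 2) * \<i>) * (((- 1 / 2) gchoose k) * (- of_real h / w t) ^ k)" for h k t
  have Gle: "norm (G h k t) \<le> (\<bar>h\<bar> / \<rho>) ^ k * (C * (t powr (- 1 / 2) * exp (- \<delta> * t)))" if t: "t > 0" for h k t
  proof -
    have "norm (- of_real h / w t) \<le> \<bar>h\<bar> / \<rho>"
      using w[of t] \<rho> by (simp add: norm_divide frac_le)
    then have "norm ((- of_real h / w t) ^ k) \<le> (\<bar>h\<bar> / \<rho>) ^ k"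
      unfolding norm_power by (rule power_mono) simp
    then have "norm (((- 1 / 2) gchoose k) * (- of_real h / w t) ^ k) \<le> 1 * (\<bar>h\<bar> / \<rho>) ^ k"
      unfolding norm_mult by (intro mult_mono norm_gbinomial_neg_half) auto
    moreover have "norm (?u t * (w t powr (- 1 / 2) * \<i>)) \<le> (C * (t ^ 0 * exp (- \<delta> * t))) * t powr (- 1 / 2)"
      unfolding norm_mult w_def using C(1) norm_Complex_powr_le[OF t, of "p - x"] by (intro mult_mono C(2) t) auto
    ultimately have "norm (G h k t) \<le> ((C * (t ^ 0 * exp (- \<delta> * t))) * t powr (- 1 / 2)) * (1 * (\<bar>h\<bar> / \<rho>) ^ k)"
      unfolding G_def norm_mult[of "?u t * (w t powr (- 1 / 2) * \<i>)"] using C(1) by (intro mult_mono) auto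
    then show ?thesis by (simp add: mult_ac)
  qed
  have contG: "continuous_on {0<..} (G h k)" for h k
  proof -
    have "(\<lambda>t. w t) = (\<lambda>t. of_real (p - x) + \<i> * of_real t)" by (auto simp: w_def complex_eq_iff)
    then have "continuous_on {0<..} w" by (auto intro!: continuous_intros)
    moreover have "continuous_on {0<..} (\<lambda>t. w t powr (- 1 / 2))" unfolding w_def by (rule continuous_vertical_powr)
    ultimately show ?thesis
      unfolding G_def using continuous_vertical[of 0 p] w0
      by (intro continuous_on_mult continuous_on_power continuous_on_divide continuous_on_const) auto
  qed
  have intG: "set_integrable lborel {0<..} (G h k)" for h k
    by (rule set_integrable_gamma_bound[OF contG \<delta>(1), of _ _ "(\<bar>h\<bar> / \<rho>) ^ k * C"]) (use Gle in \<open>simp add: mult.assoc\<close>)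
  \<comment> \<open>\<open>G\<close> is homogeneous of degree k in h, so the coefficients are read
    off at h = 1.\<close>
  define s where "s k = (LINT t:{0<..}|lborel. G 1 k t)" for k
  have "(\<lambda>k. s k * of_real (h ^ k)) sums cusp_int m f p (x + h)" if h: "\<bar>h\<bar> < \<rho>" for h
  proof -
    have ratio: "0 \<le> \<bar>h\<bar> / \<rho>" "\<bar>h\<bar> / \<rho> < 1" using h \<rho> by auto
    define I where "I = (LINT t|lborel. indicator {0<..} t * (t powr (- 1 / 2) * exp (- \<delta> * t)) :: real)"
    have bd: "norm (indicator {0<..} t *\<^sub>R G h k t) \<le> (\<bar>h\<bar> / \<rho>) ^ k * (C * (indicator {0<..} t * (t powr (- 1 / 2) * exp (- \<delta> * t))))" for k t
      using Gle[of t h k] by (cases "t > 0") auto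
    have "(\<lambda>k. LINT t|lborel. indicator {0<..} t *\<^sub>R G h k t) sums (LINT t|lborel. (\<Sum>k. indicator {0<..} t *\<^sub>R G h k t))"
    proof (rule sums_integral)
      show "integrable lborel (\<lambda>t. indicator {0<..} t *\<^sub>R G h k t)" for k
        using intG by (simp only: set_integrable_def)
      show "AE t in lborel. summable (\<lambda>k. norm (indicator {0<..} t *\<^sub>R G h k t))"
      proof (rule AE_I2)
        fix t :: real
        show "summable (\<lambda>k. norm (indicator {0<..} t *\<^sub>R G h k t))"
        proof (rule summable_comparison_test')
          show "summable (\<lambda>k. (\<bar>h\<bar> / \<rho>) ^ k * (C * (indicator {0<..} t * (t powr (- 1 / 2) * exp (- \<delta> * t)))))"
            using ratio by (intro summable_mult2 summable_geometric) auto
          show "norm (norm (indicator {0<..} t *\<^sub>R G h k t)) \<le> (\<bar>h\<bar> / \<rho>) ^ k * (C * (indicator {0<..} t * (t powr (- 1 / 2) * exp (- \<delta> * t))))" for k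
            using bd[of t k] by (simp only: real_norm_def abs_norm_cancel)
        qed
      qed
      show "summable (\<lambda>k. LINT t|lborel. norm (indicator {0<..} t *\<^sub>R G h k t))"
      proof (rule summable_comparison_test')
        show "summable (\<lambda>k. (\<bar>h\<bar> / \<rho>) ^ k * (C * I))"
          using ratio by (intro summable_mult2 summable_geometric) auto
        fix k
        have "(LINT t|lborel. norm (indicator {0<..} t *\<^sub>R G h k t)) \<le> (LINT t|lborel. (\<bar>h\<bar> / \<rho>) ^ k * (C * (indicator {0<..} t * (t powr (- 1 / 2) * exp (- \<delta> * t)))))"
        proof (rule integral_mono)
          show "integrable lborel (\<lambda>t. norm (indicator {0<..} t *\<^sub>R G h k t))"
            using intG unfolding set_integrable_def by (rule integrable_norm)
          show "integrable lborel (\<lambda>t. (\<bar>h\<bar> / \<rho>) ^ k * (C * (indicator {0<..} t * (t powr (- 1 / 2) * exp (- \<delta> * t)))))"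
            using gamma_half_integral[OF \<delta>(1)] by (intro integrable_mult_right) (auto simp: has_bochner_integral_iff)
        qed (rule bd)
        then show "norm (LINT t|lborel. norm (indicator {0<..} t *\<^sub>R G h k t)) \<le> (\<bar>h\<bar> / \<rho>) ^ k * (C * I)"
          by (simp add: I_def)
      qed
    qed
    moreover have "(\<Sum>k. indicator {0<..} t *\<^sub>R G h k t) = indicator {0<..} t *\<^sub>R (?u t * (Complex (p - (x + h)) t powr (- 1 / 2) * \<i>))" for t :: real
    proof (cases "t > 0")
      case True
      have "norm (- of_real h / w t) < 1"
      proof -
        have "\<bar>h\<bar> < norm (w t)" using h w[of t] by simp
        then show ?thesis using w0[of t] by (simp add: norm_divide)
      qed
      then have "(\<lambda>k. ((- 1 / 2) gchoose k) * (- of_real h / w t) ^ k) sums (1 + (- of_real h / w t)) powr (- 1 / 2)"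
        by (rule gen_binomial_complex)
      moreover have "1 + (- of_real h / w t) = Complex (p - (x + h)) t / w t"
      proof -
        have "Complex (p - (x + h)) t = w t - of_real h" by (simp add: w_def complex_eq_iff)
        then show ?thesis using w0[of t] by (simp add: diff_divide_distrib)
      qed
      moreover have "(Complex (p - (x + h)) t / w t) powr (- 1 / 2) = Complex (p - (x + h)) t powr (- 1 / 2) / w t powr (- 1 / 2)"
        using True by (intro powr_quotient_upper) (auto simp: w_def)
      ultimately have "(\<lambda>k. ((- 1 / 2) gchoose k) * (- of_real h / w t) ^ k) sums (Complex (p - (x + h)) t powr (- 1 / 2) / w t powr (- 1 / 2))"
        by (simp only:)
      from sums_mult[OF this, of "?u t * (w t powr (- 1 / 2) * \<i>)"]
      have "(\<lambda>k. G h k t) sums (?u t * (w t powr (- 1 / 2) * \<i>) * (Complex (p - (x + h)) t powr (- 1 / 2) / w t powr (- 1 / 2)))"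
        unfolding G_def .
      also have "?u t * (w t powr (- 1 / 2) * \<i>) * (Complex (p - (x + h)) t powr (- 1 / 2) / w t powr (- 1 / 2)) =
          ?u t * (Complex (p - (x + h)) t powr (- 1 / 2) * \<i>)"
        using w0[of t] by simp
      finally have "(\<lambda>k. G h k t) sums (?u t * (Complex (p - (x + h)) t powr (- 1 / 2) * \<i>))" .
      then show ?thesis using True by (simp add: sums_iff)
    qed simp
    moreover have "(LINT t|lborel. indicator {0<..} t *\<^sub>R G h k t) = s k * of_real (h ^ k)" for k
    proof -
      have "G h k t = G 1 k t * of_real (h ^ k)" for t
      proof -
        have "(- of_real h / w t) ^ k = (- of_real 1 / w t) ^ k * of_real (h ^ k)"
          unfolding of_real_power power_mult_distrib[symmetric] by simp
        then show ?thesis by (simp only: G_def mult.assoc)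
      qed
      then show ?thesis
        unfolding s_def set_lebesgue_integral_def[symmetric] by (simp only: set_integral_mult_left)
    qed
    ultimately show ?thesis
      unfolding cusp_int_def set_lebesgue_integral_def by simp
  qed
  note series = this
  show ?thesis
    unfolding real_analytic_at_def
  proof (intro exI[of _ \<rho>] exI[of _ s] conjI allI impI \<rho>)
    fix t assume "\<bar>t - x\<bar> < \<rho>"
    from series[OF this] show "(\<lambda>n. s n * of_real ((t - x) ^ n)) sums cusp_int m f p t" by simp
  qed
qed

end

section \<open>The false theta series as a quantum modular form\<close>

context periodic_theta
begin

lemma utheta_half_sgn_holomorphic: "utheta m 0 (half_sgn f) holomorphic_on {\<tau>. Im \<tau> > 0}"
  by (rule utheta_holomorphic[OF m half_sgn_bound])

definition false_theta_limit :: "real \<Rightarrow> complex" where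
  "false_theta_limit x = cusp_int m f x x / (2 * of_real (sqrt (2 * of_int m)) * sqrt_phase)"

lemma false_theta_limit:
  assumes "x \<in> \<rat>"
  shows "((\<lambda>y. utheta m 0 (half_sgn f) (Complex x y)) \<longlongrightarrow> false_theta_limit x) (at_right 0)"
proof -
  let ?c = "2 * complex_of_real (sqrt (2 * of_int m)) * sqrt_phase"
  have c: "?c \<noteq> 0" using m sqrt_phase_nonzero by simp
  have "((\<lambda>y. ?c * utheta m 0 (half_sgn f) (Complex x y) / ?c) \<longlongrightarrow> cusp_int m f x x / ?c) (at_right 0)"
    by (intro tendsto_divide false_theta_radial_limit assms tendsto_const c)
  then show ?thesis unfolding false_theta_limit_def nonzero_mult_div_cancel_left[OF c] .
qed

text \<open>The scalar \<kappa> is that of the weight 3/2 series, whose integral represents the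
  limit values. For c = 0 these are invariant under the translation up to \<kappa> and the error is
  0; otherwise it is the integral from the cusp -d/c.\<close>

lemma false_theta_limit_error:
  assumes \<gamma>: "\<gamma> \<in> Gamma_cong (4 * m)"
  obtains \<kappa> h where "norm \<kappa> = 1" "smooth_R h" "\<And>x. mob_denom \<gamma> x \<noteq> 0 \<Longrightarrow> real_analytic_at h x"
    "\<And>x. x \<in> \<rat> \<Longrightarrow> mob_denom \<gamma> x \<noteq> 0 \<Longrightarrow> h x = false_theta_limit x - real_automorphy (1/2) \<gamma> x / \<kappa> * false_theta_limit (mob \<gamma> x)"
proof -
  define a b c d where "a = \<gamma> $$ (0,0)" and "b = \<gamma> $$ (0,1)" and "c = \<gamma> $$ (1,0)" and "d = \<gamma> $$ (1,1)"
  note entries = a_def b_def c_def d_def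
  have det: "a * d - b * c = 1" unfolding entries by (rule Gamma_cong_entries(1)[OF \<gamma>])
  have cong: "4 * m dvd a - 1" "4 * m dvd b" "4 * m dvd c" "4 * m dvd d - 1"
    unfolding entries by (rule Gamma_cong_entries(2-5)[OF \<gamma>])+
  have denom: "mob_denom \<gamma> x = of_int c * x + of_int d" for x :: real by (simp only: mob_denom_def entries)
  have mob: "mob \<gamma> x = (of_int a * x + of_int b) / (of_int c * x + of_int d)" for x :: real
    by (simp only: mob_def denom a_def b_def)
  obtain \<kappa> where \<kappa>: "norm \<kappa> = 1"
    "\<And>\<tau>. Im \<tau> > 0 \<Longrightarrow> utheta m 1 f ((of_int a * \<tau> + of_int b) / (of_int c * \<tau> + of_int d)) =
      \<kappa> * (of_int c * \<tau> + of_int d) powr (1 / 2 + of_nat 1) * utheta m 1 f \<tau>"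
    by (rule utheta_Gamma[where f = f and j = 1, OF m f det cong order_refl]) (rule that)
  have \<kappa>0: "\<kappa> \<noteq> 0" using \<kappa>(1) by auto
  let ?c = "2 * complex_of_real (sqrt (2 * of_int m)) * sqrt_phase"
  show ?thesis
  proof (cases "c = 0")
    case True
    have "a = 1" "d = 1" by (rule unipotent_if_lower_left_0[OF m det True cong(4)])+
    have inv: "utheta m 1 f (Complex (x + of_int b) t) = \<kappa> * utheta m 1 f (Complex x t)" if "t > 0" for x t
    proof -
      have "Complex (x + of_int b) t = (of_int a * Complex x t + of_int b) / (of_int c * Complex x t + of_int d)"
        by (simp add: True \<open>d = 1\<close> \<open>a = 1\<close> complex_eq_iff)
      also have "utheta m 1 f \<dots> = \<kappa> * (of_int c * Complex x t + of_int d) powr (1 / 2 + of_nat 1) * utheta m 1 f (Complex x t)"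
        using that by (intro \<kappa>(2)) simp
      finally show ?thesis by (simp add: True \<open>d = 1\<close>)
    qed
    have "cusp_int m f (x + of_int b) (x + of_int b) = \<kappa> * cusp_int m f x x" for x
    proof -
      have "cusp_int m f (x + of_int b) (x + of_int b) = (LINT t:{0<..}|lborel. \<kappa> * (utheta m 1 f (Complex x t) * (Complex (x - x) t powr (- 1 / 2) * \<i>)))"
        unfolding cusp_int_def by (rule set_lebesgue_integral_cong) (auto simp: inv[simplified])
      also have "\<dots> = \<kappa> * cusp_int m f x x"
        unfolding cusp_int_def by (rule set_integral_mult_right)
      finally show ?thesis .
    qed
    then have lim: "false_theta_limit (x + of_int b) = \<kappa> * false_theta_limit x" for x
      by (simp add: false_theta_limit_def)
    have aut: "real_automorphy (1/2) \<gamma> x = 1" for x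
    proof -
      have "mob_denom \<gamma> (Complex x (- y)) powr of_real (- (1/2)) = 1" for y
      proof -
        have "mob_denom \<gamma> (Complex x (- y)) = of_int c * Complex x (- y) + of_int d" by (simp only: mob_denom_def entries)
        then show ?thesis by (simp add: True \<open>d = 1\<close>)
      qed
      then show ?thesis unfolding real_automorphy_def by (simp add: tendsto_Lim)
    qed
    show ?thesis
    proof (rule that[OF \<kappa>(1), of "\<lambda>_. 0"])
      show "smooth_R (\<lambda>_. 0)"
        unfolding smooth_R_def by (intro exI[of _ "\<lambda>_ _. 0"]) auto
      show "real_analytic_at (\<lambda>_. 0) x" for x
        unfolding real_analytic_at_def by (intro exI[of _ 1] conjI exI[of _ "\<lambda>_. 0"]) auto
      show "0 = false_theta_limit x - real_automorphy (1/2) \<gamma> x / \<kappa> * false_theta_limit (mob \<gamma> x)" for x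
        using \<kappa>0 lim[of x] by (simp add: aut mob True \<open>d = 1\<close> \<open>a = 1\<close>)
    qed
  next
    case False
    define p where "p = - of_int d / (of_int c :: real)"
    have p: "p \<in> \<rat>" by (simp add: p_def)
    define h where "h x = cusp_int m f p x * (1 / ?c)" for x
    show ?thesis
    proof (rule that[OF \<kappa>(1), of h])
      obtain D where D: "D 0 = cusp_int m f p" "\<And>n x. (D n has_vector_derivative D (Suc n) x) (at x)"
        using cusp_int_smooth[OF p] unfolding smooth_R_def by blast
      have "((\<lambda>x. D n x * (1 / ?c)) has_vector_derivative D (Suc n) x * (1 / ?c)) (at x)" for n x
        by (rule has_vector_derivative_mult_left[OF D(2)])
      then show "smooth_R h"
        unfolding smooth_R_def by (intro exI[of _ "\<lambda>n x. D n x * (1 / ?c)"] conjI allI) (auto simp: D(1) h_def)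
    next
      fix x :: real assume x: "mob_denom \<gamma> x \<noteq> 0"
      then have "x \<noteq> p" using False by (auto simp: denom p_def)
      from cusp_int_analytic[OF p this] obtain r s where "r > 0" and s: "\<And>t. \<bar>t - x\<bar> < r \<Longrightarrow> (\<lambda>n. s n * of_real ((t - x) ^ n)) sums cusp_int m f p t"
        unfolding real_analytic_at_def by blast
      show "real_analytic_at h x"
        unfolding real_analytic_at_def
      proof (intro exI[of _ r] exI[of _ "\<lambda>n. s n * (1 / ?c)"] conjI allI impI \<open>r > 0\<close>)
        fix t assume "\<bar>t - x\<bar> < r"
        from sums_mult2[OF s[OF this], of "1 / ?c"]
        show "(\<lambda>n. s n * (1 / ?c) * of_real ((t - x) ^ n)) sums h t"
          by (simp only: h_def mult_ac)
      qed
    next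
      fix x :: real assume x: "x \<in> \<rat>" and nz: "mob_denom \<gamma> x \<noteq> 0"
      have nz': "of_int c * x + of_int d \<noteq> 0" using nz by (simp only: denom not_False_eq_True)
      have split: "cusp_int m f x x - real_automorphy (1/2) \<gamma> x / \<kappa> * cusp_int m f ((of_int a * x + of_int b) / (of_int c * x + of_int d)) ((of_int a * x + of_int b) / (of_int c * x + of_int d)) =
          cusp_int m f (- of_int d / of_int c) x"
      proof (rule cusp_transform[OF det False x nz' \<kappa>0])
        show "real_automorphy (1/2) \<gamma> x \<noteq> 0"
          by (rule real_automorphy_half(1)[OF det False nz' c_def[symmetric] d_def[symmetric]])
        show "((of_int a * \<sigma> + of_int b) / (of_int c * \<sigma> + of_int d) - of_real ((of_int a * x + of_int b) / (of_int c * x + of_int d))) powr (- 1 / 2)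
          * (of_int c * \<sigma> + of_int d) powr (- 1 / 2) * real_automorphy (1/2) \<gamma> x = (\<sigma> - of_real x) powr (- 1 / 2)" if "Im \<sigma> > 0" for \<sigma>
          by (rule real_automorphy_half(2)[OF det False nz' c_def[symmetric] d_def[symmetric] that])
        show "utheta m 1 f ((of_int a * \<sigma> + of_int b) / (of_int c * \<sigma> + of_int d)) =
          \<kappa> * (of_int c * \<sigma> + of_int d) powr (3 / 2) * utheta m 1 f \<sigma>" if "Im \<sigma> > 0" for \<sigma>
          using \<kappa>(2)[OF that] by simp
      qed
      have "(A - e * B) * (1 / C) = A / C - e * (B / C)" for A B C e :: complex
        by (simp add: diff_divide_distrib)
      then show "h x = false_theta_limit x - real_automorphy (1/2) \<gamma> x / \<kappa> * false_theta_limit (mob \<gamma> x)"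
        unfolding h_def p_def false_theta_limit_def mob split[symmetric] .
    qed
  qed
qed

lemma quantum_modular_false_theta:
  "quantum_modular_form (Gamma_cong (4 * m)) (1/2) (utheta m 0 (half_sgn f))"
proof -
  let ?f = false_theta_limit
  have "\<exists>v. norm v = 1 \<and> (\<exists>h. smooth_R h \<and> (\<forall>x. mob_denom \<gamma> x \<noteq> 0 \<longrightarrow> real_analytic_at h x) \<and>
        (\<forall>x\<in>\<rat>. mob_denom \<gamma> x \<noteq> 0 \<longrightarrow> h x = ?f x - cnj v * slash_R (1/2) \<gamma> ?f x))"
    if \<gamma>: "\<gamma> \<in> Gamma_cong (4 * m)" for \<gamma>
  proof -
    obtain \<kappa> h where \<kappa>: "norm \<kappa> = 1" and h: "smooth_R h" "\<And>x. mob_denom \<gamma> x \<noteq> 0 \<Longrightarrow> real_analytic_at h x"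
      "\<And>x. x \<in> \<rat> \<Longrightarrow> mob_denom \<gamma> x \<noteq> 0 \<Longrightarrow> h x = ?f x - real_automorphy (1/2) \<gamma> x / \<kappa> * ?f (mob \<gamma> x)"
      by (rule false_theta_limit_error[OF \<gamma>]) (rule that)
    have tf: "norm (theta_factor (1/2) \<gamma>) = 1" by (rule theta_factor_half_norm[OF Gamma_cong_entries(1)[OF \<gamma>]])
    have tf0: "theta_factor (1/2) \<gamma> \<noteq> 0" using tf by auto
    define v where "v = cnj (1 / (theta_factor (1/2) \<gamma> * \<kappa>))"
    have "cnj v * slash_R (1/2) \<gamma> ?f x = real_automorphy (1/2) \<gamma> x / \<kappa> * ?f (mob \<gamma> x)" for x
      using tf0 by (simp add: v_def slash_R_def)
    moreover have "norm v = 1" by (simp only: v_def complex_mod_cnj norm_divide norm_mult tf \<kappa>) simp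
    ultimately show ?thesis using h by (intro exI[of _ v] exI[of _ h] conjI) auto
  qed
  then obtain v where v: "\<And>\<gamma>. \<gamma> \<in> Gamma_cong (4 * m) \<Longrightarrow> norm (v \<gamma>) = 1 \<and>
      (\<exists>h. smooth_R h \<and> (\<forall>x. mob_denom \<gamma> x \<noteq> 0 \<longrightarrow> real_analytic_at h x) \<and>
        (\<forall>x\<in>\<rat>. mob_denom \<gamma> x \<noteq> 0 \<longrightarrow> h x = ?f x - cnj (v \<gamma>) * slash_R (1/2) \<gamma> ?f x))"
    by metis
  show ?thesis
    unfolding quantum_modular_form_def
  proof (intro conjI exI[of _ v] exI[of _ "\<rat>"] exI[of _ ?f] ballI)
    show "utheta m 0 (half_sgn f) holomorphic_on {\<tau>. Im \<tau> > 0}" by (rule utheta_half_sgn_holomorphic)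
    show "multiplier (Gamma_cong (4 * m)) v" unfolding multiplier_def using v by blast
    \<comment> \<open>The exceptional set is empty, since the limits exist at every
      rational.\<close>
    show "quantum_domain (Gamma_cong (4 * m)) \<rat>"
      unfolding quantum_domain_def by (intro exI[of _ "{}"]) (auto simp: discrete_def)
    show "((\<lambda>y. utheta m 0 (half_sgn f) (Complex x y)) \<longlongrightarrow> ?f x) (at_right 0)" if "x \<in> \<rat>" for x
      using that by (rule false_theta_limit)
    show "quantum_modular_mult (Gamma_cong (4 * m)) (1/2) v \<rat> ?f"
      unfolding quantum_modular_mult_def
    proof
      fix \<gamma> assume "\<gamma> \<in> Gamma_cong (4 * m)"
      from v[OF this] show "\<exists>h. smooth_R h \<and> (\<forall>x. mob_denom \<gamma> x \<noteq> 0 \<longrightarrow> real_analytic_at h x) \<and>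
        (\<forall>x\<in>\<rat>. mob_denom \<gamma> x \<noteq> 0 \<longrightarrow> h x = ?f x - cnj (v \<gamma>) * slash_R (1/2) \<gamma> ?f x)" by (rule conjunct2)
    qed
  qed
qed

end

section \<open>Expansions of the rational function\<close>

text \<open>Compare coefficients in (N / D) * D = N. The sign of A is left open so that, with -A in
  place of A, the expansion at infinity is covered too.\<close>

lemma laurent_expansion_quotient_recurrence:
  fixes A :: int and \<omega> :: complex and C :: "'a \<Rightarrow> complex"
  assumes "A \<noteq> 0" "\<omega> \<noteq> 0" "finite I"
  obtains F where
    "(\<lambda>z. (\<Sum>i\<in>I. C i * z powi e i) / (z powi A * inverse \<omega> - z powi (- A) * \<omega>)) has_laurent_expansion F"
    "\<And>n. fls_nth F (n - A) * inverse \<omega> - fls_nth F (n + A) * \<omega> = (\<Sum>i\<in>I. if e i = n then C i else 0)"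
proof -
  define N where "N = (\<Sum>i\<in>I. fls_const (C i) * fls_X_intpow (e i))"
  define D where "D = fls_X_intpow A * fls_const (inverse \<omega>) - fls_X_intpow (- A) * fls_const \<omega>"
  have "(\<lambda>z. (\<Sum>i\<in>I. C i * z powi e i)) has_laurent_expansion N"
    unfolding N_def by (intro laurent_expansion_intros)
  moreover have "(\<lambda>z. z powi A * inverse \<omega> - z powi (- A) * \<omega>) has_laurent_expansion D"
    unfolding D_def by (intro laurent_expansion_intros)
  ultimately have expansion: "(\<lambda>z. (\<Sum>i\<in>I. C i * z powi e i) / (z powi A * inverse \<omega> - z powi (- A) * \<omega>)) has_laurent_expansion N / D"
    by (rule has_laurent_expansion_divide)
  have nth_mult: "fls_nth (F * D) n = fls_nth F (n - A) * inverse \<omega> - fls_nth F (n + A) * \<omega>" for F n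
  proof -
    have "F * D = (fls_X_intpow A * F) * fls_const (inverse \<omega>) - (fls_X_intpow (- A) * F) * fls_const \<omega>"
      by (simp only: D_def right_diff_distrib mult_ac)
    moreover have "fls_X_intpow A * F = fls_shift (- A) F" "fls_X_intpow (- A) * F = fls_shift A F"
      using fls_X_intpow_times_conv_shift(1)[of A F] fls_X_intpow_times_conv_shift(1)[of "- A" F] by simp_all
    ultimately show ?thesis by (simp only:) simp
  qed
  \<comment> \<open>Multiplying the series 1 by D reads off a coefficient of D; A \<noteq> 0 keeps
    its two monomials apart, so D is not zero.\<close>
  have "fls_nth (1 * D) (- A) = - \<omega>"
    using assms(1) unfolding nth_mult by simp
  then have "D \<noteq> 0" using assms(2) by auto
  then have "N / D * D = N" by simp
  moreover have "fls_nth N n = (\<Sum>i\<in>I. if e i = n then C i else 0)" for n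
  proof -
    have "fls_nth (\<Sum>i\<in>I. H i) n = (\<Sum>i\<in>I. fls_nth (H i) n)" for H :: "'a \<Rightarrow> complex fls"
      using assms(3) by (induction I) auto
    then show ?thesis
      unfolding N_def by (auto simp: fls_X_intpow_times_conv_shift intro!: sum.cong)
  qed
  ultimately show ?thesis
    using that[OF expansion] nth_mult[of "N / D"] by simp
qed

lemma prod_power_int: "z \<noteq> 0 \<Longrightarrow> (\<Prod>i\<in>X. z powi e i) = z powi (\<Sum>i\<in>X. e i)" for z :: complex
  by (induction X rule: infinite_finite_induct) (auto simp: power_int_add)

text \<open>With coefficients u at 0 and v at infinity, (1 - y) u + y v = (u + v)/2 + (1/2 - y)(u -
  v). Far to the right v vanishes and far to the left u does, so (u + v)/2 is half of sgn n (u - v)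
  there; \<open>d\<close> collects the finitely many exceptions.\<close>

lemma f0_coefficients:
  fixes a :: "nat \<Rightarrow> int" and \<omega> :: complex and j :: nat
  assumes A: "seifert_A a > 0" and "j \<ge> 1" and \<omega>: "\<omega> ^ (2 * j) = 1"
  obtains c d :: "int \<Rightarrow> complex" and X where
    "\<And>n. c (n + 2 * (seifert_A a * int j)) = c n" "finite X" "\<And>n. n \<notin> X \<Longrightarrow> d n = 0"
    "\<And>y n. avg_expansion y (f0 a \<omega>) n = d n + half_sgn c n + (1/2 - of_real y) * c n"
proof -
  define A where "A = seifert_A a"
  have A: "A > 0" using A by (simp add: A_def)
  have \<omega>0: "\<omega> \<noteq> 0" using \<omega> \<open>j \<ge> 1\<close> by (auto simp: power_0_left)
  define \<alpha> where "\<alpha> i = A div a i" for i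
  let ?J = "{1..3} :: nat set"
  let ?I = "Pow ?J"
  \<comment> \<open>The product is expanded over the set X of those factors that contribute their
    first term, which gives eight monomials.\<close>
  define C where "C X = (\<Prod>i\<in>X. inverse \<omega>) * (\<Prod>i\<in>?J - X. - \<omega>)" for X
  define e where "e X = (\<Sum>i\<in>X. \<alpha> i) - (\<Sum>i\<in>?J - X. \<alpha> i)" for X
  have f0: "f0 a \<omega> z = (\<Sum>X\<in>?I. C X * z powi e X) / (z powi A * inverse \<omega> - z powi (- A) * \<omega>)" if z: "z \<noteq> 0" for z
  proof -
    have "(\<Prod>i\<in>?J. z powi \<alpha> i * inverse \<omega> - z powi (- \<alpha> i) * \<omega>) =
        (\<Prod>i\<in>?J. z powi \<alpha> i * inverse \<omega> + z powi (- \<alpha> i) * (- \<omega>))"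
      by simp
    also have "\<dots> = (\<Sum>X\<in>?I. (\<Prod>i\<in>X. z powi \<alpha> i * inverse \<omega>) * (\<Prod>i\<in>?J - X. z powi (- \<alpha> i) * (- \<omega>)))"
      by (rule prod_add) simp
    also have "\<dots> = (\<Sum>X\<in>?I. C X * z powi e X)"
    proof (rule sum.cong[OF refl])
      fix X
      have "(\<Prod>i\<in>X. z powi \<alpha> i * inverse \<omega>) * (\<Prod>i\<in>?J - X. z powi (- \<alpha> i) * (- \<omega>)) =
          C X * (z powi (\<Sum>i\<in>X. \<alpha> i) * z powi (\<Sum>i\<in>?J - X. - \<alpha> i))"
        unfolding prod.distrib prod_power_int[OF z] C_def by (simp only: mult_ac)
      also have "z powi (\<Sum>i\<in>X. \<alpha> i) * z powi (\<Sum>i\<in>?J - X. - \<alpha> i) = z powi e X"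
        using z by (simp add: e_def sum_negf flip: power_int_add)
      finally show "(\<Prod>i\<in>X. z powi \<alpha> i * inverse \<omega>) * (\<Prod>i\<in>?J - X. z powi (- \<alpha> i) * (- \<omega>)) = C X * z powi e X" .
    qed
    finally show ?thesis unfolding f0_def \<alpha>_def A_def by simp
  qed
  have finI: "finite ?I" by simp
  obtain F where F: "(\<lambda>z. (\<Sum>X\<in>?I. C X * z powi e X) / (z powi A * inverse \<omega> - z powi (- A) * \<omega>)) has_laurent_expansion F"
    and Frec: "\<And>n. fls_nth F (n - A) * inverse \<omega> - fls_nth F (n + A) * \<omega> = (\<Sum>X\<in>?I. if e X = n then C X else 0)"
    by (rule laurent_expansion_quotient_recurrence[of A \<omega> ?I C e]) (use A \<omega>0 in auto)
  \<comment> \<open>In the variable w = 1/z all exponents change sign, including those of the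
    denominator.\<close>
  obtain G where G: "(\<lambda>z. (\<Sum>X\<in>?I. C X * z powi (- e X)) / (z powi (- A) * inverse \<omega> - z powi (- (- A)) * \<omega>)) has_laurent_expansion G"
    and Grec: "\<And>n. fls_nth G (n - (- A)) * inverse \<omega> - fls_nth G (n + (- A)) * \<omega> = (\<Sum>X\<in>?I. if - e X = n then C X else 0)"
    by (rule laurent_expansion_quotient_recurrence[of "- A" \<omega> ?I C "\<lambda>X. - e X"]) (use A \<omega>0 in auto)
  have nz: "eventually (\<lambda>z :: complex. z \<noteq> 0) (at 0)" by (simp add: eventually_at_filter)
  have LF: "laurent_expansion (f0 a \<omega>) 0 = F"
  proof (rule laurent_expansion_eqI)
    have "eventually (\<lambda>z. f0 a \<omega> (0 + z) = (\<Sum>X\<in>?I. C X * z powi e X) / (z powi A * inverse \<omega> - z powi (- A) * \<omega>)) (at 0)"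
      using nz by eventually_elim (simp only: add_0_left f0 not_False_eq_True)
    then show "(\<lambda>z. f0 a \<omega> (0 + z)) has_laurent_expansion F"
      using F by (subst has_laurent_expansion_cong) auto
  qed
  have LG: "laurent_expansion (\<lambda>w. f0 a \<omega> (inverse w)) 0 = G"
  proof (rule laurent_expansion_eqI)
    have "eventually (\<lambda>w. f0 a \<omega> (inverse (0 + w)) = (\<Sum>X\<in>?I. C X * w powi (- e X)) / (w powi (- A) * inverse \<omega> - w powi (- (- A)) * \<omega>)) (at 0)"
      using nz
    proof eventually_elim
      case (elim w)
      have "inverse w powi k = w powi (- k)" for k by (simp add: power_int_minus power_int_inverse)
      moreover have "inverse w \<noteq> 0" using elim by simp
      ultimately show ?case by (simp only: add_0_left f0 not_False_eq_True)
    qed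
    then show "(\<lambda>w. f0 a \<omega> (inverse (0 + w))) has_laurent_expansion G"
      using G by (subst has_laurent_expansion_cong) auto
  qed
  define u where "u n = fls_nth F n" for n
  define v where "v n = fls_nth G (- n)" for n
  define c where "c n = u n - v n" for n
  define d where "d n = (u n + v n) / 2 - half_sgn c n" for n
  \<comment> \<open>The inhomogeneous terms cancel in u - v, which leaves multiplication by
    \<omega>^(-2) under n to n + 2A; after j steps the factor is 1.\<close>
  have step: "c (n + 2 * A) = c n * inverse \<omega> ^ 2" for n
  proof -
    have "u n * inverse \<omega> - u (n + 2 * A) * \<omega> = (\<Sum>X\<in>?I. if e X = n + A then C X else 0)"
      using Frec[of "n + A"] by (simp add: u_def add.assoc)
    moreover have "v n * inverse \<omega> - v (n + 2 * A) * \<omega> = (\<Sum>X\<in>?I. if e X = n + A then C X else 0)"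
    proof -
      have "fls_nth G (- (n + A) - (- A)) * inverse \<omega> - fls_nth G (- (n + A) + (- A)) * \<omega> = (\<Sum>X\<in>?I. if - e X = - (n + A) then C X else 0)"
        by (rule Grec)
      moreover have "- (n + A) - (- A) = - n" "- (n + A) + (- A) = - (n + 2 * A)" "- e X = - (n + A) \<longleftrightarrow> e X = n + A" for X
        by auto
      ultimately show ?thesis by (simp only: v_def)
    qed
    ultimately have "c n * inverse \<omega> = c (n + 2 * A) * \<omega>"
      by (simp add: c_def algebra_simps)
    then show ?thesis using \<omega>0 by (simp add: power2_eq_square field_simps)
  qed
  have "c (n + 2 * A * int k) = c n * (inverse \<omega> ^ 2) ^ k" for n k
  proof (induction k)
    case (Suc k)
    have "n + 2 * A * int (Suc k) = (n + 2 * A * int k) + 2 * A" by (simp add: algebra_simps)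
    then show ?case using Suc step[of "n + 2 * A * int k"] by (simp add: add.assoc)
  qed simp
  from this[of _ j] have per: "c (n + 2 * (A * int j)) = c n" for n
    using \<omega> by (simp add: power_mult[symmetric] power_inverse mult.assoc)
  define X where "X = {- (\<bar>fls_subdegree F\<bar> + \<bar>fls_subdegree G\<bar>) .. \<bar>fls_subdegree F\<bar> + \<bar>fls_subdegree G\<bar>}"
  have d0: "d n = 0" if n: "n \<notin> X" for n
  proof -
    consider "n < - (\<bar>fls_subdegree F\<bar> + \<bar>fls_subdegree G\<bar>)" | "n > \<bar>fls_subdegree F\<bar> + \<bar>fls_subdegree G\<bar>"
      using n unfolding X_def atLeastAtMost_iff by linarith
    then show ?thesis
    proof cases
      case 1
      then have "u n = 0" unfolding u_def by (intro fls_eq0_below_subdegree) linarith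
      moreover have "n < 0" using 1 by linarith
      ultimately show ?thesis by (simp add: d_def c_def half_sgn_def)
    next
      case 2
      then have "v n = 0" unfolding v_def by (intro fls_eq0_below_subdegree) linarith
      moreover have "n > 0" using 2 by linarith
      ultimately show ?thesis by (simp add: d_def c_def half_sgn_def)
    qed
  qed
  show ?thesis
  proof (rule that[of c X d])
    show "c (n + 2 * (seifert_A a * int j)) = c n" for n using per[of n] by (simp add: A_def)
    show "finite X" by (simp add: X_def)
    show "d n = 0" if "n \<notin> X" for n using that by (rule d0)
    show "avg_expansion y (f0 a \<omega>) n = d n + half_sgn c n + (1/2 - of_real y) * c n" for y n
      unfolding avg_expansion_def LF LG u_def[symmetric] v_def[symmetric] d_def
      by (simp add: c_def algebra_simps add_divide_distrib diff_divide_distrib)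
  qed
qed

text \<open>Reindex by k = jn: terms with k not divisible by j vanish, and (jn)^2/(4Aj^2) =
  n^2/(4A).\<close>

lemma laplace_sum_utheta:
  fixes A :: int and j :: nat and b c :: "int \<Rightarrow> complex"
  assumes A: "A > 0" and j: "j \<ge> 1" and \<tau>: "Im \<tau> > 0"
    and b: "\<And>n. norm (b n) \<le> B" "\<And>n. b (int j * n) = c n" "\<And>k. \<not> int j dvd k \<Longrightarrow> b k = 0"
  shows "laplace_sum A c \<tau> (utheta (A * int j ^ 2) 0 b \<tau>)"
proof -
  define m where "m = A * int j ^ 2"
  have m: "m > 0" using A j by (simp add: m_def)
  let ?T = "\<lambda>k. b k * of_int k ^ 0 * exp (- of_real pi * of_int k ^ 2 * (- \<i> * \<tau> / (2 * of_int m)))"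
  have "(?T has_sum utheta m 0 b \<tau>) UNIV"
    unfolding utheta_def by (rule gtheta_has_sum[OF b(1)]) (use \<tau> m in \<open>simp only: Re_utheta_arg, simp\<close>)
  also have "(?T has_sum utheta m 0 b \<tau>) UNIV \<longleftrightarrow> (?T has_sum utheta m 0 b \<tau>) (range (\<lambda>n. int j * n))"
    by (rule has_sum_cong_neutral) (use b(3) in \<open>auto simp: image_iff dvd_def\<close>)
  also have "\<dots> \<longleftrightarrow> ((?T \<circ> (\<lambda>n. int j * n)) has_sum utheta m 0 b \<tau>) UNIV"
    using j by (intro has_sum_reindex) (auto simp: inj_on_def)
  also have "?T \<circ> (\<lambda>n. int j * n) = (\<lambda>n. c n * q_pow (of_int (n\<^sup>2) / (4 * of_int A)) \<tau>)"
  proof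
    fix n
    have "- of_real pi * of_int (int j * n) ^ 2 * (- \<i> * \<tau> / (2 * of_int m)) =
        2 * of_real pi * \<i> * of_real (of_int (n\<^sup>2) / (4 * of_int A)) * \<tau>"
      using A j by (simp add: m_def field_simps power2_eq_square)
    then show "(?T \<circ> (\<lambda>n. int j * n)) n = c n * q_pow (of_int (n\<^sup>2) / (4 * of_int A)) \<tau>"
      by (simp only: o_def b(2) q_pow_def power_0 mult_1_right)
  qed
  finally show ?thesis by (simp only: laplace_sum_def m_def)
qed

theorem theorem1p6:
  fixes b0 :: int and a b :: "nat \<Rightarrow> int" and c :: "nat \<Rightarrow> int list"
    and j :: nat and \<omega> :: complex
  assumes "seifert_data a b c"
    and "negative_definite (plumbing_matrix b0 c)"
    and "first_betti b0 c = 0"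
    and "j \<ge> 1"
    and "\<omega> ^ (2 * j) = 1"
  shows "\<exists>\<theta> \<Theta>.
    quantum_modular_form (Gamma_cong (4 * seifert_A a * int j ^ 2)) (1/2) \<theta> \<and>
    modular_form (Gamma_cong (4 * seifert_A a * int j ^ 2)) (1/2) \<Theta> \<and>
    (\<forall>W. admissible_family W \<longrightarrow>
      (\<exists>p. q_polynomial (seifert_A a) p \<and>
        (\<forall>\<tau>. Im \<tau> > 0 \<longrightarrow>
          laplace_sum (seifert_A a) (avg_expansion (W 3 1) (f0 a \<omega>)) \<tau>
            (p \<tau> + \<theta> \<tau> + (1/2 - of_real (W 3 1)) * \<Theta> \<tau>))))"
proof -
  let ?A = "seifert_A a"
  have A: "?A > 0"
    using assms(1) unfolding seifert_A_def seifert_data_def by (intro prod_pos) blast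
  obtain c d X where c: "\<And>n. c (n + 2 * (?A * int j)) = c n" and X: "finite X" "\<And>n. n \<notin> X \<Longrightarrow> d n = 0"
    and avg: "\<And>y n. avg_expansion y (f0 a \<omega>) n = d n + half_sgn c n + (1/2 - of_real y) * c n"
    by (rule f0_coefficients[OF A assms(4,5)]) (rule that)
  define m where "m = ?A * int j ^ 2"
  \<comment> \<open>The coefficients c are placed on the multiples of j; their period 2Aj becomes
    2Aj^2 = 2m.\<close>
  define f where "f k = (if int j dvd k then c (k div int j) else 0)" for k
  have m: "m > 0" using A assms(4) by (simp add: m_def)
  have per: "f (k + 2 * m) = f k" for k
  proof -
    have "2 * m = int j * (2 * (?A * int j))" by (simp add: m_def power2_eq_square)
    then have "int j dvd k + 2 * m \<longleftrightarrow> int j dvd k" "(k + 2 * m) div int j = k div int j + 2 * (?A * int j)"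
      using assms(4) by (simp_all only: dvd_add_left_iff dvd_triv_left) simp
    then show ?thesis by (simp only: f_def c)
  qed
  interpret periodic_theta m f by unfold_locales (rule m, rule per)
  have level: "4 * m = 4 * seifert_A a * int j ^ 2" by (simp add: m_def)
  have fj: "f (int j * n) = c n" "half_sgn f (int j * n) = half_sgn c n" for n
    using assms(4) by (auto simp: f_def half_sgn_def sgn_mult)
  have f0: "f k = 0" "half_sgn f k = 0" if "\<not> int j dvd k" for k
    using that by (auto simp: f_def half_sgn_def)
  define p where "p \<tau> = (\<Sum>n\<in>X. d n * q_pow (of_int (n\<^sup>2) / (4 * of_int ?A)) \<tau>)" for \<tau>
  \<comment> \<open>The weight y stays arbitrary here, so the two forms can be fixed before the
    admissible family is chosen.\<close>
  have "laplace_sum ?A (avg_expansion y (Defs.f0 a \<omega>)) \<tau> (p \<tau> + utheta m 0 (half_sgn f) \<tau> + (1/2 - of_real y) * utheta m 0 f \<tau>)"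
    if \<tau>: "Im \<tau> > 0" for y \<tau>
  proof -
    let ?q = "\<lambda>n :: int. q_pow (of_int (n\<^sup>2) / (4 * of_int ?A)) \<tau>"
    have "((\<lambda>n. d n * ?q n) has_sum p \<tau>) UNIV"
      by (rule has_sum_finite_neutralI[OF X(1)]) (auto simp: X(2) p_def)
    moreover have "((\<lambda>n. half_sgn c n * ?q n) has_sum utheta m 0 (half_sgn f) \<tau>) UNIV"
      using laplace_sum_utheta[where b = "half_sgn f" and c = "half_sgn c", OF A assms(4) \<tau> half_sgn_bound fj(2) f0(2)] unfolding m_def laplace_sum_def .
    moreover have "((\<lambda>n. c n * ?q n) has_sum utheta m 0 f \<tau>) UNIV"
      using laplace_sum_utheta[where b = f and c = c, OF A assms(4) \<tau> coeff_bound(2) fj(1) f0(1)] unfolding m_def laplace_sum_def .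
    ultimately have "((\<lambda>n. d n * ?q n + half_sgn c n * ?q n + (1/2 - of_real y) * (c n * ?q n)) has_sum
        (p \<tau> + utheta m 0 (half_sgn f) \<tau> + (1/2 - of_real y) * utheta m 0 f \<tau>)) UNIV"
      by (intro has_sum_add has_sum_cmult_right)
    then show ?thesis by (simp only: laplace_sum_def avg distrib_right mult.assoc)
  qed
  moreover have "q_polynomial ?A p"
    unfolding q_polynomial_def using X(1) by (intro exI[of _ X] exI[of _ d] conjI) (auto simp: p_def)
  ultimately show ?thesis
    using quantum_modular_false_theta modular_form_utheta[where f = f, OF m per] unfolding level
    by (intro exI[of _ "utheta m 0 (half_sgn f)"] exI[of _ "utheta m 0 f"] conjI allI impI exI[of _ p])
qed

end
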